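(* If $m\geq 5$ is a prime and $k\in\{3,5\}$, then there are infinitely many positive integers $n$ for which $b_k(n)\equiv 0\pmod m$. More precisely, $$\#\{0\leq n\leq X : b_k(n)\equiv 0 \pmod m\}\gg X.$$
   Context: For a positive integer $k$, $b_k(n)$ denotes the number of $k$-regular partitions of $n$, i.e. partitions of $n$ in which no part is a multiple of $k$; $\sum_{n\ge 0} b_k(n)q^n=\prod_{n\ge 1}\frac{1-q^{kn}}{1-q^n}$, with $b_3(0)=b_5(0)=1$. Here $f(X)\gg g(X)$ means that there is a constant $c>0$ (which may depend on $m$ and $k$) with $f(X)\ge c\,g(X)$ for all sufficiently large $X$. *)

theory Defs
  imports Complex_Main "HOL-Library.Multiset" "HOL-Number_Theory.Cong"
begin

text \<open>
  A partition of \<open>n\<close> is the finite multiset of its parts, which are positive integers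
  with sum \<open>n\<close>. The empty multiset is the partition of \<open>0\<close>.
\<close>

definition partitions :: "nat \<Rightarrow> nat multiset set" where
  "partitions n = {P. (\<forall>i \<in># P. 0 < i) \<and> \<Sum>\<^sub># P = n}"

definition regular_partitions :: "nat \<Rightarrow> nat \<Rightarrow> nat multiset set" where
  "regular_partitions k n = {P \<in> partitions n. \<forall>i \<in># P. \<not> k dvd i}"

definition b_reg :: "nat \<Rightarrow> nat \<Rightarrow> nat" where
  "b_reg k n = card (regular_partitions k n)"

text \<open>\<open>card\<close> is \<open>0\<close> on infinite sets; finiteness shows that \<open>b_reg\<close> is a genuine count.\<close>

lemma finite_partitions: "finite (partitions n)"
proof (rule finite_subset)
  show "partitions n \<subseteq> mset ` {xs. set xs \<subseteq> {..n} \<and> length xs \<le> n}"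
  proof
    fix P assume P: "P \<in> partitions n"
    obtain xs where xs: "P = mset xs" by (metis ex_mset)
    have pos: "\<forall>i \<in> set xs. 0 < i" and sum: "sum_list xs = n"
      using P by (auto simp: partitions_def xs sum_mset_sum_list)
    have "length ys \<le> sum_list ys" if "\<forall>i \<in> set ys. 0 < i" for ys :: "nat list"
      using that by (induction ys) auto
    with pos sum have "length xs \<le> n" by blast
    moreover have "set xs \<subseteq> {..n}"
      using sum member_le_sum_list by auto
    ultimately show "P \<in> mset ` {xs. set xs \<subseteq> {..n} \<and> length xs \<le> n}"
      using xs by blast
  qed
  show "finite (mset ` {xs. set xs \<subseteq> {..n} \<and> length xs \<le> n})"
    by (intro finite_imageI finite_lists_length_le) simp
qed

lemma finite_regular_partitions: "finite (regular_partitions k n)"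
  by (rule finite_subset[OF _ finite_partitions]) (auto simp: regular_partitions_def)

lemma b_reg_0: "b_reg k 0 = 1"
proof -
  have "P = {#}" if "\<forall>i \<in># P. 0 < i" "\<Sum>\<^sub># P = 0" for P :: "nat multiset"
    using that by (cases P) auto
  then have "regular_partitions k 0 = {{#}}"
    by (auto simp: regular_partitions_def partitions_def)
  then show ?thesis by (simp add: b_reg_def)
qed

end

theory Submission
  imports Defs "HOL-Complex_Analysis.Complex_Analysis"
begin

text \<open>
  Write \<open>f(z) = \<eta>(k z) / \<eta>(z)\<close>. Up to the factor \<open>q ^ ((k - 1) / 24)\<close> its expansion at infinity is the
  generating function of the \<open>b_k(n)\<close>. It is a modular function of weight \<open>0\<close>, with poles at some
  cusps. The idea is to replace it by a holomorphic modular form with congruent coefficients, and to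
  let a Hecke operator act on the form modulo \<open>m\<close>.

  For a prime \<open>m\<close> not dividing \<open>N = level k\<close>, the form \<open>H = T\<^sub>m (f \<Delta> ^ m) / \<Delta>\<close> is holomorphic at all cusps and
  has weight \<open>12 m - 12\<close>. As \<open>\<Delta>(z) ^ m\<close> and \<open>\<Delta>(m z)\<close> are congruent modulo \<open>m\<close>, the \<open>n\<close>-th coefficient of \<open>H\<close>
  is congruent to \<open>b_k((m n - k) / N)\<close> (lemma \<open>zeros_coprime_to_level\<close>). For \<open>m = k = 5\<close> the congruence of \<open>f\<close> with
  \<open>\<eta> ^ 4\<close> gives a form directly (lemma \<open>zeros_mod_5_of_5_regular\<close>).

  Now let \<open>l\<close> be another prime. The expansions with integral coefficients of the modular forms of a given weight
  form a group on which \<open>T\<^sub>l\<close> acts. A form vanishing to high order at infinity is zero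
  (lemma \<open>modular_form_eq_0\<close>, by taking the norm to level one and the maximum principle there), so the group is
  finitely generated and finite modulo \<open>m\<close>. The Hecke operators at the powers of \<open>l\<close> obey a two-step recursion that is invertible
  modulo \<open>m\<close>; it is therefore periodic, and one of these operators kills the form modulo \<open>m\<close>
  (lemma \<open>hecke_pigeonhole\<close>). This means that the coefficients of index \<open>l ^ K n\<close> with \<open>l\<close> not dividing \<open>n\<close>
  are divisible by \<open>m\<close> (lemma \<open>coefficients_vanish_mod_prime\<close>). These indices contain an
  arithmetic progression of zeros of \<open>b_k\<close> modulo \<open>m\<close>, which has positive density.

  The modular forms are built from the beginning. The transformation law of \<open>\<Delta>\<close>
  (lemma \<open>Delta_modular\<close>) follows from the inversion formula of the weight 2 Eisenstein series
  (lemma \<open>phi_transform\<close>), its logarithmic derivative. The 24th power of \<open>f\<close> is a quotient of values of \<open>\<Delta>\<close>, so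
  \<open>f\<close> transforms under \<open>\<Gamma>\<^sub>0(k)\<close> with roots of unity, which are computed on generators (lemma \<open>reg_eta_chi\<close>).
  The link with partitions is Euler's recurrence (lemma \<open>parts_expansion\<close>).
\<close>

section \<open>The modular group acting on the upper half plane\<close>

definition uhp :: "complex set" where "uhp = {z. 0 < Im z}"

lemma uhp_iff: "z \<in> uhp \<longleftrightarrow> 0 < Im z" by (simp add: uhp_def)
lemma open_uhp [simp]: "open uhp" unfolding uhp_def by (rule open_halfspace_Im_gt)
lemma convex_uhp: "convex uhp" unfolding uhp_def by (rule convex_halfspace_Im_gt)
lemma uhp_Im: "z \<in> uhp \<Longrightarrow> 0 < Im z" by (simp add: uhp_def)
lemma connected_uhp [simp]: "connected uhp" by (rule convex_connected[OF convex_uhp])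

datatype mat2 = Mat2 (ma: int) (mb: int) (mc: int) (md: int)

lemma mat2_eq_iff: "A = B \<longleftrightarrow> ma A = ma B \<and> mb A = mb B \<and> mc A = mc B \<and> md A = md B"
  by (cases A; cases B) auto

instantiation mat2 :: monoid_mult
begin
definition "1 = Mat2 1 0 0 1"
definition "A * B = Mat2 (ma A * ma B + mb A * mc B) (ma A * mb B + mb A * md B)
                         (mc A * ma B + md A * mc B) (mc A * mb B + md A * md B)"
instance by standard (auto simp: one_mat2_def times_mat2_def mat2_eq_iff algebra_simps)
end

lemma mat2_sel_times [simp]:
  "ma (A * B) = ma A * ma B + mb A * mc B" "mb (A * B) = ma A * mb B + mb A * md B"
  "mc (A * B) = mc A * ma B + md A * mc B" "md (A * B) = mc A * mb B + md A * md B"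
  by (simp_all add: times_mat2_def)

lemma mat2_sel_one [simp]: "ma 1 = 1" "mb 1 = 0" "mc 1 = 0" "md 1 = 1"
  by (simp_all add: one_mat2_def)

definition mdet :: "mat2 \<Rightarrow> int" where "mdet A = ma A * md A - mb A * mc A"
definition adj :: "mat2 \<Rightarrow> mat2" where "adj A = Mat2 (md A) (- mb A) (- mc A) (ma A)"

lemma mdet_mult [simp]: "mdet (A * B) = mdet A * mdet B"
  by (simp add: mdet_def algebra_simps)
lemma mdet_one [simp]: "mdet 1 = 1" by (simp add: mdet_def)
lemma mdet_Mat2 [simp]: "mdet (Mat2 a b c d) = a * d - b * c" by (simp add: mdet_def)
lemma mdet_adj [simp]: "mdet (adj A) = mdet A" by (simp add: mdet_def adj_def)
lemma adj_sel [simp]: "ma (adj A) = md A" "mb (adj A) = - mb A" "mc (adj A) = - mc A" "md (adj A) = ma A"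
  by (simp_all add: adj_def)
lemma mult_adj: "mdet A = 1 \<Longrightarrow> A * adj A = 1" "mdet A = 1 \<Longrightarrow> adj A * A = 1"
  by (auto simp: mat2_eq_iff mdet_def algebra_simps)

definition mact :: "mat2 \<Rightarrow> complex \<Rightarrow> complex" where
  "mact A z = (of_int (ma A) * z + of_int (mb A)) / (of_int (mc A) * z + of_int (md A))"
definition mj :: "mat2 \<Rightarrow> complex \<Rightarrow> complex" where
  "mj A z = of_int (mc A) * z + of_int (md A)"
text \<open>
  The weight \<open>w\<close> operator without the factor \<open>det ^ (w / 2)\<close>; for matrices of
  determinant \<open>p\<close> the missing power of \<open>p\<close> reappears in the Hecke operator.
\<close>

definition slash :: "nat \<Rightarrow> mat2 \<Rightarrow> (complex \<Rightarrow> complex) \<Rightarrow> complex \<Rightarrow> complex" where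
  "slash w A h z = h (mact A z) / mj A z ^ w"

lemma mj_nonzero: assumes "mdet A > 0" "z \<in> uhp" shows "mj A z \<noteq> 0"
proof
  assume *: "mj A z = 0"
  hence "Im (mj A z) = 0" by simp
  hence "mc A = 0" using assms by (simp add: mj_def uhp_iff)
  with * have "md A = 0" by (simp add: mj_def)
  with \<open>mc A = 0\<close> assms show False by (simp add: mdet_def)
qed

lemma Im_mact: assumes "mdet A > 0" "z \<in> uhp"
  shows "Im (mact A z) = of_int (mdet A) * Im z / norm (mj A z) ^ 2"
proof -
  obtain x y where z: "z = Complex x y" by (cases z)
  have num: "Im (of_int (ma A) * z + of_int (mb A)) * Re (mj A z) - Re (of_int (ma A) * z + of_int (mb A)) * Im (mj A z)
      = of_int (mdet A) * Im z"
    by (simp add: mj_def z mdet_def algebra_simps)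
  show ?thesis unfolding mact_def mj_def[symmetric] cmod_power2
    by (subst Im_divide) (simp only: num)
qed

lemma mact_uhp: "mdet A > 0 \<Longrightarrow> z \<in> uhp \<Longrightarrow> mact A z \<in> uhp"
  using mj_nonzero[of A z] Im_mact[of A z] by (simp add: uhp_iff)

lemma mj_mult: assumes "mdet B > 0" "z \<in> uhp"
  shows "mj (A * B) z = mj A (mact B z) * mj B z"
  using mj_nonzero[OF assms] unfolding mj_def mact_def by (simp add: field_simps)

lemma mact_mult: assumes "mdet A > 0" "mdet B > 0" "z \<in> uhp"
  shows "mact (A * B) z = mact A (mact B z)"
proof -
  let ?w = "mact B z"
  have B: "mj B z \<noteq> 0" and AB: "mj (A * B) z \<noteq> 0" using mj_nonzero assms by auto
  have "mj A ?w \<noteq> 0" using assms mj_nonzero mact_uhp by blast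
  have num: "of_int (ma (A*B)) * z + of_int (mb (A*B)) = (of_int (ma A) * ?w + of_int (mb A)) * mj B z"
    using B unfolding mact_def mj_def by (simp add: field_simps)
  have "mact (A * B) z = (of_int (ma (A*B)) * z + of_int (mb (A*B))) / mj (A*B) z"
    by (simp add: mact_def mj_def)
  also have "\<dots> = ((of_int (ma A) * ?w + of_int (mb A)) * mj B z) / (mj A ?w * mj B z)"
    by (simp only: num mj_mult[OF assms(2,3)])
  also have "\<dots> = mact A ?w" using B by (simp add: mact_def mj_def)
  finally show ?thesis .
qed

lemma slash_mult: assumes "mdet A > 0" "mdet B > 0" "z \<in> uhp"
  shows "slash w (A * B) h z = slash w B (slash w A h) z"
  using assms by (simp add: slash_def mact_mult mj_mult power_mult_distrib)

lemma mact_one [simp]: "mact 1 z = z" and mj_one [simp]: "mj 1 z = 1" and slash_one [simp]: "slash w 1 h z = h z"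
  by (simp_all add: mact_def mj_def slash_def)

lemma slash_cong: assumes "mdet A > 0" "z \<in> uhp" "\<And>z. z \<in> uhp \<Longrightarrow> h z = g z"
  shows "slash w A h z = slash w A g z"
  using assms by (simp add: slash_def mact_uhp)

lemma holomorphic_slash: assumes "h holomorphic_on uhp" "mdet A > 0"
  shows "slash w A h holomorphic_on uhp"
proof -
  have "mact A holomorphic_on uhp" unfolding mact_def
    using mj_nonzero[OF assms(2)] by (auto intro!: holomorphic_intros simp: mj_def)
  hence "(h \<circ> mact A) holomorphic_on uhp"
    by (rule holomorphic_on_compose_gen[OF _ assms(1)]) (use mact_uhp assms in auto)
  hence 1: "(\<lambda>z. h (mact A z)) holomorphic_on uhp" by (simp add: o_def)
  have "mj A holomorphic_on uhp" unfolding mj_def by (auto intro!: holomorphic_intros)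
  with 1 have "(\<lambda>z. h (mact A z) / mj A z ^ w) holomorphic_on uhp"
    using mj_nonzero[OF assms(2)] by (intro holomorphic_on_divide holomorphic_on_power) auto
  thus ?thesis by (simp add: slash_def[abs_def])
qed

definition Tm :: "int \<Rightarrow> mat2" where "Tm n = Mat2 1 n 0 1"
definition Sm :: mat2 where "Sm = Mat2 0 (-1) 1 0"

lemma mdet_Tm [simp]: "mdet (Tm n) = 1" and mdet_Sm [simp]: "mdet Sm = 1"
  by (simp_all add: Tm_def Sm_def)
lemma mact_Tm [simp]: "mact (Tm n) z = z + of_int n" and mj_Tm [simp]: "mj (Tm n) z = 1"
  by (simp_all add: Tm_def mact_def mj_def)
lemma mact_Sm [simp]: "mact Sm z = - 1 / z" and mj_Sm [simp]: "mj Sm z = z"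
  by (simp_all add: Sm_def mact_def mj_def)

text \<open>
  Euclid's algorithm on the bottom row \<open>(c, d)\<close> shows that \<open>S\<close> and \<open>T\<close> generate
  \<open>SL\<^sub>2(\<int>)\<close>: right multiplication by a power of \<open>T\<close> reduces \<open>d\<close> modulo \<open>c\<close>, and \<open>S\<close> swaps the two.
\<close>

lemma SL2_induct:
  assumes det: "mdet g = 1"
    and P1: "P 1"
    and PT: "\<And>g n. mdet g = 1 \<Longrightarrow> P g \<Longrightarrow> P (g * Tm n)"
    and PS: "\<And>g. mdet g = 1 \<Longrightarrow> P g \<Longrightarrow> P (g * Sm)"
  shows "P g"
  using det
proof (induction "nat \<bar>mc g\<bar>" arbitrary: g rule: less_induct)
  case (less g)
  show ?case
  proof (cases "mc g = 0")
    case True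
    with less.prems have ad: "ma g * md g = 1" by (simp add: mdet_def)
    hence "ma g = 1 \<and> md g = 1 \<or> ma g = -1 \<and> md g = -1"
      by (simp add: zmult_eq_1_iff)
    moreover have "P (1 * Tm (mb g))" using PT[of 1] P1 by simp
    moreover have "P ((1 * Sm) * Sm * Tm (- mb g))"
      using PT[of "(1 * Sm) * Sm"] PS[of "1 * Sm"] PS[of 1] P1 by simp
    moreover have "g = 1 * Tm (mb g)" if "ma g = 1" "md g = 1"
      using that True by (simp add: mat2_eq_iff Tm_def)
    moreover have "g = (1 * Sm) * Sm * Tm (- mb g)" if "ma g = -1" "md g = -1"
      using that True by (simp add: mat2_eq_iff Tm_def Sm_def)
    ultimately show ?thesis by metis
  next
    case False
    define n where "n = - (md g div mc g)"
    define g' where "g' = g * Tm n * Sm"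
    have c': "mc g' = md g mod mc g"
      by (simp add: g'_def n_def Tm_def Sm_def minus_div_mult_eq_mod[symmetric])
    have "\<bar>md g mod mc g\<bar> < \<bar>mc g\<bar>" using False by (rule abs_mod_less)
    hence "P g'" using c' less.prems by (intro less.hyps) (auto simp: g'_def)
    have d': "mdet g' = 1" using less.prems by (simp add: g'_def)
    have "P (g' * Sm * Sm * Sm * Tm (- n))"
      using d' \<open>P g'\<close> by (intro PT PS) auto
    also have "g' * Sm * Sm * Sm * Tm (- n) = g"
      by (simp add: g'_def mat2_eq_iff Tm_def Sm_def)
    finally show ?thesis .
  qed
qed

lemma ex_SL2_bottom_row:
  assumes "coprime c d" shows "\<exists>g. mdet g = 1 \<and> mc g = c \<and> md g = d"
proof -
  obtain x y where "x * c + y * d = 1" using assms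
    by (metis bezout_int coprime_iff_gcd_eq_1)
  hence "mdet (Mat2 y (-x) c d) = 1" by (simp add: algebra_simps)
  thus ?thesis by (intro exI[of _ "Mat2 y (-x) c d"]) simp
qed

text \<open>
  Among the finitely many coprime \<open>(c, d)\<close> with \<open>\<bar>c z + d\<bar> \<le> 1\<close> a minimal one gives a
  translate \<open>w\<close> with largest imaginary part; then \<open>\<bar>w\<bar> \<ge> 1\<close>, since otherwise \<open>- 1 / w\<close> would be
  higher. The bound \<open>1 / 2\<close> is not the best one, but any positive constant makes the part
  of the strip that matters compact.
\<close>

lemma fundamental_domain:
  assumes z: "z \<in> uhp"
  shows "\<exists>g. mdet g = 1 \<and> \<bar>Re (mact g z)\<bar> \<le> 1/2 \<and> Im (mact g z) \<ge> 1/2"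
proof -
  define X where "X = {(c,d). coprime c d \<and> norm (of_int c * z + of_int d) \<le> 1}"
  have y: "Im z > 0" using z by (rule uhp_Im)
  have "finite X"
  proof (rule finite_subset)
    let ?K = "\<lceil>1 / Im z\<rceil>" let ?M = "\<lceil>1 + of_int ?K * norm z\<rceil>"
    show "X \<subseteq> {-?K..?K} \<times> {-?M..?M}"
    proof safe
      fix c d assume "(c,d) \<in> X"
      hence n: "norm (of_int c * z + of_int d) \<le> 1" by (simp add: X_def)
      have "\<bar>of_int c * Im z\<bar> \<le> 1"
        using abs_Im_le_cmod[of "of_int c * z + of_int d"] n by simp
      hence "\<bar>of_int c\<bar> \<le> 1 / Im z" using y by (simp add: abs_mult field_simps)
      hence c: "\<bar>c\<bar> \<le> ?K" by linarith
      thus "c \<in> {-?K..?K}" by auto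
      have "norm (of_int d :: complex) \<le> norm (of_int c * z + of_int d) + norm (of_int c * z)"
        by (metis add_diff_cancel_left' norm_triangle_ineq4)
      also have "\<dots> \<le> 1 + of_int \<bar>c\<bar> * norm z" using n by (simp add: norm_mult)
      also have "\<dots> \<le> 1 + of_int ?K * norm z" using c by (simp add: mult_right_mono)
      finally have "\<bar>of_int d\<bar> \<le> 1 + of_int ?K * norm z" by simp
      hence "\<bar>d\<bar> \<le> ?M" by linarith
      thus "d \<in> {-?M..?M}" by auto
    qed
  qed auto
  moreover have "(0,1) \<in> X" by (simp add: X_def)
  moreover define F where "F = (\<lambda>p::int\<times>int. norm (of_int (fst p) * z + of_int (snd p)))"
  ultimately obtain p where p: "p \<in> X"
    and min: "\<And>p'. p' \<in> X \<Longrightarrow> norm (of_int (fst p) * z + of_int (snd p)) \<le> norm (of_int (fst p') * z + of_int (snd p'))"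
    using that arg_min_if_finite(1)[of X F] arg_min_least[of X _ F] by blast
  have cop: "coprime (fst p) (snd p)" using p by (auto simp: X_def)
  then obtain g0 where g0: "mdet g0 = 1" "mc g0 = fst p" "md g0 = snd p"
    using ex_SL2_bottom_row by blast
  define n where "n = - round (Re (mact g0 z))"
  define g where "g = Tm n * g0"
  have g: "mdet g = 1" "mc g = fst p" "md g = snd p" using g0 by (simp_all add: g_def Tm_def)
  have gz: "mact g z = mact g0 z + of_int n" using g0 z by (simp add: g_def mact_mult)
  have re: "\<bar>Re (mact g z)\<bar> \<le> 1/2"
    unfolding gz n_def using of_int_round_abs_le[of "Re (mact g0 z)"] by (simp add: abs_minus_commute)
  define w where "w = mact g z"
  have w: "w \<in> uhp" using g z mact_uhp by (simp add: w_def)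
  have "norm w \<ge> 1"
  proof (rule ccontr)
    assume "\<not> norm w \<ge> 1"
    define g' where "g' = Sm * g"
    have mj': "mj g' z = w * mj g z" using g z by (simp add: g'_def mj_mult w_def)
    have mjg: "norm (mj g z) \<le> 1" using p g by (auto simp: mj_def X_def)
    have mjg0: "norm (mj g z) > 0" using mj_nonzero g z by simp
    have lt: "norm (mj g' z) < norm (mj g z)" using \<open>\<not> norm w \<ge> 1\<close> mjg0 by (simp add: mj' norm_mult)
    have g': "mdet g' = 1" using g by (simp add: g'_def)
    have "coprime (mc g') (md g')"
    proof (rule coprimeI)
      fix c assume "c dvd mc g'" "c dvd md g'"
      hence "c dvd mdet g'" unfolding mdet_def by auto
      thus "is_unit c" using g' by simp
    qed
    hence "(mc g', md g') \<in> X" using lt mjg by (simp add: X_def mj_def)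
    from min[OF this] lt g show False by (simp add: mj_def)
  qed
  hence "1 \<le> (norm w)\<^sup>2" by (simp add: one_le_power)
  also have "(norm w)\<^sup>2 = (Re w)\<^sup>2 + (Im w)\<^sup>2" by (simp add: cmod_power2)
  also have "(Re w)\<^sup>2 \<le> (1/2)\<^sup>2" using re unfolding w_def abs_le_square_iff[symmetric] by simp
  finally have "(1/2)\<^sup>2 \<le> (Im w)\<^sup>2" by (simp add: power2_eq_square)
  hence "1/2 \<le> Im w" using w by (intro power2_le_imp_le[of "1/2" "Im w"]) (auto simp: uhp_iff)
  thus ?thesis using g re unfolding w_def by blast
qed

section \<open>The inversion formula for the sum of the inverse squares\<close>

(* Two constants share this infix; the unordered sums below are those of Infinite_Sum. *)
no_notation Infinite_Set_Sum.abs_summable_on (infix \<open>abs'_summable'_on\<close> 50)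

lemma not_Ints_of_Im: "Im z \<noteq> 0 \<Longrightarrow> z \<notin> \<int>"
  by (metis complex_is_Int_iff)

text \<open>
  The logarithmic derivative of Euler's reflection formula for \<open>\<Gamma>\<close>.
\<close>

lemma Digamma_reflection:
  assumes "z \<notin> \<int>"
  shows "Digamma (1 - z) - Digamma z = of_real pi * cot (of_real pi * z :: complex)"
proof -
  have nz: "w \<notin> \<int>\<^sub>\<le>\<^sub>0" "1 - w \<notin> \<int>\<^sub>\<le>\<^sub>0" "sin (of_real pi * w) \<noteq> 0" if "w \<notin> \<int>" for w :: complex
  proof -
    show "w \<notin> \<int>\<^sub>\<le>\<^sub>0" using that nonpos_Ints_subset_Ints by auto
    show "1 - w \<notin> \<int>\<^sub>\<le>\<^sub>0"
    proof
      assume "1 - w \<in> \<int>\<^sub>\<le>\<^sub>0"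
      hence "1 - (1 - w) \<in> \<int>" using nonpos_Ints_subset_Ints by (intro Ints_diff) auto
      thus False using that by simp
    qed
    show "sin (of_real pi * w) \<noteq> 0"
      using that by (auto simp: sin_eq_0)
  qed
  note z = nz[OF assms]
  have op: "open (UNIV - \<int> :: complex set)" by (simp add: closed_Ints open_Diff)
  define F where "F = (\<lambda>w::complex. Gamma w * Gamma (1 - w) * sin (of_real pi * w))"
  have F: "F w = of_real pi" if "w \<in> UNIV - \<int>" for w
    using Gamma_reflection_complex[of w] nz[of w] that by (simp add: F_def)
  have "(F has_field_derivative
     Gamma z * Digamma z * Gamma (1 - z) * sin (of_real pi * z) - Gamma z * (Gamma (1 - z) * Digamma (1 - z)) * sin (of_real pi * z)
       + Gamma z * Gamma (1 - z) * (of_real pi * cos (of_real pi * z))) (at z)"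
    unfolding F_def using z by (auto intro!: derivative_eq_intros simp: algebra_simps)
  moreover have "(F has_field_derivative 0) (at z)"
  proof (rule has_field_derivative_transform_within_open[OF _ op])
    show "((\<lambda>_. of_real pi) has_field_derivative 0) (at z)" by simp
  qed (use assms F in auto)
  ultimately have "Gamma z * Digamma z * Gamma (1 - z) * sin (of_real pi * z) - Gamma z * (Gamma (1 - z) * Digamma (1 - z)) * sin (of_real pi * z)
       + Gamma z * Gamma (1 - z) * (of_real pi * cos (of_real pi * z)) = 0"
    by (rule DERIV_unique)
  hence "Gamma z * Gamma (1 - z) * (Digamma z * sin (of_real pi * z) - Digamma (1 - z) * sin (of_real pi * z)
       + of_real pi * cos (of_real pi * z)) = 0" by (simp add: algebra_simps)
  hence "Digamma z * sin (of_real pi * z) - Digamma (1 - z) * sin (of_real pi * z)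
       + of_real pi * cos (of_real pi * z) = 0" using z by (simp add: Gamma_eq_zero_iff)
  thus ?thesis using z(3) by (simp add: cot_def field_simps)
qed

text \<open>
  The reflection formula for Digamma contains the partial fractions of the cotangent:
  the two Digamma series run over the nonpositive and over the positive integers. Only the
  boundary terms have to be rearranged.
\<close>

lemma cot_partial_fractions:
  assumes "Im w \<noteq> 0"
  shows "(\<lambda>c. 1 / (w - of_nat (Suc c)) + 1 / (w + of_nat (Suc c))) sums (of_real pi * cot (of_real pi * w) - 1 / w)"
proof -
  have w: "w \<notin> \<int>" using assms by (rule not_Ints_of_Im)
  hence w0: "w \<noteq> 0" "1 - w \<noteq> 0" using assms by auto
  have 1: "(\<lambda>k. inverse (of_nat (Suc k)) - inverse (w + of_nat k)) sums (Digamma w + euler_mascheroni)"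
    using summable_sums[OF summable_Digamma[OF w0(1)]] by (simp add: Digamma_def)
  have 2: "(\<lambda>k. inverse (of_nat (Suc k)) - inverse (1 - w + of_nat k)) sums (Digamma (1 - w) + euler_mascheroni)"
    using summable_sums[OF summable_Digamma[OF w0(2)]] by (simp add: Digamma_def)
  have "(\<lambda>k. inverse (w + of_nat k) - inverse (1 - w + of_nat k)) sums (Digamma (1 - w) - Digamma w)"
    using sums_diff[OF 2 1] by simp
  also have "Digamma (1 - w) - Digamma w = of_real pi * cot (of_real pi * w)" by (rule Digamma_reflection[OF w])
  finally have 3: "(\<lambda>k. inverse (w + of_nat k) - inverse (1 - w + of_nat k)) sums (of_real pi * cot (of_real pi * w))" .
  have 4: "(\<lambda>n. (\<Sum>k<n. inverse (w + of_nat k) - inverse (1 - w + of_nat k)) - 1 / w + inverse (w + of_nat n))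
     \<longlonglongrightarrow> of_real pi * cot (of_real pi * w) - 1 / w + 0"
    by (intro tendsto_add tendsto_diff tendsto_const 3[unfolded sums_def]
        filterlim_compose[OF tendsto_inverse_0] tendsto_add_filterlim_at_infinity[OF tendsto_const] tendsto_of_nat)
  have nz: "w - of_nat n \<noteq> 0" "w + of_nat n \<noteq> 0" for n
    using assms by (auto simp: complex_eq_iff)
  have "(\<Sum>c<n. 1 / (w - of_nat (Suc c)) + 1 / (w + of_nat (Suc c))) =
    (\<Sum>k<n. inverse (w + of_nat k) - inverse (1 - w + of_nat k)) - 1 / w + inverse (w + of_nat n)" for n
  proof (induction n)
    case (Suc n)
    have "inverse (1 - w + of_nat n) = - (1 / (w - of_nat (Suc n)))"
      using nz(1)[of "Suc n"] by (simp add: divide_simps) (simp add: algebra_simps)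
    with Suc show ?case by (simp add: inverse_eq_divide add_ac)
  qed (simp add: inverse_eq_divide)
  thus ?thesis using 4 unfolding sums_def by simp
qed

text \<open>
  This is \<open>\<Sum>d\<in>\<int>. 1 / (z + d)\<^sup>2\<close>.
\<close>

definition psi :: "complex \<Rightarrow> complex" where
  "psi z = of_real pi ^ 2 / sin (of_real pi * z) ^ 2"

lemma psi_eq_Polygamma:
  assumes "Im z \<noteq> 0"
  shows "Polygamma 1 z + Polygamma 1 (1 - z) = psi z"
proof -
  have z: "z \<notin> \<int>" using assms by (rule not_Ints_of_Im)
  have op: "open (UNIV - \<int> :: complex set)" by (simp add: closed_Ints open_Diff)
  have nz: "z \<notin> \<int>\<^sub>\<le>\<^sub>0" "1 - z \<notin> \<int>\<^sub>\<le>\<^sub>0"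
    using assms by (auto elim!: nonpos_Ints_cases simp: complex_eq_iff)
  have s: "sin (of_real pi * z) \<noteq> 0" using z by (auto simp: sin_eq_0)
  have "((\<lambda>z. Digamma (1 - z) - Digamma z) has_field_derivative (- Polygamma 1 (1 - z) - Polygamma 1 z)) (at z)"
    using nz by (auto intro!: derivative_eq_intros)
  hence 1: "((\<lambda>z. of_real pi * cot (of_real pi * z)) has_field_derivative (- Polygamma 1 (1 - z) - Polygamma 1 z)) (at z)"
    by (rule has_field_derivative_transform_within_open[OF _ op]) (use z Digamma_reflection in auto)
  have "((\<lambda>z. of_real pi * (cos (of_real pi * z) / sin (of_real pi * z))) has_field_derivative
      of_real pi * ((- sin (of_real pi * z) * of_real pi * sin (of_real pi * z) - cos (of_real pi * z) * (cos (of_real pi * z) * of_real pi))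
          / (sin (of_real pi * z) * sin (of_real pi * z)))) (at z)"
    using s by (auto intro!: derivative_eq_intros simp: algebra_simps)
  also have "(- sin (of_real pi * z) * of_real pi * sin (of_real pi * z) - cos (of_real pi * z) * (cos (of_real pi * z) * of_real pi))
     = - of_real pi"
  proof -
    have "- s * p * s - c * (c * p) = - p * (s\<^sup>2 + c\<^sup>2)" for s c p :: complex
      by (simp add: power2_eq_square algebra_simps)
    thus ?thesis by (simp only: sin_cos_squared_add mult_1_right)
  qed
  finally have 2: "((\<lambda>z. of_real pi * cot (of_real pi * z)) has_field_derivative - psi z) (at z)"
    by (simp add: cot_def psi_def power2_eq_square)
  show ?thesis using DERIV_unique[OF 1 2] by (simp add: algebra_simps)
qed

lemma psi_partial_fractions:
  assumes "Im w \<noteq> 0"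
  shows "(\<lambda>c. 1 / (w - of_nat (Suc c))^2 + 1 / (w + of_nat (Suc c))^2) sums (psi w - 1 / w^2)"
proof -
  have nz: "w - of_nat n \<noteq> 0" "w + of_nat n \<noteq> 0" for n
    using assms by (auto simp: complex_eq_iff)
  have w0: "w \<noteq> 0" "1 - w \<noteq> 0" using nz[of 0] nz[of 1] by auto
  have 1: "(\<lambda>k. inverse ((w + of_nat k)^2)) sums Polygamma 1 w"
    using Polygamma_LIMSEQ[OF w0(1), of 1] by (simp add: numeral_2_eq_2)
  have 2: "(\<lambda>k. inverse ((1 - w + of_nat k)^2)) sums Polygamma 1 (1 - w)"
    using Polygamma_LIMSEQ[OF w0(2), of 1] by (simp add: numeral_2_eq_2)
  have 3: "(\<lambda>k. inverse ((w + of_nat k)^2) + inverse ((1 - w + of_nat k)^2)) sums psi w"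
    using sums_add[OF 1 2] psi_eq_Polygamma[OF assms] by simp
  have 4: "(\<lambda>n. (\<Sum>k<n. inverse ((w + of_nat k)^2) + inverse ((1 - w + of_nat k)^2)) - 1 / w^2 + (inverse (w + of_nat n))^2)
     \<longlonglongrightarrow> psi w - 1 / w^2 + 0^2"
    by (intro tendsto_add tendsto_diff tendsto_const 3[unfolded sums_def] tendsto_power
        filterlim_compose[OF tendsto_inverse_0] tendsto_add_filterlim_at_infinity[OF tendsto_const] tendsto_of_nat)
  have "(\<Sum>c<n. 1 / (w - of_nat (Suc c))^2 + 1 / (w + of_nat (Suc c))^2) =
    (\<Sum>k<n. inverse ((w + of_nat k)^2) + inverse ((1 - w + of_nat k)^2)) - 1 / w^2 + (inverse (w + of_nat n))^2" for n
  proof (induction n)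
    case (Suc n)
    have "1 - w + of_nat n = - (w - of_nat (Suc n))" by simp
    hence "inverse ((1 - w + of_nat n)^2) = 1 / (w - of_nat (Suc n))^2"
      by (metis inverse_eq_divide power2_minus)
    with Suc show ?case by (simp add: inverse_eq_divide power_divide add_ac)
  qed (simp add: inverse_eq_divide power_divide)
  thus ?thesis using 4 unfolding sums_def by simp
qed

text \<open>
  The constant comes from solving \<open>u z + v\<close> for \<open>u\<close> (by its imaginary part) and then for \<open>v\<close>.
\<close>

lemma norm_linear_form_ge:
  assumes "z \<in> uhp"
  obtains \<delta> :: real where "\<delta> > 0" "\<And>x y. norm (of_real x * z + of_real y) \<ge> \<delta> * (\<bar>x\<bar> + \<bar>y\<bar>)"
proof -
  have y: "Im z > 0" using assms by (rule uhp_Im)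
  define K where "K = 1 / Im z + 1 + norm z / Im z"
  have K: "K > 0" using y by (auto simp: K_def intro!: add_pos_nonneg)
  show ?thesis
  proof (rule that[of "1 / K"])
    fix u v :: real
    let ?n = "norm (of_real u * z + of_real v)"
    have "\<bar>u * Im z\<bar> \<le> ?n" using abs_Im_le_cmod[of "of_real u * z + of_real v"] by simp
    hence u: "\<bar>u\<bar> \<le> ?n / Im z" using y by (simp add: abs_mult field_simps)
    have "norm (of_real v :: complex) \<le> ?n + norm (of_real u * z)"
      by (metis add_diff_cancel_left' norm_triangle_ineq4)
    hence "\<bar>v\<bar> \<le> ?n + \<bar>u\<bar> * norm z" by (simp add: norm_mult)
    also have "\<dots> \<le> ?n + ?n / Im z * norm z" using mult_right_mono[OF u norm_ge_zero[of z]] by simp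
    finally have "\<bar>u\<bar> + \<bar>v\<bar> \<le> K * ?n" using u by (simp add: K_def algebra_simps)
    thus "1 / K * (\<bar>u\<bar> + \<bar>v\<bar>) \<le> ?n" using K by (simp add: field_simps)
  qed (use K in simp)
qed

lemma has_sum_int_LIMSEQ:
  fixes f :: "int \<Rightarrow> 'a :: topological_comm_monoid_add"
  assumes "(f has_sum S) UNIV"
  shows "(\<lambda>n. \<Sum>d\<in>{- int n..<int n}. f d) \<longlonglongrightarrow> S"
proof -
  have "filterlim (\<lambda>n. {- int n..<int n}) (finite_subsets_at_top UNIV) sequentially"
    unfolding filterlim_finite_subsets_at_top
  proof safe
    fix X :: "int set" assume "finite X"
    then obtain M where M: "\<And>x. x \<in> X \<Longrightarrow> \<bar>x\<bar> \<le> M"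
      by (metis abs_le_iff finite_has_maximal2 finite_imageI image_eqI linorder_linear finite_nat_set_iff_bounded_le bdd_above.E bdd_above_finite)
    show "\<forall>\<^sub>F n in sequentially. finite {- int n..<int n} \<and> X \<subseteq> {- int n..<int n} \<and> {- int n..<int n} \<subseteq> UNIV"
      using eventually_gt_at_top[of "nat (M + 1)"]
    proof eventually_elim
      case (elim n)
      have "X \<subseteq> {- int n..<int n}" using elim M by force
      thus ?case by simp
    qed
  qed
  from filterlim_compose[OF assms[unfolded has_sum_def] this] show ?thesis by (simp add: o_def)
qed

lemma sum_int_telescope:
  fixes F :: "int \<Rightarrow> 'a :: ab_group_add"
  shows "(\<Sum>d\<in>{- int n..<int n}. F d - F (d + 1)) = F (- int n) - F (int n)"
proof (induction n)
  case (Suc n)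
  have *: "{- int (Suc n)..<int (Suc n)} = insert (- 1 - int n) (insert (int n) {- int n..<int n})" by auto
  show ?case unfolding * using Suc by (simp add: algebra_simps)
qed simp

lemma sum_int_symmetric:
  fixes F :: "int \<Rightarrow> 'a :: ab_group_add"
  shows "(\<Sum>d\<in>{- int n..<int n}. F d) = (if n = 0 then 0 else F 0) + (\<Sum>d<n-1. F (int (Suc d)) + F (- int (Suc d))) + (if n = 0 then 0 else F (- int n))"
proof (induction n)
  case (Suc n)
  have *: "{- int (Suc n)..<int (Suc n)} = insert (- int n - 1) (insert (int n) {- int n..<int n})" by auto
  show ?case unfolding * using Suc by (cases n) (simp_all add: algebra_simps)
qed simp

lemma summable_on_int_powr:
  "(\<lambda>d::int. (1 + \<bar>real_of_int d\<bar>) powr (- 3/2)) summable_on UNIV"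
proof -
  have 1: "(\<lambda>n::nat. real (Suc n) powr (- 3/2)) summable_on UNIV"
  proof (rule norm_summable_imp_summable_on)
    have "summable (\<lambda>n. real n powr (- 3/2))" by (simp add: summable_real_powr_iff)
    hence "summable (\<lambda>n. real (Suc n) powr (- 3/2))" by (subst summable_Suc_iff)
    thus "summable (\<lambda>n. norm (real (Suc n) powr (- 3/2)))" by simp
  qed
  have 2: "(\<lambda>d::int. (1 + \<bar>real_of_int d\<bar>) powr (- 3/2)) summable_on range int"
    by (subst summable_on_reindex) (use 1 in \<open>auto simp: o_def add_ac\<close>)
  have 3: "(\<lambda>d::int. (1 + \<bar>real_of_int d\<bar>) powr (- 3/2)) summable_on range (\<lambda>n. - int n)"
    by (subst summable_on_reindex) (use 1 in \<open>auto simp: o_def add_ac inj_def\<close>)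
  have "UNIV = range int \<union> range (\<lambda>n. - int n)"
    by (auto intro: int_cases2)
  thus ?thesis using summable_on_union[OF 2 3] by simp
qed

text \<open>
  The series \<open>\<Sum>1 / (c z + d)\<^sup>2\<close> over all pairs is not absolutely convergent, and the two orders
  of summation differ. One more factor in the denominator repairs this: by the arithmetic-geometric mean
  inequality the terms are dominated by a product of two one-variable series of exponent \<open>3 / 2\<close>.
\<close>

lemma summable_cubic_pairs:
  assumes "z \<in> uhp"
  shows "(\<lambda>(c::nat,d::int). 1 / ((of_nat (Suc c) * z + of_int d)^2 * (of_nat (Suc c) * z + of_int d + 1)))
           abs_summable_on (UNIV \<times> UNIV)"
proof -
  obtain \<delta> where \<delta>: "\<delta> > 0" and bound: "\<And>x y. norm (of_real x * z + of_real y) \<ge> \<delta> * (\<bar>x\<bar> + \<bar>y\<bar>)"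
    using norm_linear_form_ge[OF assms] by blast
  define g where "g = (\<lambda>(c::nat,d::int). (real (Suc c) powr (-3/2)) * (1 + \<bar>real_of_int d\<bar>) powr (- 3/2))"
  have 1: "(\<lambda>n::nat. real (Suc n) powr (- 3/2)) summable_on UNIV"
  proof (rule norm_summable_imp_summable_on)
    have "summable (\<lambda>n. real n powr (- 3/2))" by (simp add: summable_real_powr_iff)
    hence "summable (\<lambda>n. real (Suc n) powr (- 3/2))" by (subst summable_Suc_iff)
    thus "summable (\<lambda>n. norm (real (Suc n) powr (- 3/2)))" by simp
  qed
  have "g abs_summable_on (UNIV \<times> UNIV)"
    using 1 summable_on_int_powr
    by (subst Infinite_Sum.abs_summable_on_Sigma_iff) (auto simp: g_def abs_mult infsum_cmult_right' intro!: summable_on_cmult_right summable_on_cmult_left)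
  hence "(\<lambda>x. 16 / \<delta>^3 * g x) abs_summable_on (UNIV \<times> UNIV)"
    using \<delta> by (simp only: norm_mult) (rule summable_on_cmult_right)
  thus ?thesis
  proof (rule Infinite_Sum.abs_summable_on_comparison_test)
    fix x :: "nat \<times> int"
    obtain c d where x: "x = (c,d)" by (cases x)
    let ?C = "real (Suc c)" and ?D = "\<bar>real_of_int d\<bar>"
    let ?a = "of_nat (Suc c) * z + of_int d"
    define t where "t = ?C * (1 + ?D)"
    have t: "t > 0" by (simp add: t_def add_pos_nonneg)
    have sq: "sqrt t \<le> (?C + (1 + ?D)) / 2"
      unfolding t_def by (rule arith_geo_mean_sqrt) auto
    have "sqrt t \<le> ?C + ?D" using sq by simp
    have a: "norm ?a \<ge> \<delta> * sqrt t"
    proof -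
      have "\<delta> * sqrt t \<le> \<delta> * (?C + ?D)" using \<open>sqrt t \<le> ?C + ?D\<close> \<delta> by (intro mult_left_mono) auto
      also have "\<dots> \<le> norm ?a" using bound[of "?C" "real_of_int d"] by simp
      finally show ?thesis .
    qed
    have b: "norm (?a + 1) \<ge> \<delta> * sqrt t / 2"
    proof -
      have "sqrt t \<le> 2 * (?C + \<bar>real_of_int (d + 1)\<bar>)"
      proof -
        have D1: "?D \<le> \<bar>real_of_int (d + 1)\<bar> + 1" by (simp; arith)
        have gen: "s \<le> 2 * (c + e)" if "s \<le> (c + (1 + d)) / 2" "d \<le> e + 1" "0 \<le> e" "1 \<le> c" for s c d e :: real
          using that by simp
        show ?thesis by (rule gen[OF sq D1]) auto
      qed
      hence "\<delta> * sqrt t \<le> \<delta> * (2 * (?C + \<bar>real_of_int (d + 1)\<bar>))" using \<delta> by (intro mult_left_mono) auto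
      also have "\<dots> = 2 * (\<delta> * (\<bar>?C\<bar> + \<bar>real_of_int (d + 1)\<bar>))" by simp
      also have "\<dots> \<le> 2 * norm (of_real ?C * z + of_real (real_of_int (d + 1)))"
        using bound[of "?C" "real_of_int (d+1)"] by (intro mult_left_mono) auto
      also have "of_real ?C * z + of_real (real_of_int (d + 1)) = ?a + 1" by simp
      finally show ?thesis by simp
    qed
    have st: "sqrt t > 0" using t by simp
    have "\<delta>^3 / 2 * (t * sqrt t) = (\<delta> * sqrt t)^2 * (\<delta> * sqrt t / 2)"
      using t by (simp add: power2_eq_square power3_eq_cube)
    also have "\<dots> \<le> norm ?a ^ 2 * norm (?a + 1)"
      using a b \<delta> st by (intro mult_mono power_mono) auto
    finally have le: "\<delta>^3 / 2 * (t * sqrt t) \<le> norm ?a ^ 2 * norm (?a + 1)" .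
    have "0 < \<delta>^3 / 2 * (t * sqrt t)" using \<delta> t st by simp
    from le_imp_inverse_le[OF le this] have "1 / (norm ?a ^ 2 * norm (?a + 1)) \<le> 1 / (\<delta>^3 / 2 * (t * sqrt t))"
      by (simp only: inverse_eq_divide)
    also have "t * sqrt t = t powr (3/2)"
      using t powr_add[of t 1 "1/2"] by (simp add: powr_half_sqrt)
    also have "1 / (\<delta>^3 / 2 * t powr (3/2)) = 2 / \<delta>^3 * t powr (-3/2)"
      by (simp add: powr_minus divide_simps)
    also have "\<dots> \<le> 16 / \<delta>^3 * t powr (-3/2)" using \<delta> by (intro mult_right_mono divide_right_mono) auto
    also have "t powr (-3/2) = g x" unfolding g_def x t_def by (simp add: powr_mult)
    finally show "norm (case x of (c, d) \<Rightarrow> 1 / ((of_nat (Suc c) * z + of_int d)\<^sup>2 * (of_nat (Suc c) * z + of_int d + 1)))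
       \<le> norm (16 / \<delta>^3 * g x)"
      using abs_ge_self[of "16 / \<delta>^3 * g x"] by (simp add: x norm_divide norm_mult norm_power)
  qed
qed


lemma cot_LIMSEQ_lower:
  assumes "Im w < 0"
  shows "(\<lambda>n. cot (of_nat n * w)) \<longlonglongrightarrow> \<i>"
proof -
  define \<rho> where "\<rho> = exp (- 2 * \<i> * w)"
  have \<rho>: "norm \<rho> < 1" using assms by (simp add: \<rho>_def norm_exp)
  hence lim: "(\<lambda>n. \<rho> ^ n) \<longlonglongrightarrow> 0" by (rule LIMSEQ_power_zero)
  have "(\<lambda>n. \<i> * (1 + \<rho> ^ n) / (1 - \<rho> ^ n)) \<longlonglongrightarrow> \<i> * (1 + 0) / (1 - 0)"
    by (intro tendsto_intros lim) auto
  also have "(\<lambda>n. \<i> * (1 + \<rho> ^ n) / (1 - \<rho> ^ n)) = (\<lambda>n. cot (of_nat n * w))"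
  proof
    fix n
    define e where "e = exp (\<i> * (of_nat n * w))"
    have e: "e \<noteq> 0" "exp (- (\<i> * (of_nat n * w))) = 1 / e" by (simp_all add: e_def exp_minus field_simps)
    have "\<rho> ^ n = 1 / e ^ 2"
      by (simp add: \<rho>_def e_def exp_of_nat_mult[symmetric] exp_minus[symmetric] field_simps power2_eq_square exp_add[symmetric])
    hence "\<i> * (1 + \<rho> ^ n) / (1 - \<rho> ^ n) = \<i> * ((e^2 + 1) / e^2) / ((e^2 - 1) / e^2)"
      using e by (simp add: add_divide_distrib diff_divide_distrib)
    also have "\<dots> = \<i> * (e^2 + 1) / (e^2 - 1)" using e by simp
    also have "\<dots> = cot (of_nat n * w)"
      unfolding cot_def sin_exp_eq cos_exp_eq e_def[symmetric] using e
      by (simp add: e divide_simps power2_eq_square) (simp add: algebra_simps)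
    finally show "\<i> * (1 + \<rho> ^ n) / (1 - \<rho> ^ n) = cot (of_nat n * w)" .
  qed
  finally show ?thesis by simp
qed


text \<open>
  The nonconstant part of the weight 2 Eisenstein series: half of the sum of
  \<open>1 / (c z + d)\<^sup>2\<close> over \<open>c \<noteq> 0\<close>, summed over \<open>d\<close> first.
\<close>

definition phi :: "complex \<Rightarrow> complex" where "phi z = (\<Sum>c. psi (of_nat (Suc c) * z))"

text \<open>
  Because of \<open>1 / a\<^sup>2 - 1 / (a\<^sup>2 (a + 1)) = 1 / a - 1 / (a + 1)\<close> the cubic terms differ from
  the inverse squares by a telescoping series with limit \<open>0\<close>.
\<close>

lemma cubic_inner_sum:
  fixes w :: complex
  assumes w: "Im w \<noteq> 0" and sm: "(\<lambda>d::int. 1 / ((w + of_int d)^2 * (w + of_int d + 1))) summable_on UNIV"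
  shows "((\<lambda>d::int. 1 / ((w + of_int d)^2 * (w + of_int d + 1))) has_sum psi w) UNIV"
proof -
  obtain S where S: "((\<lambda>d::int. 1 / ((w + of_int d)^2 * (w + of_int d + 1))) has_sum S) UNIV"
    using sm by (auto simp: summable_on_def)
  have nz: "w + of_int n \<noteq> 0" for n using w by (auto simp: complex_eq_iff)
  have nz1: "w + of_int n + 1 \<noteq> 0" for n using nz[of "n+1"] by (simp add: add_ac)
  have lim0: "(\<lambda>n. inverse (w + of_nat n)) \<longlonglongrightarrow> 0" 
    by (intro filterlim_compose[OF tendsto_inverse_0] tendsto_add_filterlim_at_infinity[OF tendsto_const] tendsto_of_nat)
  have lim0': "(\<lambda>n. inverse (- w + of_nat n)) \<longlonglongrightarrow> 0" 
    by (intro filterlim_compose[OF tendsto_inverse_0] tendsto_add_filterlim_at_infinity[OF tendsto_const] tendsto_of_nat)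
  have eq: "(\<Sum>d\<in>{- int n..<int n}. 1 / ((w + of_int d)^2 * (w + of_int d + 1))) =
     (1 / w^2 + (\<Sum>c<n-1. 1 / (w - of_nat (Suc c))^2 + 1 / (w + of_nat (Suc c))^2) + inverse (- w + of_nat n) ^ 2)
      + inverse (- w + of_nat n) + inverse (w + of_nat n)" if "n > 0" for n
  proof -
    have "(\<Sum>d\<in>{- int n..<int n}. 1 / ((w + of_int d)^2 * (w + of_int d + 1))) =
       (\<Sum>d\<in>{- int n..<int n}. 1 / (w + of_int d)^2 - (1 / (w + of_int d) - 1 / (w + of_int (d + 1))))"
    proof (intro sum.cong refl)
      fix d
      have "1 / (a^2 * (a + 1)) = 1 / a^2 - (1 / a - 1 / (a + 1))" if "a \<noteq> 0" "a + 1 \<noteq> 0" for a :: complex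
        using that by (simp add: divide_simps power2_eq_square)
      from this[OF nz nz1] show "1 / ((w + of_int d)^2 * (w + of_int d + 1)) = 1 / (w + of_int d)^2 - (1 / (w + of_int d) - 1 / (w + of_int (d + 1)))"
        by (simp add: add_ac)
    qed
    also have "\<dots> = (\<Sum>d\<in>{- int n..<int n}. 1 / (w + of_int d)^2) - (1 / (w + of_int (- int n)) - 1 / (w + of_int (int n)))"
      by (subst sum_subtractf) (simp only: sum_int_telescope[of "\<lambda>d. 1 / (w + of_int d)"])
    also have "(\<Sum>d\<in>{- int n..<int n}. 1 / (w + of_int d)^2) =
       1 / w^2 + (\<Sum>c<n-1. 1 / (w + of_nat (Suc c))^2 + 1 / (w - of_nat (Suc c))^2) + 1 / (w - of_nat n)^2"
      using that by (subst sum_int_symmetric) (simp add: algebra_simps)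
    also have "1 / (w - of_nat n)^2 = inverse (- w + of_nat n) ^ 2"
      by (simp add: power_divide inverse_eq_divide power2_commute)
    also have "1 / (w + of_int (- int n)) = - inverse (- w + of_nat n)"
    proof -
      have "w + of_int (- int n) = - (- w + of_nat n)" by simp
      thus ?thesis by (metis inverse_eq_divide inverse_minus_eq)
    qed
    finally show ?thesis by (simp add: inverse_eq_divide add_ac)
  qed
  have "(\<lambda>n. (1 / w^2 + (\<Sum>c<n-1. 1 / (w - of_nat (Suc c))^2 + 1 / (w + of_nat (Suc c))^2) + inverse (- w + of_nat n) ^ 2)
      + inverse (- w + of_nat n) + inverse (w + of_nat n)) \<longlonglongrightarrow> 1 / w^2 + (psi w - 1 / w^2) + 0^2 + 0 + 0"
    using psi_partial_fractions[OF w] unfolding sums_def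
    by (intro tendsto_add tendsto_const tendsto_power lim0 lim0')
      (rule filterlim_compose[OF _ filterlim_minus_const_nat_at_top])
  hence "(\<lambda>n. \<Sum>d\<in>{- int n..<int n}. 1 / ((w + of_int d)^2 * (w + of_int d + 1))) \<longlonglongrightarrow> 1 / w^2 + (psi w - 1 / w^2) + 0^2 + 0 + 0"
    by (rule Lim_transform_eventually) (use eventually_gt_at_top[of 0] in eventually_elim, simp only: eq)
  with has_sum_int_LIMSEQ[OF S] have "S = psi w" by (simp add: LIMSEQ_unique)
  with S show ?thesis by simp
qed


text \<open>
  The anomaly of the weight 2 Eisenstein series, by Eisenstein's convergence trick. The cubic
  series may be summed in both orders. Over \<open>d\<close> first it gives \<open>phi z\<close>. Over \<open>c\<close> first, the
  inverse squares give \<open>phi (- 1 / z) / z\<^sup>2\<close> together with the terms with \<open>d = 0\<close>,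
  while the telescoping correction has partial sums equal to cotangents, whose limit is not \<open>0\<close>; it produces the
  extra summand \<open>\<i> \<pi> / z\<close>.
\<close>

lemma phi_transform:
  assumes z: "z \<in> uhp"
  shows "((\<lambda>c. psi (of_nat (Suc c) * z)) has_sum phi z) UNIV"
    and "phi z = phi (-1 / z) / z^2 + of_real (pi^2/6) / z^2 - of_real (pi^2/6) + \<i> * of_real pi / z"
proof -
  have z0: "z \<noteq> 0" and imz: "Im z > 0" using z by (auto simp: uhp_iff)
  define A where "A = (\<lambda>(z::complex) (c::nat,d::int). 1 / ((of_nat (Suc c) * z + of_int d)^2 * (of_nat (Suc c) * z + of_int d + 1)))"
  have A_sum: "A z summable_on (UNIV \<times> UNIV)" if "z \<in> uhp" for z
    using summable_cubic_pairs[OF that] unfolding A_def by (rule abs_summable_summable)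
  have im: "Im (of_nat (Suc c) * z) \<noteq> 0" if "z \<in> uhp" for c z using that by (simp add: uhp_iff)
  have phi_sum: "((\<lambda>c. psi (of_nat (Suc c) * z)) has_sum infsum (A z) (UNIV \<times> UNIV)) UNIV" if "z \<in> uhp" for z
  proof (rule has_sum_SigmaD)
    show "(A z has_sum infsum (A z) (UNIV \<times> UNIV)) (Sigma UNIV (\<lambda>_. UNIV))"
      using A_sum[OF that] by (rule has_sum_infsum)
    fix c :: nat
    have "(\<lambda>d. A z (c, d)) summable_on UNIV"
      by (rule summable_on_SigmaD1[where A = UNIV and B = "\<lambda>_. UNIV"]) (use A_sum[OF that] in auto)
    thus "((\<lambda>d. A z (c, d)) has_sum psi (of_nat (Suc c) * z)) UNIV"
      unfolding A_def prod.case by (intro cubic_inner_sum im that)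
  qed
  have phi_eq: "infsum (A z) (UNIV \<times> UNIV) = phi z" if "z \<in> uhp" for z
    unfolding phi_def using has_sum_imp_sums[OF phi_sum[OF that]] by (rule sums_unique)
  show phi1: "((\<lambda>c. psi (of_nat (Suc c) * z)) has_sum phi z) UNIV"
    using phi_sum[OF z] phi_eq[OF z] by simp
  have mz: "-1 / z \<in> uhp" using mact_uhp[of Sm z] z by simp
  have phi_sums': "(\<lambda>c. psi (of_nat (Suc c) * (-1/z))) sums phi (-1/z)"
    using has_sum_imp_sums[OF phi_sum[OF mz]] phi_eq[OF mz] by simp
  have As: "((\<lambda>(d,c). A z (c,d)) has_sum phi z) (UNIV \<times> UNIV)"
    using has_sum_infsum[OF A_sum[OF z]] phi_eq[OF z] has_sum_swap[where f = "A z" and S = "phi z" and A = UNIV and B = UNIV]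
    by simp
  define g where "g = (\<lambda>d. \<Sum>\<^sub>\<infinity>c. A z (c,d))"
  have g_sum: "((\<lambda>c. A z (c,d)) has_sum g d) UNIV" for d
  proof -
    have "(\<lambda>c. A z (c, d)) summable_on UNIV"
      by (rule summable_on_SigmaD1[where A = UNIV and B = "\<lambda>_. UNIV" and f = "\<lambda>d c. A z (c,d)"])
        (use As in \<open>auto simp: summable_on_def\<close>)
    thus ?thesis unfolding g_def by (rule has_sum_infsum)
  qed
  have "(g has_sum phi z) UNIV"
    by (rule has_sum_SigmaD[OF As]) (use g_sum in auto)
  hence lim_g: "(\<lambda>n. \<Sum>d\<in>{- int n..<int n}. g d) \<longlonglongrightarrow> phi z" by (rule has_sum_int_LIMSEQ)
  obtain \<delta> where \<delta>: "\<delta> > 0" and bound: "\<And>x y. norm (of_real x * z + of_real y) \<ge> \<delta> * (\<bar>x\<bar> + \<bar>y\<bar>)"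
    using norm_linear_form_ge[OF z] by blast
  have nz: "of_nat (Suc c) * z + of_int d \<noteq> 0" for c d
    using imz by (auto simp: complex_eq_iff)
  \<comment> \<open>the inverse squares summed over \<open>c\<close> first: \<open>d\<close> and \<open>- d\<close> together form partial fractions at \<open>- d / z\<close>\<close>
  define U where "U = (\<lambda>d::int. \<Sum>c. 1 / (of_nat (Suc c) * z + of_int d)^2)"
  have Ubound: "norm (1 / (of_nat (Suc c) * z + of_int d)^2) \<le> 1 / \<delta>^2 * (1 / (real (Suc c) + \<bar>of_int d\<bar>)^2)" for c d
  proof -
    have "(\<delta> * (real (Suc c) + \<bar>of_int d\<bar>))^2 \<le> norm (of_nat (Suc c) * z + of_int d) ^ 2"
      using bound[of "real (Suc c)" "of_int d"] \<delta> by (intro power_mono) auto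
    hence "1 / norm (of_nat (Suc c) * z + of_int d) ^ 2 \<le> 1 / (\<delta> * (real (Suc c) + \<bar>of_int d\<bar>))^2"
      using \<delta> nz by (intro divide_left_mono) (auto intro!: mult_pos_pos zero_less_power)
    thus ?thesis by (simp add: norm_divide norm_power power_mult_distrib)
  qed
  have sq_summable: "summable (\<lambda>c. 1 / real (Suc c)^2)" using inverse_squares_sums by (simp add: sums_iff)
  have U_sums: "(\<lambda>c. 1 / (of_nat (Suc c) * z + of_int d)^2) sums U d" for d
    unfolding U_def
  proof (rule summable_sums, rule summable_comparison_test')
    show "summable (\<lambda>c. 1 / \<delta>^2 * (1 / real (Suc c)^2))" by (intro summable_mult sq_summable)
    fix c
    have "1 / (real (Suc c) + \<bar>of_int d\<bar>)^2 \<le> 1 / real (Suc c)^2"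
      by (intro divide_left_mono power_mono) (auto intro!: mult_pos_pos zero_less_power add_pos_nonneg)
    with Ubound[of c d] show "norm (1 / (of_nat (Suc c) * z + of_int d)^2) \<le> 1 / \<delta>^2 * (1 / real (Suc c)^2)"
      using \<delta> by (meson order_trans mult_left_mono divide_nonneg_pos zero_le_one zero_less_power)
  qed
  have U0: "U 0 = of_real (pi^2/6) / z^2"
  proof -
    have "(\<lambda>c. of_real (1 / real (Suc c)^2) / z^2) sums (of_real (pi^2/6) / z^2)"
      using inverse_squares_sums by (intro sums_divide sums_of_real) (simp add: add_ac)
    moreover have "of_real (1 / real (Suc c)^2) / z^2 = 1 / (of_nat (Suc c) * z + of_int 0)^2" for c
      by (simp add: power_mult_distrib del: of_nat_Suc)
    ultimately show ?thesis using U_sums[of 0] by (simp add: sums_iff)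
  qed
  have Upair: "U (int (Suc n)) + U (- int (Suc n)) = psi (of_nat (Suc n) * (-1/z)) / z^2 - of_real (1 / real (Suc n)^2)" for n
  proof -
    define w where "w = of_nat (Suc n) * (-1/z)"
    have w: "w \<noteq> 0" "Im w \<noteq> 0" using im[OF mz, of n] by (auto simp: w_def)
    have "(\<lambda>c. (1 / (w - of_nat (Suc c))^2 + 1 / (w + of_nat (Suc c))^2) / z^2) sums ((psi w - 1 / w^2) / z^2)"
      by (intro sums_divide psi_partial_fractions w)
    moreover have "(1 / (w - of_nat (Suc c))^2 + 1 / (w + of_nat (Suc c))^2) / z^2 = 
      1 / (of_nat (Suc c) * z + of_int (int (Suc n)))^2 + 1 / (of_nat (Suc c) * z + of_int (- int (Suc n)))^2" for c
    proof -
      have a: "(w - of_nat (Suc c)) * z = - (of_nat (Suc c) * z + of_int (int (Suc n)))"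
        and b: "(w + of_nat (Suc c)) * z = of_nat (Suc c) * z + of_int (- int (Suc n))"
        using z0 by (simp_all add: w_def field_simps)
      have "(1 / (w - of_nat (Suc c))^2 + 1 / (w + of_nat (Suc c))^2) / z^2 = 
         1 / ((w - of_nat (Suc c)) * z)^2 + 1 / ((w + of_nat (Suc c)) * z)^2"
        by (simp add: add_divide_distrib power_mult_distrib)
      thus ?thesis unfolding a b by (simp only: power2_minus)
    qed
    moreover have "(psi w - 1 / w^2) / z^2 = psi w / z^2 - of_real (1 / real (Suc n)^2)"
      using z0 by (simp add: w_def diff_divide_distrib power_mult_distrib power_divide del: of_nat_Suc)
    ultimately show ?thesis
      using sums_add[OF U_sums[of "int (Suc n)"] U_sums[of "- int (Suc n)"]]
      unfolding w_def by (simp only: sums_iff)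
  qed
  have Uneg: "(\<lambda>n. U (- int n)) \<longlonglongrightarrow> 0"
  proof (rule tendsto_norm_zero_cancel, rule tendsto_sandwich)
    show "(\<lambda>n. 0) \<longlonglongrightarrow> (0::real)" by simp
    show "(\<lambda>n. 1 / \<delta>^2 * inverse (real n)) \<longlonglongrightarrow> 0"
      using tendsto_mult[OF tendsto_const[of "1 / \<delta>^2"] lim_inverse_n[where 'a = real]] by simp
    show "\<forall>\<^sub>F n in sequentially. 0 \<le> norm (U (- int n))" by simp
    show "\<forall>\<^sub>F n in sequentially. norm (U (- int n)) \<le> 1 / \<delta>^2 * inverse (real n)"
      using eventually_gt_at_top[of 0]
    proof eventually_elim
      case (elim n)
      have tele: "(\<lambda>c. inverse (real (c + n)) - inverse (real (Suc c + n))) sums (inverse (real (0 + n)) - 0)"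
        by (rule telescope_sums') (rule LIMSEQ_ignore_initial_segment[OF lim_inverse_n])
      have *: "(\<lambda>c. 1 / \<delta>^2 * (inverse (real (c + n)) - inverse (real (Suc c + n)))) sums (1 / \<delta>^2 * inverse (real n))"
        using sums_mult[OF tele, of "1 / \<delta>^2"] by simp
      have le: "norm (1 / (of_nat (Suc c) * z + of_int (- int n))^2) \<le> 1 / \<delta>^2 * (inverse (real (c + n)) - inverse (real (Suc c + n)))" for c
      proof -
        define x where "x = real (c + n)"
        have x: "x > 0" using elim by (simp add: x_def)
        have e: "real (Suc c) + \<bar>of_int (- int n)\<bar> = x + 1" "real (Suc c + n) = x + 1" "real (c + n) = x" by (simp_all add: x_def)
        have "1 / (x + 1)^2 \<le> inverse x - inverse (x + 1)"
          using x by (simp add: divide_simps power2_eq_square)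
        hence "1 / \<delta>^2 * (1 / (x + 1)^2) \<le> 1 / \<delta>^2 * (inverse x - inverse (x + 1))"
          using \<delta> by (intro mult_left_mono) auto
        thus ?thesis using Ubound[of c "- int n"] unfolding e by simp
      qed
      have sn: "summable (\<lambda>c. norm (1 / (of_nat (Suc c) * z + of_int (- int n))^2))"
        by (rule summable_comparison_test'[OF sums_summable[OF *], of 0]) (simp only: real_norm_def abs_norm_cancel le)
      have "norm (U (- int n)) \<le> (\<Sum>c. norm (1 / (of_nat (Suc c) * z + of_int (- int n))^2))"
        unfolding U_def by (rule summable_norm[OF sn])
      also have "\<dots> \<le> 1 / \<delta>^2 * inverse (real n)"
        by (rule sums_le[OF le summable_sums[OF sn] *])
      finally show ?case .
    qed
  qed
  have lim_U: "(\<lambda>n. \<Sum>d\<in>{- int n..<int n}. U d) \<longlonglongrightarrow> of_real (pi^2/6) / z^2 + (phi (-1/z) / z^2 - of_real (pi^2/6)) + 0"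
  proof (rule Lim_transform_eventually)
    have "(\<lambda>n. psi (of_nat (Suc n) * (-1/z)) / z^2 - of_real (1 / real (Suc n)^2)) sums (phi (-1/z) / z^2 - of_real (pi^2/6))"
      using inverse_squares_sums
      by (intro sums_diff sums_divide phi_sums' sums_of_real) (simp add: add_ac)
    hence "(\<lambda>n. \<Sum>d<n. U (int (Suc d)) + U (- int (Suc d))) \<longlonglongrightarrow> phi (-1/z) / z^2 - of_real (pi^2/6)"
      unfolding Upair sums_def .
    thus "(\<lambda>n. U 0 + (\<Sum>d<n-1. U (int (Suc d)) + U (- int (Suc d))) + U (- int n)) \<longlonglongrightarrow>
       of_real (pi^2/6) / z^2 + (phi (-1/z) / z^2 - of_real (pi^2/6)) + 0"
      unfolding U0 by (intro tendsto_add tendsto_const Uneg)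
        (rule filterlim_compose[OF _ filterlim_minus_const_nat_at_top])
    show "\<forall>\<^sub>F n in sequentially. U 0 + (\<Sum>d<n-1. U (int (Suc d)) + U (- int (Suc d))) + U (- int n) = (\<Sum>d\<in>{- int n..<int n}. U d)"
      using eventually_gt_at_top[of 0] by eventually_elim (subst sum_int_symmetric, simp)
  qed
  \<comment> \<open>telescoping over \<open>d\<close> leaves the two ends \<open>- n\<close> and \<open>n\<close>, whose sum over \<open>c\<close> is a cotangent at \<open>n / z\<close>\<close>
  have lim_V: "(\<lambda>n. \<Sum>d\<in>{- int n..<int n}. U d - g d) \<longlonglongrightarrow> 0 - of_real pi / z * \<i>"
  proof (rule Lim_transform_eventually)
    have imw: "Im (1 / z) < 0" using imz by (simp add: Im_divide divide_neg_pos sum_power2_gt_zero_iff)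
    have "Im (of_real pi / z) = pi * Im (1 / z)" by (simp add: Im_divide)
    hence "Im (of_real pi / z) < 0" using imw by (simp add: mult_pos_neg)
    thus "(\<lambda>n. inverse (of_nat n) - of_real pi / z * cot (of_nat n * (of_real pi / z))) \<longlonglongrightarrow> 0 - of_real pi / z * \<i>"
      by (intro tendsto_diff tendsto_mult tendsto_const cot_LIMSEQ_lower lim_inverse_n) 
    show "\<forall>\<^sub>F n in sequentially. inverse (of_nat n) - of_real pi / z * cot (of_nat n * (of_real pi / z)) = (\<Sum>d\<in>{- int n..<int n}. U d - g d)"
      using eventually_gt_at_top[of 0]
    proof eventually_elim
      case (elim n)
      define w where "w = of_nat n / z"
      have w: "w \<noteq> 0" "Im w \<noteq> 0" using elim imw z0 by (auto simp: w_def Im_divide)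
      have d: "(\<lambda>c. 1 / (of_nat (Suc c) * z + of_int d) - 1 / (of_nat (Suc c) * z + of_int (d + 1))) sums (U d - g d)" for d
      proof -
        have "1 / a^2 - 1 / (a^2 * (a + 1)) = 1 / a - 1 / (a + 1)" if "a \<noteq> 0" "a + 1 \<noteq> 0" for a :: complex
          using that by (simp add: divide_simps power2_eq_square)
        from this[OF nz] nz[of _ "d + 1"]
        have "1 / (of_nat (Suc c) * z + of_int d)^2 - A z (c,d) = 1 / (of_nat (Suc c) * z + of_int d) - 1 / (of_nat (Suc c) * z + of_int (d + 1))" for c
          unfolding A_def by (simp add: add_ac)
        with sums_diff[OF U_sums[of d] has_sum_imp_sums[OF g_sum[of d]]] show ?thesis by simp
      qed
      have "(\<lambda>c. \<Sum>d\<in>{- int n..<int n}. 1 / (of_nat (Suc c) * z + of_int d) - 1 / (of_nat (Suc c) * z + of_int (d + 1)))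
               sums (\<Sum>d\<in>{- int n..<int n}. U d - g d)"
        by (intro sums_sum d)
      moreover have "(\<Sum>d\<in>{- int n..<int n}. 1 / (of_nat (Suc c) * z + of_int d) - 1 / (of_nat (Suc c) * z + of_int (d + 1))) =
          - (1 / z) * (1 / (w - of_nat (Suc c)) + 1 / (w + of_nat (Suc c)))" for c
      proof -
        have a: "of_nat (Suc c) * z + of_int (- int n) = - z * (w - of_nat (Suc c))" 
          and b: "of_nat (Suc c) * z + of_int (int n) = z * (w + of_nat (Suc c))"
          using z0 by (simp_all add: w_def field_simps)
        have c: "1 / (- z * x) - 1 / (z * y) = - (1 / z) * (1 / x + 1 / y)" for x y
          by (simp add: divide_inverse algebra_simps)
        show ?thesis
          by (subst sum_int_telescope) (simp only: a b c)
      qed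
      moreover have "(\<lambda>c. - (1 / z) * (1 / (w - of_nat (Suc c)) + 1 / (w + of_nat (Suc c)))) sums (- (1 / z) * (of_real pi * cot (of_real pi * w) - 1 / w))"
        by (intro sums_mult cot_partial_fractions w)
      ultimately have "(\<Sum>d\<in>{- int n..<int n}. U d - g d) = - (1 / z) * (of_real pi * cot (of_real pi * w) - 1 / w)"
        by (simp add: sums_iff)
      also have "\<dots> = inverse (of_nat n) - of_real pi / z * cot (of_nat n * (of_real pi / z))"
        using z0 elim by (simp add: w_def field_simps)
      finally show ?case by simp
    qed
  qed
  have "(\<lambda>n. (\<Sum>d\<in>{- int n..<int n}. U d) - (\<Sum>d\<in>{- int n..<int n}. U d - g d)) \<longlonglongrightarrow>
     (of_real (pi^2/6) / z^2 + (phi (-1/z) / z^2 - of_real (pi^2/6)) + 0) - (0 - of_real pi / z * \<i>)"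
    by (rule tendsto_diff[OF lim_U lim_V])
  hence "(\<lambda>n. \<Sum>d\<in>{- int n..<int n}. g d) \<longlonglongrightarrow> (of_real (pi^2/6) / z^2 + (phi (-1/z) / z^2 - of_real (pi^2/6)) + 0) - (0 - of_real pi / z * \<i>)"
    by (simp add: sum_subtractf)
  from LIMSEQ_unique[OF lim_g this] show "phi z = phi (-1 / z) / z^2 + of_real (pi^2/6) / z^2 - of_real (pi^2/6) + \<i> * of_real pi / z"
    by (simp add: algebra_simps)
qed

section \<open>The discriminant function\<close>

lemma ereal_less_of_ge_1: "r < 1 \<Longrightarrow> 1 \<le> R \<Longrightarrow> ereal r < R"
  by (rule less_le_trans[of _ 1]) simp_all

definition dsum :: "(nat \<Rightarrow> bool) \<Rightarrow> nat \<Rightarrow> nat" where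
  "dsum P n = (\<Sum>d\<in>{d\<in>{1..n}. d dvd n \<and> P d}. d)"

lemma dsum_0 [simp]: "dsum P 0 = 0" by (simp add: dsum_def)

lemma dsum_le: "dsum P n \<le> n ^ 2"
proof -
  have "dsum P n \<le> (\<Sum>d\<in>{1..n}. n)"
    unfolding dsum_def by (rule order.trans[OF sum_mono2 sum_mono]) auto
  thus ?thesis by (simp add: power2_eq_square)
qed

text \<open>
  The second derivative of the geometric series is a majorant.
\<close>

lemma conv_radius_quadratic_growth:
  fixes f :: "nat \<Rightarrow> complex"
  assumes "\<And>n. norm (f n) \<le> real n ^ 2"
  shows "conv_radius f \<ge> 1"
proof (rule conv_radius_geI_ex')
  fix r :: real assume r: "0 < r" "ereal r < 1"
  define g :: "complex fps" where "g = Abs_fps (\<lambda>_. 1)"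
  have "conv_radius (\<lambda>_. 1 :: complex) \<ge> 1"
    by (rule conv_radius_geI_ex') (auto intro!: summable_geometric simp: norm_power)
  hence "fps_conv_radius g \<ge> 1" by (simp add: g_def fps_conv_radius_def)
  hence "fps_conv_radius (fps_deriv (fps_deriv g)) \<ge> 1"
    using fps_conv_radius_deriv[of g] fps_conv_radius_deriv[of "fps_deriv g"] by (meson order.trans)
  hence "summable (\<lambda>n. norm (fps_nth (fps_deriv (fps_deriv g)) n * of_real r ^ n))"
    using r by (intro norm_summable_fps) (simp add: ereal_less_of_ge_1)
  thus "summable (\<lambda>n. f n * of_real r ^ n)"
  proof (rule summable_comparison_test'[of _ 0])
    fix n :: nat
    have "norm (fps_nth (fps_deriv (fps_deriv g)) n) = real ((n + 1) * (n + 2))"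
      by (simp add: g_def norm_mult flip: of_nat_add of_nat_Suc of_nat_mult del: of_nat_add of_nat_Suc of_nat_mult)
    moreover have "real n ^ 2 \<le> real ((n + 1) * (n + 2))"
      by (simp add: power2_eq_square flip: of_nat_mult)
    ultimately have "norm (f n) \<le> norm (fps_nth (fps_deriv (fps_deriv g)) n)"
      using assms[of n] by linarith
    thus "norm (f n * of_real r ^ n) \<le> norm (fps_nth (fps_deriv (fps_deriv g)) n * of_real r ^ n)"
      by (simp add: norm_mult mult_right_mono)
  qed
qed

text \<open>
  With \<open>P\<close> always true this is \<open>- \<Sum>ln (1 - x ^ n)\<close>, so that its exponential is the generating
  function of the partitions; for general \<open>P\<close> the product is restricted to the \<open>n\<close> satisfying \<open>P\<close>.
\<close>

definition logser :: "(nat \<Rightarrow> bool) \<Rightarrow> complex fps" where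
  "logser P = Abs_fps (\<lambda>n. of_nat (dsum P n) / of_nat n)"
definition dser :: "(nat \<Rightarrow> bool) \<Rightarrow> complex fps" where
  "dser P = Abs_fps (\<lambda>n. of_nat (dsum P n))"

lemma dser_radius: "fps_conv_radius (dser P) \<ge> 1"
  unfolding fps_conv_radius_def dser_def
  by (rule conv_radius_quadratic_growth) (use dsum_le[of P] in \<open>simp flip: of_nat_power\<close>)

lemma logser_radius: "fps_conv_radius (logser P) \<ge> 1"
  unfolding fps_conv_radius_def logser_def
proof (rule conv_radius_quadratic_growth)
  fix n
  have "real (dsum P n) / real n \<le> real (dsum P n)"
    by (cases "n = 0") (auto simp: divide_simps mult_le_cancel_left1)
  also have "\<dots> \<le> real n ^ 2" using dsum_le[of P n] by (simp flip: of_nat_power)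
  finally show "norm (fps_nth (Abs_fps (\<lambda>n. of_nat (dsum P n) / of_nat n)) n :: complex) \<le> real n ^ 2"
    by (simp add: norm_divide)
qed

lemma logser_deriv: "fps_X * fps_deriv (logser P) = dser P"
  by (rule fps_ext) (auto simp: logser_def dser_def fps_X_mult_nth)

lemma eval_logser_deriv:
  assumes "norm x < 1"
  shows "\<exists>D. (eval_fps (logser P) has_field_derivative D) (at x within A) \<and> x * D = eval_fps (dser P) x"
proof (intro exI conjI)
  have r: "ereal (norm x) < fps_conv_radius (logser P)" using assms logser_radius[of P]
    by (rule ereal_less_of_ge_1)
  show "(eval_fps (logser P) has_field_derivative eval_fps (fps_deriv (logser P)) x) (at x within A)"
    by (rule has_field_derivative_eval_fps[OF r])
  have "ereal (norm x) < fps_conv_radius (fps_deriv (logser P))"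
    using r fps_conv_radius_deriv[of "logser P"] by (rule less_le_trans)
  hence "eval_fps (fps_X * fps_deriv (logser P)) x = eval_fps fps_X x * eval_fps (fps_deriv (logser P)) x"
    by (intro eval_fps_mult) auto
  thus "x * eval_fps (fps_deriv (logser P)) x = eval_fps (dser P) x"
    by (simp add: logser_deriv)
qed

definition qq :: "complex \<Rightarrow> complex" where "qq z = exp (2 * of_real pi * \<i> * z)"

lemma norm_qq: "norm (qq z) = exp (- 2 * pi * Im z)" by (simp add: qq_def norm_exp)
lemma norm_qq_less: "z \<in> uhp \<Longrightarrow> norm (qq z) < 1" by (simp add: norm_qq uhp_iff)
lemma qq_nonzero [simp]: "qq z \<noteq> 0" by (simp add: qq_def)
lemma qq_add_int [simp]: "qq (z + of_int n) = qq z"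
  unfolding qq_def by (auto simp: exp_eq algebra_simps intro!: exI[of _ n])
lemma qq_mult_nat: "qq (of_nat n * z) = qq z ^ n"
  by (simp add: qq_def exp_of_nat_mult[symmetric] mult_ac)

text \<open>
  Lipschitz's formula in weight 2: both sides are \<open>q / (1 - q)\<^sup>2\<close>.
\<close>

lemma psi_lipschitz:
  assumes "w \<in> uhp"
  shows "((\<lambda>n. of_nat n * qq w ^ n) has_sum (- psi w / (4 * of_real pi ^ 2))) UNIV"
proof -
  let ?q = "qq w"
  have q: "norm ?q < 1" using norm_qq_less[OF assms] .
  have g: "(\<lambda>n. of_nat (Suc n) * ?q ^ n) sums (1 / (1 - ?q)\<^sup>2)" by (rule geometric_deriv_sums[OF q])
  have "(\<lambda>n. ?q * (of_nat (Suc n) * ?q ^ n)) sums (?q * (1 / (1 - ?q)\<^sup>2))" by (rule sums_mult[OF g])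
  hence "(\<lambda>n. of_nat (Suc n) * ?q ^ Suc n) sums (?q / (1 - ?q)\<^sup>2)" by (simp add: mult_ac)
  hence s: "(\<lambda>n. of_nat n * ?q ^ n) sums (?q / (1 - ?q)\<^sup>2)"
    by (subst (asm) sums_Suc_iff) simp
  have "(\<lambda>n. real (Suc n) * norm ?q ^ n) sums (1 / (1 - norm ?q)\<^sup>2)"
    by (rule geometric_deriv_sums) (use q in simp)
  hence "summable (\<lambda>n. norm ?q * (real (Suc n) * norm ?q ^ n))" by (intro summable_mult sums_summable)
  hence "summable (\<lambda>n. real (Suc n) * norm ?q ^ Suc n)" by (simp add: mult_ac)
  hence "summable (\<lambda>n. real n * norm ?q ^ n)" by (subst (asm) summable_Suc_iff)
  hence "summable (\<lambda>n. norm (of_nat n * ?q ^ n))" by (simp add: norm_mult norm_power)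
  from norm_summable_imp_has_sum[OF this s] have "((\<lambda>n. of_nat n * ?q ^ n) has_sum (?q / (1 - ?q)\<^sup>2)) UNIV" .
  also have "?q / (1 - ?q)\<^sup>2 = - psi w / (4 * of_real pi ^ 2)"
  proof -
    define e where "e = exp (\<i> * (of_real pi * w))"
    have e: "e \<noteq> 0" "exp (- (\<i> * (of_real pi * w))) = 1 / e" "?q = e^2"
      by (simp_all add: e_def exp_minus field_simps qq_def power2_eq_square exp_add[symmetric])
    have q1: "1 - e^2 \<noteq> 0" using q unfolding e by auto
    have "sin (of_real pi * w) ^ 2 = - ((1 - e^2)^2) / (4 * e^2)"
      unfolding sin_exp_eq e_def[symmetric] e using e(1)
      by (simp add: power2_eq_square divide_simps) (simp add: algebra_simps)
    hence "psi w = - (4 * of_real pi ^ 2 * (e^2 / (1 - e^2)^2))" unfolding psi_def by simp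
    thus ?thesis unfolding e(3) by simp
  qed
  finally show ?thesis .
qed

text \<open>
  The Fourier expansion of \<open>phi\<close>: expand every summand by Lipschitz's formula and collect the
  pairs \<open>(c, d)\<close> with \<open>c d = N\<close>.
\<close>

lemma sigma_series_phi:
  assumes z: "z \<in> uhp"
  shows "eval_fps (dser (\<lambda>_. True)) (qq z) = - phi z / (4 * of_real pi ^ 2)"
proof -
  let ?q = "qq z" and ?D = "\<lambda>N. {d\<in>{1..N}. d dvd (N::nat)}"
  have q: "norm ?q < 1" by (rule norm_qq_less[OF z])
  have S: "summable (\<lambda>n. norm (fps_nth (dser (\<lambda>_. True)) n * ?q ^ n))"
    using q by (intro norm_summable_fps less_le_trans[OF _ dser_radius]) auto
  have "(\<lambda>n. fps_nth (dser (\<lambda>_. True)) n * ?q ^ n) sums eval_fps (dser (\<lambda>_. True)) ?q"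
    using q by (intro sums_eval_fps less_le_trans[OF _ dser_radius]) auto
  from norm_summable_imp_has_sum[OF S this]
  have hs: "((\<lambda>n. of_nat (dsum (\<lambda>_. True) n) * ?q ^ n) has_sum eval_fps (dser (\<lambda>_. True)) ?q) UNIV"
    by (simp add: dser_def)
  have S': "(\<lambda>n. real (dsum (\<lambda>_. True) n) * norm ?q ^ n) summable_on UNIV"
    using norm_summable_imp_summable_on[of "\<lambda>n. real (dsum (\<lambda>_. True) n) * norm ?q ^ n"] S by (simp add: dser_def norm_mult norm_power)
  define f where "f = (\<lambda>(N,d). of_nat d * ?q ^ N)"
  have "(\<lambda>x. norm (f x)) summable_on Sigma UNIV ?D"
  proof (rule summable_on_SigmaI)
    fix N :: nat
    show "((\<lambda>d. norm (f (N,d))) has_sum (real (dsum (\<lambda>_. True) N) * norm ?q ^ N)) (?D N)"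
      by (rule has_sum_finiteI) (auto simp: f_def norm_mult norm_power dsum_def sum_distrib_right)
  qed (use S' in auto)
  hence "f summable_on Sigma UNIV ?D" by (rule abs_summable_summable)
  hence "(f has_sum eval_fps (dser (\<lambda>_. True)) ?q) (Sigma UNIV ?D)"
  proof (rule has_sum_SigmaI[rotated -1])
    fix N :: nat
    show "((\<lambda>d. f (N,d)) has_sum (of_nat (dsum (\<lambda>_. True) N) * ?q ^ N)) (?D N)"
      by (rule has_sum_finiteI) (auto simp: f_def dsum_def sum_distrib_right)
  qed (use hs in auto)
  also have "?this \<longleftrightarrow> ((\<lambda>(c,d). of_nat d * qq (of_nat (Suc c) * z) ^ d) has_sum eval_fps (dser (\<lambda>_. True)) ?q) (UNIV \<times> {1..})"
  proof (rule has_sum_reindex_bij_witness[of _ "\<lambda>(c,d). (Suc c * d, d)" "\<lambda>(N,d). (N div d - 1, d)"])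
    fix x assume "x \<in> Sigma UNIV ?D"
    then obtain N d where x: "x = (N,d)" "d \<ge> 1" "d \<le> N" "d dvd N" by auto
    hence *: "N div d \<ge> 1" by (simp add: div_greater_zero_iff Suc_le_eq)
    have SD: "Suc (N div d - 1) * d = N" using x * by simp
    from SD show "(case case x of (N, d) \<Rightarrow> (N div d - 1, d) of (c, d) \<Rightarrow> (Suc c * d, d)) = x" using x by simp
    show "(case x of (N, d) \<Rightarrow> (N div d - 1, d)) \<in> UNIV \<times> {1..}" using x by simp
    have "qq (of_nat (Suc (N div d - 1)) * z) ^ d = qq z ^ N"
      by (simp only: qq_mult_nat power_mult[symmetric] SD)
    thus "(case case x of (N, d) \<Rightarrow> (N div d - 1, d) of (c, d) \<Rightarrow> of_nat d * qq (of_nat (Suc c) * z) ^ d) = f x"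
      using x by (simp add: f_def del: of_nat_Suc)
  qed auto
  finally have fs: "((\<lambda>(c,d). of_nat d * qq (of_nat (Suc c) * z) ^ d) has_sum eval_fps (dser (\<lambda>_. True)) ?q) (UNIV \<times> {1..})" .
  have "((\<lambda>c. - psi (of_nat (Suc c) * z) / (4 * of_real pi ^ 2)) has_sum eval_fps (dser (\<lambda>_. True)) ?q) UNIV"
  proof (rule has_sum_SigmaD[OF fs])
    fix c :: nat
    have "of_nat (Suc c) * z \<in> uhp" using z by (simp add: uhp_iff add_pos_nonneg)
    note psi_lipschitz[OF this]
    also have "((\<lambda>n. of_nat n * qq (of_nat (Suc c) * z) ^ n) has_sum - psi (of_nat (Suc c) * z) / (4 * of_real pi ^ 2)) UNIV \<longleftrightarrow>
      ((\<lambda>d. case (c, d) of (c, d) \<Rightarrow> of_nat d * qq (of_nat (Suc c) * z) ^ d) has_sum - psi (of_nat (Suc c) * z) / (4 * of_real pi ^ 2)) {1..}"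
      by (rule has_sum_cong_neutral) auto
    finally show "((\<lambda>d. case (c, d) of (c, d) \<Rightarrow> of_nat d * qq (of_nat (Suc c) * z) ^ d) has_sum - psi (of_nat (Suc c) * z) / (4 * of_real pi ^ 2)) {1..}" .
  qed
  moreover have "((\<lambda>c. - psi (of_nat (Suc c) * z) / (4 * of_real pi ^ 2)) has_sum (- phi z / (4 * of_real pi ^ 2))) UNIV"
    using has_sum_cmult_right[OF phi_transform(1)[OF z], of "- 1 / (4 * of_real pi ^ 2)"] by simp
  ultimately show ?thesis by (rule has_sum_unique)
qed

text \<open>
  The product \<open>q \<Prod>(1 - q ^ n) ^ 24\<close>, written through its logarithm, so that the logarithmic derivative
  is available without differentiating an infinite product.
\<close>

definition Delta :: "complex \<Rightarrow> complex" where
  "Delta z = qq z * exp (- 24 * eval_fps (logser (\<lambda>_. True)) (qq z))"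

lemma Delta_nonzero [simp]: "Delta z \<noteq> 0" by (simp add: Delta_def)

lemma Delta_deriv:
  assumes z: "z \<in> uhp"
  shows "(Delta has_field_derivative (Delta z * (2 * of_real pi * \<i> * (1 + 6 * phi z / of_real pi ^ 2)))) (at z)"
proof -
  obtain D where D: "(eval_fps (logser (\<lambda>_. True)) has_field_derivative D) (at (qq z))"
    and xD: "qq z * D = eval_fps (dser (\<lambda>_. True)) (qq z)"
    using eval_logser_deriv[OF norm_qq_less[OF z]] by blast
  have q': "(qq has_field_derivative (2 * of_real pi * \<i> * qq z)) (at z)"
    unfolding qq_def by (auto intro!: derivative_eq_intros)
  have "(Delta has_field_derivative (2 * of_real pi * \<i> * qq z * exp (- 24 * eval_fps (logser (\<lambda>_. True)) (qq z))
     + qq z * (exp (- 24 * eval_fps (logser (\<lambda>_. True)) (qq z)) * (- 24 * (D * (2 * of_real pi * \<i> * qq z)))))) (at z)"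
  proof -
    define L where "L = (\<lambda>z. eval_fps (logser (\<lambda>_. True)) (qq z))"
    have "(L has_field_derivative (D * (2 * of_real pi * \<i> * qq z))) (at z)"
      unfolding L_def by (rule DERIV_chain2[where f = "eval_fps (logser (\<lambda>_. True))" and g = qq, OF D q'])
    hence "((\<lambda>z. qq z * exp (- 24 * L z)) has_field_derivative (2 * of_real pi * \<i> * qq z * exp (- 24 * L z)
       + qq z * (exp (- 24 * L z) * (- 24 * (D * (2 * of_real pi * \<i> * qq z)))))) (at z)"
      by (auto intro!: derivative_eq_intros q')
    thus ?thesis by (simp add: L_def Delta_def[abs_def])
  qed
  also have "2 * of_real pi * \<i> * qq z * exp (- 24 * eval_fps (logser (\<lambda>_. True)) (qq z))
     + qq z * (exp (- 24 * eval_fps (logser (\<lambda>_. True)) (qq z)) * (- 24 * (D * (2 * of_real pi * \<i> * qq z))))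
     = Delta z * (2 * of_real pi * \<i> * (1 - 24 * (qq z * D)))"
    by (simp add: Delta_def algebra_simps)
  finally show ?thesis unfolding xD sigma_series_phi[OF z] by simp
qed

lemma holomorphic_Delta: "Delta holomorphic_on uhp"
  using Delta_deriv by (intro holomorphic_onI) (meson field_differentiable_at_within field_differentiable_def)

text \<open>
  The logarithmic derivative of \<open>Delta\<close> is \<open>phi\<close> up to constants. The anomaly in the inversion formula
  of \<open>phi\<close> is exactly the logarithmic derivative of \<open>z ^ 12\<close>, so the quotient of both sides is constant,
  and at the fixed point \<open>\<i>\<close> it is \<open>1\<close>.
\<close>

lemma Delta_inversion:
  assumes z: "z \<in> uhp"
  shows "Delta (-1 / z) = z ^ 12 * Delta z"
proof -
  define R where "R = (\<lambda>z. Delta (-1 / z) / (z ^ 12 * Delta z))"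
  have "(R has_field_derivative 0) (at z)" if z: "z \<in> uhp" for z
  proof -
    have mz: "-1 / z \<in> uhp" using mact_uhp[of Sm z] z by simp
    have z0: "z \<noteq> 0" using z by (auto simp: uhp_iff)
    define P where "P = 2 * of_real pi * \<i> * (1 + 6 * phi z / of_real pi ^ 2)"
    define P' where "P' = 2 * of_real pi * \<i> * (1 + 6 * phi (-1/z) / of_real pi ^ 2)"
    have phi': "phi (-1/z) = z^2 * (phi z - of_real (pi^2/6) / z^2 + of_real (pi^2/6) - \<i> * of_real pi / z)"
    proof -
      have "z^2 * (phi z - of_real (pi^2/6) / z^2 + of_real (pi^2/6) - \<i> * of_real pi / z) = z^2 * (phi (-1/z) / z^2)"
        by (simp only: phi_transform(2)[OF z]) simp
      thus ?thesis using z0 by simp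
    qed
    have P': "P' / z^2 - 12 / z = P"
      unfolding P_def P'_def phi' using z0 by (simp add: field_simps power2_eq_square)
    have i: "((\<lambda>z. -1 / z) has_field_derivative 1 / z^2) (at z)"
      using z0 by (auto intro!: derivative_eq_intros simp: power2_eq_square)
    have N: "((\<lambda>z. Delta (-1 / z)) has_field_derivative Delta (-1/z) * P' * (1 / z^2)) (at z)"
      using DERIV_chain2[OF Delta_deriv[OF mz] i] by (simp add: P'_def)
    have D: "((\<lambda>z. z ^ 12 * Delta z) has_field_derivative (12 * z ^ 11 * Delta z + Delta z * P * z ^ 12)) (at z)"
      by (rule derivative_eq_intros refl Delta_deriv[OF z])+ (simp add: P_def)
    have "(R has_field_derivative (Delta (-1/z) * P' * (1 / z^2) * (z ^ 12 * Delta z) - Delta (-1/z) * (12 * z ^ 11 * Delta z + Delta z * P * z ^ 12)) / ((z ^ 12 * Delta z) * (z ^ 12 * Delta z))) (at z)"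
      unfolding R_def using z0 by (intro DERIV_divide N D) simp
    also have "Delta (-1/z) * P' * (1 / z^2) * (z ^ 12 * Delta z) - Delta (-1/z) * (12 * z ^ 11 * Delta z + Delta z * P * z ^ 12)
       = Delta (-1/z) * Delta z * z ^ 12 * (P' / z^2 - 12 / z - P)"
      using z0 by (simp add: field_simps power_numeral_reduce)
    finally show ?thesis by (simp add: P')
  qed
  hence "R constant_on uhp" by (intro has_field_derivative_0_imp_constant_on) (use convex_uhp in auto)
  moreover have "\<i> \<in> uhp" by (simp add: uhp_iff)
  ultimately have "R z = R \<i>" using z by (auto simp: constant_on_def)
  also have "R \<i> = 1" by (simp add: R_def power_numeral_reduce)
  finally show ?thesis using z by (auto simp: R_def uhp_iff field_simps)
qed

lemma Delta_add_int: "Delta (z + of_int n) = Delta z" by (simp add: Delta_def)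

lemma Delta_modular:
  assumes "mdet g = 1" "z \<in> uhp"
  shows "Delta (mact g z) = mj g z ^ 12 * Delta z"
proof -
  have "\<forall>z\<in>uhp. slash 12 g Delta z = Delta z"
  proof (rule SL2_induct[OF assms(1)])
    fix g n assume g: "mdet g = 1" "\<forall>z\<in>uhp. slash 12 g Delta z = Delta z"
    show "\<forall>z\<in>uhp. slash 12 (g * Tm n) Delta z = Delta z"
    proof
      fix z assume z: "z \<in> uhp"
      have "slash 12 (g * Tm n) Delta z = slash 12 (Tm n) (slash 12 g Delta) z"
        using g z by (intro slash_mult) auto
      also have "\<dots> = slash 12 (Tm n) Delta z" by (rule slash_cong) (use g z in auto)
      finally show "slash 12 (g * Tm n) Delta z = Delta z" by (simp add: slash_def Delta_add_int)
    qed
    show "\<forall>z\<in>uhp. slash 12 (g * Sm) Delta z = Delta z"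
    proof
      fix z assume z: "z \<in> uhp"
      have "slash 12 (g * Sm) Delta z = slash 12 Sm (slash 12 g Delta) z"
        using g z by (intro slash_mult) auto
      also have "\<dots> = slash 12 Sm Delta z" by (rule slash_cong) (use g z in auto)
      finally show "slash 12 (g * Sm) Delta z = Delta z"
        using z Delta_inversion[OF z] by (auto simp: slash_def uhp_iff)
    qed
  qed auto
  hence "Delta (mact g z) / mj g z ^ 12 = Delta z" using assms by (simp add: slash_def)
  thus ?thesis using assms mj_nonzero[of g z] by (simp add: divide_eq_eq mult.commute)
qed

text \<open>
  The function \<open>Delta / q\<close> extends continuously to \<open>q = 0\<close> and has no zeros.
\<close>

lemma Delta_bounds:
  obtains M where "\<And>z. Im z \<ge> 1 \<Longrightarrow> norm (Delta z) \<le> exp M * exp (- 2 * pi * Im z)"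
    "\<And>z. Im z \<ge> 1 \<Longrightarrow> norm (Delta z) \<ge> exp (- M) * exp (- 2 * pi * Im z)"
proof -
  let ?L = "eval_fps (logser (\<lambda>_. True))"
  have "ereal (exp (- 2 * pi)) < fps_conv_radius (logser (\<lambda>_. True))"
    by (rule less_le_trans[OF _ logser_radius]) simp
  hence "continuous_on (cball 0 (exp (- 2 * pi))) ?L"
    by (intro continuous_on_eval_fps' continuous_on_id) (use le_less_trans[of "ereal _" "ereal (exp (- 2 * pi))"] in auto)
  hence "bounded (?L ` cball 0 (exp (- 2 * pi)))"
    by (intro compact_imp_bounded compact_continuous_image) auto
  then obtain B where "\<forall>x\<in>cball 0 (exp (- 2 * pi)). norm (?L x) \<le> B"
    unfolding bounded_iff by auto
  hence B: "norm (?L x) \<le> B" if "norm x \<le> exp (- 2 * pi)" for x using that by simp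
  show ?thesis
  proof (rule that[of "24 * B"])
    fix z assume "Im z \<ge> 1"
    hence "norm (qq z) \<le> exp (- 2 * pi)" by (simp add: norm_qq)
    hence "\<bar>Re (?L (qq z))\<bar> \<le> B" using B abs_Re_le_cmod order.trans by blast
    moreover have "norm (Delta z) = exp (- 2 * pi * Im z) * exp (- 24 * Re (?L (qq z)))"
      by (simp add: Delta_def norm_mult norm_qq norm_exp)
    ultimately show "norm (Delta z) \<le> exp (24 * B) * exp (- 2 * pi * Im z)"
      "norm (Delta z) \<ge> exp (- (24 * B)) * exp (- 2 * pi * Im z)"
      by (auto simp: mult.commute[of "exp (- (2 * pi * Im z))"] intro!: mult_right_mono)
  qed
qed

section \<open>Integral power series and the generating functions of partitions\<close>

definition cfps :: "int fps \<Rightarrow> complex fps" where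
  "cfps A = Abs_fps (\<lambda>n. of_int (fps_nth A n))"

lemma cfps_nth [simp]: "fps_nth (cfps A) n = of_int (fps_nth A n)" by (simp add: cfps_def)
lemma cfps_mult [simp]: "cfps (A * B) = cfps A * cfps B"
  by (rule fps_ext) (simp add: fps_mult_nth)
lemma cfps_1 [simp]: "cfps 1 = 1" by (rule fps_ext) simp

text \<open>
  Holomorphy on the whole unit disc ensures that the series converges there, although an expansion
  \<open>has_fps_expansion\<close> speaks of a neighbourhood of \<open>0\<close> only.
\<close>

definition int_expansion :: "int fps \<Rightarrow> (complex \<Rightarrow> complex) \<Rightarrow> bool" where
  "int_expansion A g \<longleftrightarrow> g holomorphic_on ball 0 1 \<and> g has_fps_expansion cfps A"

lemma int_expansion_sums:
  assumes "int_expansion A g" "norm x < 1"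
  shows "(\<lambda>n. of_int (fps_nth A n) * x ^ n) sums g x"
proof -
  have "(\<lambda>n. (deriv ^^ n) g 0 / fact n * (x - 0) ^ n) sums g x"
    using assms by (intro holomorphic_power_series[of g 0 1]) (auto simp: int_expansion_def)
  moreover have "(deriv ^^ n) g 0 / fact n = of_int (fps_nth A n)" for n
    using assms fps_nth_fps_expansion[of g "cfps A" n] by (simp add: int_expansion_def)
  ultimately show ?thesis by simp
qed

lemma int_expansion_mult: "int_expansion A f \<Longrightarrow> int_expansion B g \<Longrightarrow> int_expansion (A * B) (\<lambda>x. f x * g x)"
  by (auto simp: int_expansion_def intro!: holomorphic_intros has_fps_expansion_mult)

lemma int_expansion_1: "int_expansion 1 (\<lambda>_. 1)"
  by (auto simp: int_expansion_def)

lemma int_expansion_power: "int_expansion A f \<Longrightarrow> int_expansion (A ^ n) (\<lambda>x. f x ^ n)"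
  by (induction n) (auto intro: int_expansion_1 int_expansion_mult)

lemma int_expansion_inverse:
  assumes A: "int_expansion A f" and AB: "A * B = 1" and nz: "\<And>x. norm x < 1 \<Longrightarrow> f x \<noteq> 0"
  shows "int_expansion B (\<lambda>x. inverse (f x))"
proof -
  have "fps_nth (A * B) 0 = 1" using AB by simp
  hence A0: "fps_nth A 0 \<noteq> 0" by (auto simp: fps_mult_nth)
  have "cfps A * cfps B = 1" using AB cfps_mult[of A B] by simp
  hence "inverse (cfps A) = cfps B" by (rule fps_inverse_unique)
  moreover have "(\<lambda>x. inverse (f x)) has_fps_expansion inverse (cfps A)"
    using A A0 by (intro has_fps_expansion_inverse) (auto simp: int_expansion_def)
  moreover have "(\<lambda>x. inverse (f x)) holomorphic_on ball 0 1"
    using A nz by (intro holomorphic_intros) (auto simp: int_expansion_def)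
  ultimately show ?thesis by (simp add: int_expansion_def)
qed

definition stretch :: "nat \<Rightarrow> int fps \<Rightarrow> int fps" where
  "stretch N A = Abs_fps (\<lambda>n. if N dvd n then fps_nth A (n div N) else 0)"

lemma stretch_nth: "fps_nth (stretch N A) n = (if N dvd n then fps_nth A (n div N) else 0)"
  by (simp add: stretch_def)

lemma sums_stretch:
  fixes x :: complex
  assumes N: "N > 0" and s: "(\<lambda>n. f n * (x ^ N) ^ n) sums S"
  shows "(\<lambda>n. (if N dvd n then f (n div N) else 0) * x ^ n) sums S"
proof -
  have "strict_mono (\<lambda>n. N * n)" using N by (auto simp: strict_mono_def)
  moreover have "(if N dvd n then f (n div N) else 0) * x ^ n = 0" if "n \<notin> range (\<lambda>n. N * n)" for n
    using that by (auto elim!: dvdE)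
  ultimately have "(\<lambda>n. (if N dvd N * n then f (N * n div N) else 0) * x ^ (N * n)) sums S \<longleftrightarrow> ?thesis"
    by (rule sums_mono_reindex)
  thus ?thesis using s N by (simp add: power_mult)
qed

lemma int_expansion_stretch:
  assumes "int_expansion A f" and N: "N > 0"
  shows "int_expansion (stretch N A) (\<lambda>x. f (x ^ N))"
proof -
  have pw: "norm (x ^ N) < 1" if "norm x < 1" for x :: complex
    using that N by (simp add: norm_power power_less_one_iff)
  have "f \<circ> (\<lambda>x. x ^ N) holomorphic_on ball 0 1"
    using assms pw by (intro holomorphic_on_compose_gen[of _ _ f "ball 0 1"]) (auto simp: int_expansion_def intro!: holomorphic_intros)
  moreover have "(\<lambda>x. f (x ^ N)) has_fps_expansion cfps (stretch N A)"
  proof (rule has_fps_expansionI)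
    have "eventually (\<lambda>x::complex. x \<in> ball 0 1) (nhds 0)" by (rule eventually_nhds_in_open) auto
    thus "eventually (\<lambda>x. (\<lambda>n. fps_nth (cfps (stretch N A)) n * x ^ n) sums f (x ^ N)) (nhds 0)"
    proof eventually_elim
      case (elim x)
      have "(\<lambda>n. (if N dvd n then of_int (fps_nth A (n div N)) else 0) * x ^ n) sums f (x ^ N)"
        by (rule sums_stretch[OF N int_expansion_sums[OF assms(1) pw]]) (use elim in simp)
      also have "(\<lambda>n. (if N dvd n then of_int (fps_nth A (n div N)) else 0) * x ^ n) = (\<lambda>n. fps_nth (cfps (stretch N A)) n * x ^ n)"
        by (auto simp: stretch_nth)
      finally show ?case .
    qed
  qed
  ultimately show ?thesis by (simp add: int_expansion_def o_def)
qed

definition parts_in :: "(nat \<Rightarrow> bool) \<Rightarrow> nat \<Rightarrow> nat multiset set" where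
  "parts_in P n = {M \<in> partitions n. \<forall>i\<in>#M. P i}"

lemma finite_parts_in [simp]: "finite (parts_in P n)"
  unfolding parts_in_def using finite_partitions[of n] by auto

lemma sum_mset_eq_sum_count: "\<Sum>\<^sub># M = (\<Sum>d\<in>set_mset M. d * count M d)" for M :: "nat multiset"
proof (induction M)
  case (add x M)
  show ?case
  proof (cases "x \<in># M")
    case True
    have "(\<Sum>d\<in>set_mset M. d * count (add_mset x M) d) = (\<Sum>d\<in>set_mset M. d * count M d + (if d = x then x else 0))"
      by (intro sum.cong) auto
    also have "\<dots> = (\<Sum>d\<in>set_mset M. d * count M d) + x" using True by (simp add: sum.distrib)
    finally show ?thesis using True add by (simp add: insert_absorb)
  next
    case False
    have "(\<Sum>d\<in>set_mset M. d * count (add_mset x M) d) = (\<Sum>d\<in>set_mset M. d * count M d)"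
      using False by (intro sum.cong) auto
    thus ?thesis using False add by (simp add: not_in_iff)
  qed
qed auto

lemma card_parts_with_copies:
  assumes d: "d > 0" "P d"
  shows "card {M \<in> parts_in P n. k \<le> count M d} = (if k * d \<le> n then card (parts_in P (n - k * d)) else 0)"
proof (cases "k * d \<le> n")
  case True
  have "bij_betw (\<lambda>M. M + replicate_mset k d) (parts_in P (n - k * d)) {M \<in> parts_in P n. k \<le> count M d}"
  proof (rule bij_betwI[of _ _ _ "\<lambda>M. M - replicate_mset k d"])
    show "(\<lambda>M. M + replicate_mset k d) \<in> parts_in P (n - k * d) \<rightarrow> {M \<in> parts_in P n. k \<le> count M d}"
      using True d by (auto simp: parts_in_def partitions_def sum_mset_replicate_mset)
    show "(\<lambda>M. M - replicate_mset k d) \<in> {M \<in> parts_in P n. k \<le> count M d} \<rightarrow> parts_in P (n - k * d)"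
    proof safe
      fix M assume M: "M \<in> parts_in P n" "k \<le> count M d"
      hence le: "replicate_mset k d \<subseteq># M" by (simp add: count_le_replicate_mset_subset_eq)
      hence "\<Sum>\<^sub># (M - replicate_mset k d) = n - k * d"
        using M by (simp add: sum_mset_diff parts_in_def partitions_def sum_mset_replicate_mset)
      thus "M - replicate_mset k d \<in> parts_in P (n - k * d)"
        using M by (auto simp: parts_in_def partitions_def dest: in_diffD)
    qed
  qed (auto simp: count_le_replicate_mset_subset_eq)
  thus ?thesis using True by (simp add: bij_betw_same_card)
next
  case False
  have "{M \<in> parts_in P n. k \<le> count M d} = {}"
  proof safe
    fix M assume M: "M \<in> parts_in P n" "k \<le> count M d"
    hence "replicate_mset k d \<subseteq># M" by (simp add: count_le_replicate_mset_subset_eq)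
    then obtain M' where "M = replicate_mset k d + M'" by (metis subset_mset.le_iff_add)
    hence "k * d \<le> \<Sum>\<^sub># M" by (simp add: sum_mset_replicate_mset)
    with M False show "M \<in> {}" by (simp add: parts_in_def partitions_def)
  qed
  thus ?thesis using False by (simp only: card.empty if_False)
qed

text \<open>
  Euler's recurrence. Count the sum of all parts of all partitions of \<open>n\<close> in two ways: it is \<open>n\<close> times their number, and
  it counts the triples of a partition, a part \<open>d\<close> and a \<open>k\<close> such that \<open>d\<close> occurs at least \<open>k\<close> times, with weight \<open>d\<close>;
  removing \<open>k\<close> copies of \<open>d\<close> leaves a partition of \<open>n - k d\<close>.
\<close>

lemma parts_recurrence:
  "n * card (parts_in P n) = (\<Sum>j\<le>n. dsum P j * card (parts_in P (n - j)))"
proof -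
  let ?D = "{d\<in>{1..n}. P d}"
  have "n * card (parts_in P n) = (\<Sum>M\<in>parts_in P n. \<Sum>\<^sub># M)"
    by (simp add: parts_in_def partitions_def)
  also have "\<dots> = (\<Sum>M\<in>parts_in P n. \<Sum>d\<in>?D. \<Sum>k\<in>{1..n}. if k \<le> count M d then d else 0)"
  proof (intro sum.cong refl)
    fix M assume M: "M \<in> parts_in P n"
    hence s: "(\<Sum>d\<in>set_mset M. d * count M d) = n"
      by (simp add: sum_mset_eq_sum_count[symmetric] parts_in_def partitions_def)
    have le: "d * count M d \<le> n" if "d \<in># M" for d
      unfolding s[symmetric] using that by (intro member_le_sum) auto
    have pos: "d > 0" "P d" if "d \<in># M" for d using that M by (auto simp: parts_in_def partitions_def)
    have sub: "set_mset M \<subseteq> ?D"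
    proof
      fix d assume d: "d \<in># M"
      hence "1 \<le> count M d" by (simp add: Suc_le_eq)
      hence "d * 1 \<le> d * count M d" by (rule mult_le_mono2)
      also note le[OF d]
      finally have "d \<le> n" by simp
      thus "d \<in> ?D" using pos[OF d] by auto
    qed
    have cle: "count M d \<le> n" for d
    proof (cases "d \<in># M")
      case True
      have "1 * count M d \<le> d * count M d" by (rule mult_le_mono1) (use pos[OF True] in simp)
      also note le[OF True]
      finally show ?thesis by simp
    qed (simp add: not_in_iff)
    have "(\<Sum>k\<in>{1..n}. if k \<le> count M d then d else 0) = d * count M d" for d
    proof -
      have "(\<Sum>k\<in>{1..n}. if k \<le> count M d then d else 0) = (\<Sum>k\<in>{1..count M d}. d)"
        using cle[of d] by (intro sum.mono_neutral_cong_right) auto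
      thus ?thesis by simp
    qed
    hence "(\<Sum>d\<in>?D. \<Sum>k\<in>{1..n}. if k \<le> count M d then d else 0) = (\<Sum>d\<in>?D. d * count M d)" by simp
    also have "\<dots> = (\<Sum>d\<in>set_mset M. d * count M d)"
      using sub by (intro sum.mono_neutral_right) (auto simp: not_in_iff)
    finally show "\<Sum>\<^sub># M = (\<Sum>d\<in>?D. \<Sum>k\<in>{1..n}. if k \<le> count M d then d else 0)"
      by (simp add: sum_mset_eq_sum_count)
  qed
  also have "\<dots> = (\<Sum>d\<in>?D. \<Sum>M\<in>parts_in P n. \<Sum>k\<in>{1..n}. if k \<le> count M d then d else 0)"
    by (rule sum.swap)
  also have "\<dots> = (\<Sum>d\<in>?D. \<Sum>k\<in>{1..n}. \<Sum>M\<in>parts_in P n. if k \<le> count M d then d else 0)"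
    by (rule sum.cong[OF refl], rule sum.swap)
  also have "\<dots> = (\<Sum>d\<in>?D. \<Sum>k\<in>{1..n}. if k * d \<le> n then d * card (parts_in P (n - k * d)) else 0)"
  proof (intro sum.cong refl)
    fix d k assume d: "d \<in> ?D"
    have "(\<Sum>M\<in>parts_in P n. if k \<le> count M d then d else 0) = d * card {M\<in>parts_in P n. k \<le> count M d}"
      by (subst sum.inter_filter[symmetric]) auto
    also have "card {M\<in>parts_in P n. k \<le> count M d} = (if k * d \<le> n then card (parts_in P (n - k * d)) else 0)"
      using d by (intro card_parts_with_copies) auto
    finally show "(\<Sum>M\<in>parts_in P n. if k \<le> count M d then d else 0) = (if k * d \<le> n then d * card (parts_in P (n - k * d)) else 0)"
      by simp
  qed
  also have "\<dots> = (\<Sum>(d,k)\<in>?D \<times> {1..n}. if k * d \<le> n then d * card (parts_in P (n - k * d)) else 0)"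
    by (rule sum.cartesian_product)
  also have "\<dots> = (\<Sum>(d,k)\<in>{(d,k). (d,k)\<in>?D \<times> {1..n} \<and> k * d \<le> n}. d * card (parts_in P (n - k * d)))"
    by (rule sum.mono_neutral_cong_right) (auto split: if_splits)
  also have "\<dots> = (\<Sum>(j,d)\<in>(SIGMA j:{..n}. {d\<in>{1..j}. d dvd j \<and> P d}). d * card (parts_in P (n - j)))"
  proof (rule sum.reindex_bij_witness[of _ "\<lambda>(j,d). (d, j div d)" "\<lambda>(d,k). (k * d, d)"])
    fix x assume "x \<in> {(d,k). (d,k)\<in>?D \<times> {1..n} \<and> k * d \<le> n}"
    thus "(case x of (d, k) \<Rightarrow> (k * d, d)) \<in> (SIGMA j:{..n}. {d\<in>{1..j}. d dvd j \<and> P d})"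
      by (auto simp: Suc_le_eq)
  next
    fix x assume "x \<in> (SIGMA j:{..n}. {d\<in>{1..j}. d dvd j \<and> P d})"
    thus "(case x of (j, d) \<Rightarrow> (d, j div d)) \<in> {(d,k). (d,k)\<in>?D \<times> {1..n} \<and> k * d \<le> n}"
      by (auto simp: Suc_le_eq div_greater_zero_iff intro: order.trans[OF div_le_dividend])
  qed auto
  also have "\<dots> = (\<Sum>j\<le>n. \<Sum>d\<in>{d\<in>{1..j}. d dvd j \<and> P d}. d * card (parts_in P (n - j)))"
    by (subst sum.Sigma) auto
  also have "\<dots> = (\<Sum>j\<le>n. dsum P j * card (parts_in P (n - j)))"
    by (simp add: dsum_def sum_distrib_right)
  finally show ?thesis .
qed

lemma card_parts_0: "card (parts_in P 0) = 1"
proof -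
  have "M = {#}" if "\<forall>i\<in>#M. 0 < i" "\<Sum>\<^sub># M = 0" for M :: "nat multiset"
    using that by (cases M) auto
  hence "parts_in P 0 = {{#}}" by (auto simp: parts_in_def partitions_def)
  thus ?thesis by simp
qed

definition parts_fps :: "(nat \<Rightarrow> bool) \<Rightarrow> int fps" where
  "parts_fps P = Abs_fps (\<lambda>n. int (card (parts_in P n)))"

lemma holomorphic_eval_logser: "eval_fps (logser P) holomorphic_on ball 0 1"
proof (rule holomorphic_on_subset[OF holomorphic_on_eval_fps])
  show "ball 0 1 \<subseteq> eball 0 (fps_conv_radius (logser P))"
    using logser_radius[of P] by (auto intro: ereal_less_of_ge_1)
qed auto

text \<open>
  The exponential \<open>E\<close> of the series \<open>L\<close> satisfies \<open>x E' = x L' E\<close>. In coefficients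
  this is Euler's recurrence, which determines them.
\<close>

lemma parts_expansion: "int_expansion (parts_fps P) (\<lambda>x. exp (eval_fps (logser P) x))"
proof -
  define E where "E = (\<lambda>x. exp (eval_fps (logser P) x))"
  have hol: "E holomorphic_on ball 0 1" unfolding E_def
    by (intro holomorphic_intros holomorphic_eval_logser)
  define F where "F = fps_expansion E 0"
  have F: "E has_fps_expansion F" unfolding F_def
    by (rule has_fps_expansion_fps_expansion[OF _ _ hol]) auto
  have r: "fps_conv_radius (logser P) > 0" using logser_radius[of P] by (rule less_le_trans[rotated]) simp
  have "fps_conv_radius (fps_deriv (logser P)) > 0" using r fps_conv_radius_deriv[of "logser P"] by (rule less_le_trans)
  hence L: "eval_fps (fps_deriv (logser P)) has_fps_expansion fps_deriv (logser P)" by (rule eval_fps_has_fps_expansion)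
  have "(\<lambda>x. eval_fps (fps_deriv (logser P)) x * E x) has_fps_expansion fps_deriv (logser P) * F"
    by (rule has_fps_expansion_mult[OF L F])
  also have "?this \<longleftrightarrow> deriv E has_fps_expansion fps_deriv (logser P) * F"
  proof (rule has_fps_expansion_cong)
    have "eventually (\<lambda>x::complex. x \<in> ball 0 1) (nhds 0)" by (rule eventually_nhds_in_open) auto
    thus "eventually (\<lambda>x. eval_fps (fps_deriv (logser P)) x * E x = deriv E x) (nhds 0)"
    proof eventually_elim
      case (elim x)
      have "ereal (norm x) < fps_conv_radius (logser P)"
        by (rule ereal_less_of_ge_1[OF _ logser_radius]) (use elim in simp)
      hence "(eval_fps (logser P) has_field_derivative eval_fps (fps_deriv (logser P)) x) (at x)"
        by (rule has_field_derivative_eval_fps)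
      hence "(E has_field_derivative (exp (eval_fps (logser P) x) * eval_fps (fps_deriv (logser P)) x)) (at x)"
        unfolding E_def by (rule DERIV_chain2[OF DERIV_exp])
      thus ?case by (simp add: DERIV_imp_deriv E_def mult.commute)
    qed
  qed auto
  finally have "fps_deriv F = fps_deriv (logser P) * F"
    using has_fps_expansion_deriv[OF F] by (rule fps_expansion_unique_complex[rotated])
  hence XF: "fps_X * fps_deriv F = dser P * F" by (simp add: mult.assoc[symmetric] logser_deriv)
  have rec: "of_nat n * fps_nth F n = (\<Sum>j\<le>n. of_nat (dsum P j) * fps_nth F (n - j))" for n
  proof -
    have "fps_nth (fps_X * fps_deriv F) n = of_nat n * fps_nth F n"
      by (cases n) (auto simp: fps_X_mult_nth)
    moreover have "fps_nth (dser P * F) n = (\<Sum>j\<le>n. of_nat (dsum P j) * fps_nth F (n - j))"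
      by (simp add: fps_mult_nth dser_def atLeast0AtMost)
    ultimately show ?thesis using XF by simp
  qed
  have F0: "fps_nth F 0 = 1"
    using fps_nth_fps_expansion[OF F, of 0] by (simp add: E_def eval_fps_at_0 logser_def)
  have "fps_nth F n = of_nat (card (parts_in P n))" for n
  proof (induction n rule: less_induct)
    case (less n)
    show ?case
    proof (cases "n = 0")
      case False
      have "of_nat n * fps_nth F n = (\<Sum>j\<in>{..n}-{0}. of_nat (dsum P j) * fps_nth F (n - j))"
        unfolding rec by (subst sum.remove[of _ 0]) auto
      also have "\<dots> = (\<Sum>j\<in>{..n}-{0}. of_nat (dsum P j) * of_nat (card (parts_in P (n - j))))"
        using False by (intro sum.cong refl) (subst less, auto)
      also have "\<dots> = (\<Sum>j\<le>n. of_nat (dsum P j) * of_nat (card (parts_in P (n - j))))"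
        by (subst (2) sum.remove[of _ 0]) auto
      also have "\<dots> = of_nat n * of_nat (card (parts_in P n))"
        using arg_cong[OF parts_recurrence[of n P], of "of_nat :: nat \<Rightarrow> complex"] by simp
      finally show ?thesis using False by simp
    qed (simp add: F0 card_parts_0)
  qed
  hence "F = cfps (parts_fps P)" by (intro fps_ext) (simp add: parts_fps_def)
  thus ?thesis using F hol unfolding int_expansion_def E_def by simp
qed


section \<open>Congruences between integral power series\<close>

lemma of_nat_dvd_fps_iff: "(of_nat m :: int fps) dvd A \<longleftrightarrow> (\<forall>n. int m dvd fps_nth A n)"
proof
  assume "of_nat m dvd A"
  then obtain B where "A = of_nat m * B" by (elim dvdE)
  thus "\<forall>n. int m dvd fps_nth A n" by (simp add: fps_of_nat[symmetric])
next
  assume *: "\<forall>n. int m dvd fps_nth A n"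
  have "A = of_nat m * Abs_fps (\<lambda>n. fps_nth A n div int m)"
    by (rule fps_ext) (use * in \<open>simp add: fps_of_nat[symmetric]\<close>)
  thus "of_nat m dvd A" by (metis dvd_triv_left)
qed

lemma prime_dvd_add_power_diff:
  fixes a b :: "'a :: comm_ring_1"
  assumes "prime m"
  shows "of_nat m dvd (a + b) ^ m - (a ^ m + b ^ m)"
proof -
  have m: "m > 0" using assms by (simp add: prime_gt_0_nat)
  have "(a + b) ^ m = (\<Sum>k\<le>m. of_nat (m choose k) * a ^ k * b ^ (m - k))" by (rule binomial_ring)
  also have "{..m} = insert 0 (insert m {0<..<m})" using m by auto
  also have "(\<Sum>k\<in>\<dots>. of_nat (m choose k) * a ^ k * b ^ (m - k)) =
      b ^ m + (a ^ m + (\<Sum>k\<in>{0<..<m}. of_nat (m choose k) * a ^ k * b ^ (m - k)))"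
    using m by (subst sum.insert, simp, simp, subst sum.insert) auto
  finally have "(a + b) ^ m - (a ^ m + b ^ m) = (\<Sum>k\<in>{0<..<m}. of_nat (m choose k) * a ^ k * b ^ (m - k))"
    by simp
  also have "of_nat m dvd \<dots>"
  proof (intro dvd_sum dvd_mult2)
    fix k assume "k \<in> {0<..<m}"
    hence "m dvd (m choose k)" using assms by (intro dvd_choose_prime) auto
    then obtain j where "m choose k = m * j" by (elim dvdE)
    thus "(of_nat m :: 'a) dvd of_nat (m choose k)" by simp
  qed
  finally show ?thesis .
qed

lemma prime_dvd_sum_power_diff:
  fixes f :: "'b \<Rightarrow> 'a :: comm_ring_1"
  assumes "prime m" "finite I"
  shows "of_nat m dvd (\<Sum>i\<in>I. f i) ^ m - (\<Sum>i\<in>I. f i ^ m)"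
  using assms(2)
proof (induction I rule: finite_induct)
  case empty
  have "m > 0" using assms by (simp add: prime_gt_0_nat)
  thus ?case by (simp add: power_0_left)
next
  case (insert x I)
  have "(\<Sum>i\<in>insert x I. f i) ^ m - (\<Sum>i\<in>insert x I. f i ^ m) =
     ((f x + (\<Sum>i\<in>I. f i)) ^ m - (f x ^ m + (\<Sum>i\<in>I. f i) ^ m)) + ((\<Sum>i\<in>I. f i) ^ m - (\<Sum>i\<in>I. f i ^ m))"
    using insert by simp
  thus ?case using insert prime_dvd_add_power_diff[OF assms(1), of "f x" "\<Sum>i\<in>I. f i"] by (metis dvd_add)
qed

lemma fermat_int:
  fixes a :: int assumes "prime m" shows "int m dvd a ^ m - a"
proof -
  have nat_case: "int m dvd (int n) ^ m - int n" for n
  proof (induction n)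
    case 0
    have "m > 0" using assms by (simp add: prime_gt_0_nat)
    thus ?case by (simp add: power_0_left)
  next
    case (Suc n)
    have "int (Suc n) ^ m - int (Suc n) = ((int n + 1) ^ m - (int n ^ m + 1 ^ m)) + (int n ^ m - int n)"
      by (simp add: add_ac)
    thus ?case using Suc prime_dvd_add_power_diff[OF assms, of "int n" 1] by (metis dvd_add)
  qed
  define r where "r = a mod int m"
  have m: "m > 0" using assms by (simp add: prime_gt_0_nat)
  hence "r = int (nat r)" by (simp add: r_def)
  hence "int m dvd r ^ m - r" using nat_case[of "nat r"] by simp
  moreover have "[a ^ m - a = r ^ m - r] (mod int m)"
    unfolding r_def by (intro cong_diff cong_pow) (auto simp: cong_def)
  ultimately show ?thesis by (simp add: cong_dvd_iff)
qed

text \<open>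
  Frobenius: \<open>A (x) ^ m\<close> and \<open>A (x ^ m)\<close> agree modulo the prime \<open>m\<close>. Each coefficient involves a polynomial
  truncation of \<open>A\<close> only, to which the additivity of the \<open>m\<close>-th power and Fermat's theorem apply.
\<close>

lemma fps_power_prime_cong_stretch:
  assumes "prime m"
  shows "(of_nat m :: int fps) dvd A ^ m - stretch m A"
  unfolding of_nat_dvd_fps_iff
proof
  fix n
  have m: "m > 0" using assms by (simp add: prime_gt_0_nat)
  define S where "S = (\<Sum>i\<le>n. fps_const (fps_nth A i) * fps_X ^ i)"
  define R where "R = fps_shift (Suc n) A"
  have A: "A = S + fps_X ^ Suc n * R"
  proof (rule fps_ext)
    fix j
    have "fps_nth S j = (if j \<le> n then fps_nth A j else 0)"
      by (simp add: S_def fps_sum_nth fps_X_power_nth if_distrib[of "\<lambda>x. _ * x"] cong: if_cong)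
    thus "fps_nth A j = fps_nth (S + fps_X ^ Suc n * R) j"
      by (simp add: R_def fps_X_power_mult_nth del: power_Suc)
  qed
  have 1: "of_nat m dvd A ^ m - (S ^ m + (fps_X ^ Suc n * R) ^ m)"
    unfolding A by (rule prime_dvd_add_power_diff[OF assms])
  have 2: "of_nat m dvd S ^ m - (\<Sum>i\<le>n. (fps_const (fps_nth A i) * fps_X ^ i) ^ m)"
    unfolding S_def by (rule prime_dvd_sum_power_diff[OF assms]) simp
  have "of_nat m dvd A ^ m - ((\<Sum>i\<le>n. (fps_const (fps_nth A i) * fps_X ^ i) ^ m) + (fps_X ^ Suc n * R) ^ m)"
    using dvd_add[OF 1 2] by (simp add: algebra_simps)
  hence "int m dvd fps_nth (A ^ m - ((\<Sum>i\<le>n. (fps_const (fps_nth A i) * fps_X ^ i) ^ m) + (fps_X ^ Suc n * R) ^ m)) n"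
    by (simp only: of_nat_dvd_fps_iff)
  also have "fps_nth (A ^ m - ((\<Sum>i\<le>n. (fps_const (fps_nth A i) * fps_X ^ i) ^ m) + (fps_X ^ Suc n * R) ^ m)) n =
      fps_nth (A ^ m) n - (\<Sum>i\<le>n. if i * m = n then fps_nth A i ^ m else 0)"
  proof -
    have "fps_nth ((fps_X ^ Suc n * R) ^ m) n = 0"
    proof -
      have "(fps_X ^ Suc n * R) ^ m = fps_X ^ (Suc n * m) * R ^ m"
        by (simp only: power_mult_distrib power_mult)
      moreover have "n < Suc n * m" using m by (cases m) auto
      ultimately show ?thesis by (simp only: fps_X_power_mult_nth if_True)
    qed
    moreover have "fps_nth (\<Sum>i\<le>n. (fps_const (fps_nth A i) * fps_X ^ i) ^ m) n = (\<Sum>i\<le>n. if i * m = n then fps_nth A i ^ m else 0)"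
      by (auto simp: fps_sum_nth power_mult_distrib fps_const_power power_mult[symmetric] fps_X_power_nth intro!: sum.cong)
    ultimately show ?thesis by simp
  qed
  also have "(\<Sum>i\<le>n. if i * m = n then fps_nth A i ^ m else 0) = (if m dvd n then fps_nth A (n div m) ^ m else 0)"
  proof (cases "m dvd n")
    case True
    then obtain k where k: "n = m * k" by (elim dvdE)
    hence "(\<Sum>i\<le>n. if i * m = n then fps_nth A i ^ m else 0) = (\<Sum>i\<le>n. if i = k then fps_nth A i ^ m else 0)"
      using m by (intro sum.cong) auto
    also have "\<dots> = fps_nth A k ^ m" using k m by (simp add: sum.delta)
    finally show ?thesis using k m by simp
  next
    case False
    hence "(\<Sum>i\<le>n. if i * m = n then fps_nth A i ^ m else 0) = 0" by (intro sum.neutral) auto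
    thus ?thesis using False by simp
  qed
  finally have "int m dvd fps_nth (A ^ m) n - (if m dvd n then fps_nth A (n div m) ^ m else 0)" .
  moreover have "int m dvd (if m dvd n then fps_nth A (n div m) ^ m else 0) - fps_nth (stretch m A) n"
    using fermat_int[OF assms] by (simp add: stretch_nth)
  ultimately show "int m dvd fps_nth (A ^ m - stretch m A) n"
    using dvd_add by fastforce
qed

section \<open>The eta quotient of the regular partitions\<close>

text \<open>
  The Hermite normal form. It reduces the behaviour at every cusp to that of an
  upper triangular substitution at infinity.
\<close>

lemma upper_triangular_decomposition:
  assumes "mdet B > 0"
  obtains \<sigma> U where "mdet \<sigma> = 1" "B = \<sigma> * U" "mc U = 0" "ma U > 0" "md U > 0" "mdet U = mdet B"
proof -
  define g where "g = gcd (ma B) (mc B)"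
  have "g \<noteq> 0" using assms by (auto simp: g_def mdet_def)
  hence g: "g > 0" by (simp add: g_def order_le_less)
  define a where "a = ma B div g"
  define c where "c = mc B div g"
  have ac: "ma B = g * a" "mc B = g * c" by (simp_all add: a_def c_def g_def)
  have "coprime a c" using \<open>g \<noteq> 0\<close> unfolding a_def c_def g_def by (intro div_gcd_coprime) auto
  then obtain x y where xy: "x * a + y * c = 1" by (metis bezout_int coprime_iff_gcd_eq_1)
  define \<sigma> where "\<sigma> = Mat2 a (-y) c x"
  have s: "mdet \<sigma> = 1" using xy by (simp add: \<sigma>_def algebra_simps)
  define U where "U = adj \<sigma> * B"
  have B: "B = \<sigma> * U" using mult_adj[OF s] by (simp add: U_def mult.assoc[symmetric])
  have c0: "mc U = 0" by (simp add: U_def \<sigma>_def ac)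
  have "ma U = g * (x * a + y * c)" by (simp add: U_def \<sigma>_def ac algebra_simps)
  hence a0: "ma U = g" by (simp add: xy)
  have "mdet U = mdet B" using B s by simp
  moreover have "md U > 0"
  proof (rule zero_less_mult_pos)
    show "0 < g * md U" using calculation assms a0 c0 unfolding mdet_def[of U] by simp
  qed (fact g)
  ultimately show ?thesis using that[OF s B c0] a0 g by simp
qed

text \<open>
  The usual \<open>e(x)\<close>, with a root of unity as value at every rational number.
\<close>

definition ex :: "real \<Rightarrow> complex" where "ex x = exp (2 * of_real pi * \<i> * of_real x)"

lemma ex_add: "ex (x + y) = ex x * ex y" by (simp add: ex_def algebra_simps exp_add)
lemma ex_0 [simp]: "ex 0 = 1" by (simp add: ex_def)
lemma ex_int [simp]: "ex (of_int n) = 1"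
  unfolding ex_def by (auto simp: exp_eq_1 algebra_simps intro!: exI[of _ n])
lemma ex_nonzero [simp]: "ex x \<noteq> 0" by (simp add: ex_def)
lemma ex_minus: "ex (- x) = inverse (ex x)" by (simp add: ex_def exp_minus)

lemma ex_cong: assumes "(a - b) mod M = 0" "M \<noteq> (0::int)" shows "ex (of_int a / of_int M) = ex (of_int b / of_int M)"
proof -
  obtain t where "a - b = M * t" using assms(1) by auto
  hence "a = b + M * t" by simp
  hence "of_int a / of_int M = of_int b / of_int M + (of_int t :: real)" using assms(2) by (simp add: field_simps)
  thus ?thesis by (simp add: ex_add)
qed

text \<open>
  This is \<open>\<eta>(k z) / \<eta>(z)\<close>, that is \<open>q ^ ((k - 1) / 24)\<close> times the generating function of the
  \<open>k\<close>-regular partitions.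
\<close>

definition reg_eta :: "nat \<Rightarrow> complex \<Rightarrow> complex" where
  "reg_eta k z = exp (2 * of_real pi * \<i> * z * of_real ((real k - 1) / 24)) * exp (eval_fps (logser (\<lambda>i. \<not> k dvd i)) (qq z))"

lemma reg_eta_nonzero [simp]: "reg_eta k z \<noteq> 0" by (simp add: reg_eta_def)

lemma holomorphic_reg_eta: "reg_eta k holomorphic_on uhp"
proof -
  have "eval_fps (logser (\<lambda>i. \<not> k dvd i)) \<circ> qq holomorphic_on uhp"
  proof (rule holomorphic_on_compose_gen[OF _ holomorphic_eval_logser])
    show "qq holomorphic_on uhp" unfolding qq_def[abs_def] by (intro holomorphic_intros)
  qed (use norm_qq_less in auto)
  thus ?thesis unfolding reg_eta_def[abs_def] o_def by (intro holomorphic_intros) auto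
qed

lemma reg_eta_add_int: "reg_eta k (z + of_int n) = ex (of_int n * (real k - 1) / 24) * reg_eta k z"
  by (simp add: reg_eta_def ex_def exp_add[symmetric] algebra_simps add_divide_distrib)

lemma dsum_regular:
  assumes k: "k > 1"
  shows "dsum (\<lambda>i. \<not> k dvd i) n + (if k dvd n then k * dsum (\<lambda>_. True) (n div k) else 0) = dsum (\<lambda>_. True) n"
proof -
  have "dsum (\<lambda>_. True) n = (\<Sum>d\<in>{d\<in>{1..n}. d dvd n \<and> \<not> k dvd d} \<union> {d\<in>{1..n}. d dvd n \<and> k dvd d}. d)"
    unfolding dsum_def by (intro sum.cong) auto
  also have "\<dots> = dsum (\<lambda>i. \<not> k dvd i) n + (\<Sum>d\<in>{d\<in>{1..n}. d dvd n \<and> k dvd d}. d)"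
    unfolding dsum_def by (subst sum.union_disjoint) auto
  also have "(\<Sum>d\<in>{d\<in>{1..n}. d dvd n \<and> k dvd d}. d) = (if k dvd n then k * dsum (\<lambda>_. True) (n div k) else 0)"
  proof (cases "k dvd n")
    case True
    then obtain r where r: "n = k * r" by (elim dvdE)
    have "(\<Sum>d\<in>{d\<in>{1..n}. d dvd n \<and> k dvd d}. d) = (\<Sum>d\<in>{d\<in>{1..r}. d dvd r \<and> True}. k * d)"
      by (rule sum.reindex_bij_witness[of _ "\<lambda>d. k * d" "\<lambda>d. d div k"]) (use k r in \<open>auto elim!: dvdE simp: Suc_le_eq\<close>)
    thus ?thesis using r k by (simp add: dsum_def sum_distrib_left)
  next
    case False
    hence "{d\<in>{1..n}. d dvd n \<and> k dvd d} = {}" by (auto dest: dvd_trans)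
    thus ?thesis using False by simp
  qed
  finally show ?thesis by simp
qed

text \<open>
  The divisors of \<open>n\<close> that are multiples of \<open>k\<close> are \<open>k\<close> times the divisors of \<open>n / k\<close>.
\<close>

lemma eval_logser_regular:
  assumes k: "k > 1" and x: "norm x < 1"
  shows "eval_fps (logser (\<lambda>i. \<not> k dvd i)) x = eval_fps (logser (\<lambda>_. True)) x - eval_fps (logser (\<lambda>_. True)) (x ^ k)"
proof -
  have s: "(\<lambda>n. fps_nth (logser P) n * y ^ n) sums eval_fps (logser P) y" if "norm y < 1" for P and y :: complex
    by (rule sums_eval_fps, rule ereal_less_of_ge_1[OF that logser_radius])
  have xk: "norm (x ^ k) < 1" using x k by (simp add: norm_power power_less_one_iff)
  have "(\<lambda>n. fps_nth (logser (\<lambda>_. True)) n * x ^ n - (if k dvd n then fps_nth (logser (\<lambda>_. True)) (n div k) else 0) * x ^ n)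
      sums (eval_fps (logser (\<lambda>_. True)) x - eval_fps (logser (\<lambda>_. True)) (x ^ k))"
    using k by (intro sums_diff s x sums_stretch s xk) auto
  moreover have "fps_nth (logser (\<lambda>_. True)) n * x ^ n - (if k dvd n then fps_nth (logser (\<lambda>_. True)) (n div k) else 0) * x ^ n
     = fps_nth (logser (\<lambda>i. \<not> k dvd i)) n * x ^ n" for n
  proof -
    have e: "of_nat (dsum (\<lambda>_. True) n) = (of_nat (dsum (\<lambda>i. \<not> k dvd i) n) + (if k dvd n then of_nat k * of_nat (dsum (\<lambda>_. True) (n div k)) else 0) :: complex)"
      using arg_cong[OF dsum_regular[OF k, of n], of "of_nat :: nat \<Rightarrow> complex"] by (simp split: if_splits)
    show ?thesis
    proof (cases "k dvd n")
      case True
      then obtain r where r: "n = k * r" by (elim dvdE)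
      show ?thesis using k e by (simp add: logser_def r add_divide_distrib algebra_simps)
    next
      case False
      thus ?thesis using e by (simp add: logser_def)
    qed
  qed
  ultimately show ?thesis using s[OF x, of "\<lambda>i. \<not> k dvd i"] by (simp add: sums_iff)
qed

lemma reg_eta_power_24:
  assumes k: "k > 1" and z: "z \<in> uhp"
  shows "reg_eta k z ^ 24 * Delta z = Delta (of_nat k * z)"
proof -
  define L where "L = eval_fps (logser (\<lambda>_. True))"
  have "reg_eta k z ^ 24 = exp (2 * of_real pi * \<i> * z * of_real (real k - 1)) * exp (24 * (L (qq z) - L (qq z ^ k)))"
  proof -
    have "24 * (2 * of_real pi * \<i> * z * of_real ((real k - 1) / 24)) = 2 * of_real pi * \<i> * z * of_real (real k - 1)" by simp
    moreover have "exp a ^ 24 = exp (24 * a)" for a :: complex by (simp add: exp_of_nat_mult[symmetric])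
    ultimately show ?thesis
      unfolding reg_eta_def eval_logser_regular[OF k norm_qq_less[OF z]] L_def by (simp only: power_mult_distrib)
  qed
  also have "\<dots> * Delta z = exp (2 * of_real pi * \<i> * z * of_real (real k - 1) + 24 * (L (qq z) - L (qq z ^ k)) + 2 * of_real pi * \<i> * z - 24 * L (qq z))"
  proof -
    have "exp A * exp (24 * (a - b)) * (exp Q * exp (- 24 * a)) = exp (A + 24 * (a - b) + Q - 24 * a)" for A a b Q :: complex
      by (simp only: exp_add[symmetric]) (simp add: algebra_simps)
    thus ?thesis unfolding Delta_def L_def[symmetric] by (simp only: qq_def)
  qed
  also have "2 * of_real pi * \<i> * z * of_real (real k - 1) + 24 * (L (qq z) - L (qq z ^ k)) + 2 * of_real pi * \<i> * z - 24 * L (qq z)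
     = 2 * of_real pi * \<i> * (of_nat k * z) + - 24 * L (qq (of_nat k * z))"
    by (simp only: qq_mult_nat) (simp add: algebra_simps)
  also have "exp (2 * of_real pi * \<i> * (of_nat k * z) + - 24 * L (qq (of_nat k * z))) = Delta (of_nat k * z)"
    by (simp only: exp_add Delta_def L_def qq_def)
  finally show ?thesis .
qed

text \<open>
  This removes 24th powers: identities known for \<open>Delta\<close> descend to eta quotients
  up to a constant root of unity.
\<close>

lemma constant_if_power_constant:
  assumes "g holomorphic_on uhp" "\<And>z. z \<in> uhp \<Longrightarrow> g z ^ 24 = C" "C \<noteq> 0"
  obtains c where "\<And>z. z \<in> uhp \<Longrightarrow> g z = c" "c ^ 24 = C"
proof -
  have "(g has_field_derivative 0) (at z)" if z: "z \<in> uhp" for z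
  proof -
    obtain D where D: "(g has_field_derivative D) (at z)"
      using assms(1) z open_uhp by (metis field_differentiable_def holomorphic_on_imp_differentiable_at)
    have "((\<lambda>z. g z ^ 24) has_field_derivative (24 * g z ^ 23 * D)) (at z)"
      by (rule derivative_eq_intros D refl)+ simp
    moreover have "((\<lambda>z. g z ^ 24) has_field_derivative 0) (at z)"
      by (rule has_field_derivative_transform_within_open[of "\<lambda>_. C" _ _ uhp]) (use assms z in auto)
    ultimately have "24 * g z ^ 23 * D = 0" by (rule DERIV_unique)
    moreover have "g z \<noteq> 0" using assms(2)[OF z] assms(3) by auto
    ultimately have "D = 0" by simp
    thus ?thesis using D by simp
  qed
  hence "g constant_on uhp" by (intro has_field_derivative_0_imp_constant_on) auto
  then obtain c where c: "\<And>z. z \<in> uhp \<Longrightarrow> g z = c" by (auto simp: constant_on_def)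
  have "\<i> \<in> uhp" by (simp add: uhp_iff)
  thus ?thesis using that[OF c] assms(2)[of \<i>] c by metis
qed

lemma uhp_scale: "z \<in> uhp \<Longrightarrow> k > 0 \<Longrightarrow> of_nat k * z \<in> uhp" by (simp add: uhp_iff)

lemma reg_eta_Gamma0:
  assumes k: "k > 1" and g: "mdet g = 1" "int k dvd mc g"
  obtains c where "\<And>z. z \<in> uhp \<Longrightarrow> reg_eta k (mact g z) = c * reg_eta k z"
proof -
  define h where "h = (\<lambda>z. slash 0 g (reg_eta k) z / reg_eta k z)"
  have "h holomorphic_on uhp" unfolding h_def
    by (intro holomorphic_intros holomorphic_slash holomorphic_reg_eta) (use g in auto)
  moreover have "h z ^ 24 = 1" if z: "z \<in> uhp" for z
  proof -
    have gz: "mact g z \<in> uhp" using g z by (intro mact_uhp) auto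
    obtain c' where c': "mc g = int k * c'" using g by (elim dvdE)
    define g' where "g' = Mat2 (ma g) (int k * mb g) c' (md g)"
    have g': "mdet g' = 1" using g c' by (simp add: g'_def mdet_def algebra_simps)
    have kz: "of_nat k * z \<in> uhp" using uhp_scale[OF z, of k] k by simp
    have a: "mact g' (of_nat k * z) = of_nat k * mact g z" and j: "mj g' (of_nat k * z) = mj g z"
      by (simp_all add: mact_def mj_def g'_def c' algebra_simps)
    have "reg_eta k (mact g z) ^ 24 * Delta (mact g z) = Delta (mact g' (of_nat k * z))"
      using reg_eta_power_24[OF k gz] by (simp add: a)
    also have "\<dots> = mj g z ^ 12 * (reg_eta k z ^ 24 * Delta z)"
      using Delta_modular[OF g' kz] by (simp add: j reg_eta_power_24[OF k z])
    finally have "reg_eta k (mact g z) ^ 24 * (mj g z ^ 12 * Delta z) = mj g z ^ 12 * (reg_eta k z ^ 24 * Delta z)"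
      using Delta_modular[OF g(1) z] by simp
    hence "reg_eta k (mact g z) ^ 24 = reg_eta k z ^ 24" using mj_nonzero[of g z] g z by simp
    thus ?thesis by (simp add: h_def slash_def power_divide)
  qed
  ultimately obtain c where c: "\<And>z. z \<in> uhp \<Longrightarrow> h z = c" by (rule constant_if_power_constant) auto
  show ?thesis by (rule that[of c]) (use c in \<open>auto simp: h_def slash_def field_simps\<close>)
qed

text \<open>
  Inversion exchanges \<open>\<eta>(k z) / \<eta>(z)\<close> with its inverse at \<open>z / k\<close>. Applied twice in a row,
  the constant cancels.
\<close>

lemma reg_eta_inversion:
  assumes k: "k > 1"
  obtains c where "\<And>z. z \<in> uhp \<Longrightarrow> reg_eta k (- 1 / z) = c / reg_eta k (z / of_nat k)"
proof -
  define h where "h = (\<lambda>z. slash 0 Sm (reg_eta k) z * reg_eta k (z / of_nat k))"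
  have dv: "z / of_nat k \<in> uhp" if "z \<in> uhp" for z using that k by (simp add: uhp_iff Im_divide_of_nat)
  have "(reg_eta k \<circ> (\<lambda>z. z / of_nat k)) holomorphic_on uhp"
    by (rule holomorphic_on_compose_gen[OF _ holomorphic_reg_eta]) (use dv k in \<open>auto intro!: holomorphic_intros\<close>)
  hence "h holomorphic_on uhp" unfolding h_def
    by (intro holomorphic_intros holomorphic_slash holomorphic_reg_eta) (auto simp: o_def)
  moreover have "h z ^ 24 = 1 / of_nat k ^ 12" if z: "z \<in> uhp" for z
  proof -
    let ?w = "z / of_nat k"
    have w: "?w \<in> uhp" using dv[OF z] .
    have mz: "-1 / z \<in> uhp" using mact_uhp[of Sm z] z by simp
    have z0: "z \<noteq> 0" using z by (auto simp: uhp_iff)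
    have 1: "reg_eta k ?w ^ 24 * Delta ?w = Delta z" using reg_eta_power_24[OF k w] k by simp
    have "reg_eta k (-1/z) ^ 24 * Delta (-1/z) = Delta (-1 / ?w)" using reg_eta_power_24[OF k mz] by simp
    hence "reg_eta k (-1/z) ^ 24 * (z ^ 12 * (reg_eta k ?w ^ 24 * Delta ?w)) = ?w ^ 12 * Delta ?w"
      by (simp only: Delta_inversion[OF z] Delta_inversion[OF w] 1)
    hence "reg_eta k (-1/z) ^ 24 * reg_eta k ?w ^ 24 * z ^ 12 = ?w ^ 12" by (simp add: mult_ac)
    hence "reg_eta k (-1/z) ^ 24 * reg_eta k ?w ^ 24 = 1 / of_nat k ^ 12"
      using z0 k by (simp add: power_divide field_simps)
    thus ?thesis by (simp add: h_def slash_def power_mult_distrib)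
  qed
  ultimately obtain c where c: "\<And>z. z \<in> uhp \<Longrightarrow> h z = c"
    by (rule constant_if_power_constant) (use k in auto)
  show ?thesis by (rule that[of c]) (use c in \<open>auto simp: h_def slash_def field_simps\<close>)
qed

text \<open>
  The lower triangular generator is a translation conjugated by the inversion, so that the constant
  of the inversion cancels.
\<close>

lemma reg_eta_lower:
  assumes k: "k > 1" and z: "z \<in> uhp"
  shows "reg_eta k (mact (Mat2 1 0 (int k * n) 1) z) = ex (of_int n * (real k - 1) / 24) * reg_eta k z"
proof -
  obtain c where c: "\<And>z. z \<in> uhp \<Longrightarrow> reg_eta k (- 1 / z) = c / reg_eta k (z / of_nat k)"
    using reg_eta_inversion[OF k] by blast
  have z0: "z \<noteq> 0" using z by (auto simp: uhp_iff)
  define u where "u = - 1 / z"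
  have u: "u \<in> uhp" using mact_uhp[of Sm z] z by (simp add: u_def)
  have u': "u + of_int (- int k * n) \<in> uhp" using u by (simp add: uhp_iff)
  hence u'0: "u + of_int (- int k * n) \<noteq> 0" by (auto simp: uhp_iff)
  have "mact (Mat2 1 0 (int k * n) 1) z = - 1 / (u + of_int (- int k * n))"
  proof -
    have e: "u + of_int (- int k * n) = - (of_int (int k * n) * z + 1) / z" using z0 by (simp add: u_def field_simps)
    have "- 1 / (- a / b) = b / a" for a b :: complex by simp
    thus ?thesis by (simp only: e) (simp add: mact_def)
  qed
  hence "reg_eta k (mact (Mat2 1 0 (int k * n) 1) z) = c / reg_eta k ((u + of_int (- int k * n)) / of_nat k)"
    using c[OF u'] by simp
  also have "(u + of_int (- int k * n)) / of_nat k = u / of_nat k + of_int (- n)" using k by (simp add: field_simps)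
  also have "reg_eta k \<dots> = ex (- (of_int n * (real k - 1) / 24)) * reg_eta k (u / of_nat k)"
    by (subst reg_eta_add_int) simp
  also have "c / \<dots> = ex (of_int n * (real k - 1) / 24) * (c / reg_eta k (u / of_nat k))"
  proof -
    have "c / (inverse e * r) = e * (c / r)" if "e \<noteq> 0" for e r :: complex
      using that by (simp add: field_simps)
    thus ?thesis by (simp only: ex_minus ex_nonzero not_False_eq_True)
  qed
  also have "c / reg_eta k (u / of_nat k) = reg_eta k z" using c[OF u] z0 by (simp add: u_def)
  finally show ?thesis .
qed

text \<open>
  At every cusp \<open>g\<close> the function \<open>f\<close> has at most a pole of order \<open>(k - 1) / (24 k)\<close> in \<open>q\<close>.
  In terms of \<open>Delta\<close>, the matrix \<open>diag(k, 1) g\<close> is brought to upper triangular form \<open>(A, B; 0, D)\<close> with \<open>A D = k\<close>,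
  and the worst case is \<open>D = k\<close>.
\<close>

lemma reg_eta_growth:
  assumes k: "k > 1" and g: "mdet g = 1"
  shows "\<exists>C. \<forall>z. Im z \<ge> real k \<longrightarrow> norm (reg_eta k (mact g z)) \<le> C * exp (2 * pi * Im z * ((real k - 1) / (24 * real k)))"
proof -
  obtain M where up: "\<And>z. Im z \<ge> 1 \<Longrightarrow> norm (Delta z) \<le> exp M * exp (- 2 * pi * Im z)"
    and lo: "\<And>z. Im z \<ge> 1 \<Longrightarrow> norm (Delta z) \<ge> exp (- M) * exp (- 2 * pi * Im z)"
    using Delta_bounds by blast
  define K where "K = Mat2 (int k) 0 0 1"
  have K: "mdet (K * g) = int k" using g by (simp add: K_def)
  obtain \<sigma> U where s: "mdet \<sigma> = 1" and KU: "K * g = \<sigma> * U" and U: "mc U = 0" "ma U > 0" "md U > 0" and "mdet U = mdet (K * g)"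
    by (rule upper_triangular_decomposition[of "K * g"]) (use K k in simp)
  hence U4: "mdet U = int k" using K by simp
  note U = U U4
  have AD: "ma U * md U = int k" using U by (simp add: mdet_def)
  show ?thesis
  proof (rule exI[of _ "exp (2 * M / 24)"], intro allI impI)
    fix z assume imz: "Im z \<ge> real k"
    hence z: "z \<in> uhp" and imz1: "Im z \<ge> 1" using k by (auto simp: uhp_iff)
    define w where "w = mact U z"
    have w: "w \<in> uhp" unfolding w_def using U k z by (intro mact_uhp) auto
    have gz: "mact g z \<in> uhp" using g z by (intro mact_uhp) auto
    have mjU: "mj U z = of_int (md U)" using U by (simp add: mj_def)
    have "mact (K * g) z = of_nat k * mact g z"
      using mact_mult[of K g z] g z k by (simp add: K_def mact_def)
    hence e1: "mact \<sigma> w = of_nat k * mact g z"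
      using mact_mult[of \<sigma> U z] s U k z KU by (simp add: w_def)
    have "mj (K * g) z = mj g z" using mj_mult[of g z K] g z by (simp add: K_def mj_def)
    hence e2: "mj \<sigma> w * of_int (md U) = mj g z"
      using mj_mult[of U z \<sigma>] U k z KU by (simp add: w_def mjU)
    have "reg_eta k (mact g z) ^ 24 * (mj g z ^ 12 * Delta z) = mj \<sigma> w ^ 12 * Delta w"
      using reg_eta_power_24[OF k gz] Delta_modular[OF g z] Delta_modular[OF s w] e1 by simp
    hence "reg_eta k (mact g z) ^ 24 * (of_int (md U) ^ 12 * Delta z) = Delta w"
      using mj_nonzero[of \<sigma> w] s w by (simp add: e2[symmetric] power_mult_distrib)
    hence "norm (reg_eta k (mact g z) ^ 24 * (of_int (md U) ^ 12 * Delta z)) = norm (Delta w)" by (rule arg_cong)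
    hence "norm (reg_eta k (mact g z)) ^ 24 * (real_of_int (md U) ^ 12 * norm (Delta z)) = norm (Delta w)"
      using U by (simp add: norm_mult norm_power)
    moreover have "norm (reg_eta k (mact g z)) ^ 24 * (1 * norm (Delta z)) \<le> norm (reg_eta k (mact g z)) ^ 24 * (real_of_int (md U) ^ 12 * norm (Delta z))"
      using U by (intro mult_left_mono mult_right_mono) (auto intro!: one_le_power)
    ultimately have le: "norm (reg_eta k (mact g z)) ^ 24 * norm (Delta z) \<le> norm (Delta w)" by simp
    have imw: "Im w = of_int (ma U) * Im z / of_int (md U)"
      using U by (simp add: w_def mact_def Im_divide power2_eq_square)
    have "Im z / real k \<le> Im w"
    proof -
      have "1 * md U \<le> ma U * md U" by (rule mult_right_mono) (use U in auto)
      hence "md U \<le> int k" by (simp add: AD)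
      hence dk: "real_of_int (md U) \<le> real k" by linarith
      have "Im z / real k \<le> Im z / of_int (md U)" using dk U imz1 by (intro divide_left_mono) auto
      also have "\<dots> \<le> of_int (ma U) * Im z / of_int (md U)"
        using U imz1 by (intro divide_right_mono) (auto simp: mult_le_cancel_right1)
      finally show ?thesis by (simp add: imw)
    qed
    moreover have "1 \<le> Im z / real k" using imz k by simp
    ultimately have iw1: "Im w \<ge> 1" by linarith
    have "norm (reg_eta k (mact g z)) ^ 24 * (exp (- M) * exp (- 2 * pi * Im z)) \<le> norm (reg_eta k (mact g z)) ^ 24 * norm (Delta z)"
      by (intro mult_left_mono lo imz1) auto
    also note le
    also note up[OF iw1]
    also have "exp M * exp (- 2 * pi * Im w) \<le> exp M * exp (- 2 * pi * (Im z / real k))"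
      using mult_left_mono[OF \<open>Im z / real k \<le> Im w\<close>, of "2 * pi"] by simp
    finally have "norm (reg_eta k (mact g z)) ^ 24 \<le> (exp M * exp (- 2 * pi * (Im z / real k))) / (exp (- M) * exp (- 2 * pi * Im z))"
      by (simp add: field_simps)
    also have "\<dots> = exp (M + - 2 * pi * (Im z / real k) - (- M + - 2 * pi * Im z))"
      by (simp only: exp_add[symmetric] exp_diff[symmetric])
    also have "M + - 2 * pi * (Im z / real k) - (- M + - 2 * pi * Im z) =
        24 * (2 * M / 24 + 2 * pi * Im z * ((real k - 1) / (24 * real k)))"
      using k by (simp add: field_simps)
    also have "exp \<dots> = exp (2 * M / 24 + 2 * pi * Im z * ((real k - 1) / (24 * real k))) ^ 24"
      by (metis exp_of_nat_mult of_nat_numeral)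
    also have "\<dots> = (exp (2 * M / 24) * exp (2 * pi * Im z * ((real k - 1) / (24 * real k)))) ^ 24"
      by (simp only: exp_add)
    finally show "norm (reg_eta k (mact g z)) \<le> exp (2 * M / 24) * exp (2 * pi * Im z * ((real k - 1) / (24 * real k)))"
      by (rule power_le_imp_le_base[of _ 23, unfolded Suc_numeral semiring_norm]) (simp_all)
  qed
qed


section \<open>Generators of the congruence subgroups of level three and five\<close>

definition Vm :: "int \<Rightarrow> int \<Rightarrow> mat2" where "Vm k n = Mat2 1 0 (k * n) 1"
definition Nm :: mat2 where "Nm = Mat2 (-1) 0 0 (-1)"
text \<open>
  This and the next matrix are elliptic of order 4 and fix the points \<open>(2 + \<i>) / 5\<close> and \<open>(3 + \<i>) / 5\<close>.
\<close>

definition E1m :: mat2 where "E1m = Mat2 2 (-1) 5 (-2)"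
definition E2m :: mat2 where "E2m = Mat2 3 (-2) 5 (-3)"

text \<open>
  Euclid's algorithm on the bottom row with the steps available in \<open>\<Gamma>\<^sub>0(k)\<close>. Translations bring \<open>d\<close> into
  \<open>\<bar>d\<bar> \<le> \<bar>c\<bar> / 2\<close>, and adding \<open>\<plusminus> k d\<close> to \<open>c\<close> decreases \<open>\<bar>c\<bar>\<close> as soon as \<open>k \<bar>d\<bar> < 2 \<bar>c\<bar>\<close>. For \<open>k = 3\<close> this
  always holds; for \<open>k = 5\<close> the remaining range \<open>2 / 5 \<le> \<bar>d / c\<bar> \<le> 1 / 2\<close> needs the two elliptic elements.
\<close>

lemma Gamma0_induct [consumes 3, case_names one T T' V V' N E1 E2]:
  assumes k: "k \<in> {3, 5}" and det: "mdet g = 1" and c: "k dvd mc g"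
    and P1: "P 1"
    and PT: "\<And>g. mdet g = 1 \<Longrightarrow> k dvd mc g \<Longrightarrow> P g \<Longrightarrow> P (g * Tm 1)"
    and PT': "\<And>g. mdet g = 1 \<Longrightarrow> k dvd mc g \<Longrightarrow> P g \<Longrightarrow> P (g * Tm (-1))"
    and PV: "\<And>g. mdet g = 1 \<Longrightarrow> k dvd mc g \<Longrightarrow> P g \<Longrightarrow> P (g * Vm k 1)"
    and PV': "\<And>g. mdet g = 1 \<Longrightarrow> k dvd mc g \<Longrightarrow> P g \<Longrightarrow> P (g * Vm k (-1))"
    and PN: "\<And>g. mdet g = 1 \<Longrightarrow> k dvd mc g \<Longrightarrow> P g \<Longrightarrow> P (g * Nm)"
    and PE1: "\<And>g. k = 5 \<Longrightarrow> mdet g = 1 \<Longrightarrow> k dvd mc g \<Longrightarrow> P g \<Longrightarrow> P (g * E1m)"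
    and PE2: "\<And>g. k = 5 \<Longrightarrow> mdet g = 1 \<Longrightarrow> k dvd mc g \<Longrightarrow> P g \<Longrightarrow> P (g * E2m)"
  shows "P g"
proof -
  have PTn: "P (g * Tm n)" if "mdet g = 1" "k dvd mc g" "P g" for g n
  proof (induction n rule: int_induct[where k = 0])
    case base
    have "Tm 0 = 1" by (simp add: Tm_def one_mat2_def)
    thus ?case using that by simp
  next
    case (step1 i)
    have "P (g * Tm i * Tm 1)" using that step1 by (intro PT) (auto simp: Tm_def)
    moreover have "g * Tm i * Tm 1 = g * Tm (i + 1)" by (simp add: mat2_eq_iff Tm_def algebra_simps)
    ultimately show ?case by simp
  next
    case (step2 i)
    have "P (g * Tm i * Tm (-1))" using that step2 by (intro PT') (auto simp: Tm_def)
    moreover have "g * Tm i * Tm (-1) = g * Tm (i - 1)" by (simp add: mat2_eq_iff Tm_def algebra_simps)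
    ultimately show ?case by simp
  qed
  show ?thesis using det c
  proof (induction "nat \<bar>mc g\<bar>" arbitrary: g rule: less_induct)
    case (less g)
    note det = less.prems(1) and c = less.prems(2)
    show ?case
    proof (cases "mc g = 0")
      case True
      with det have "ma g * md g = 1" by (simp add: mdet_def)
      hence "ma g = 1 \<and> md g = 1 \<or> ma g = -1 \<and> md g = -1" by (simp add: zmult_eq_1_iff)
      moreover have "P (1 * Tm (mb g))" using PTn[of 1] P1 by simp
      moreover have "P ((1 * Nm) * Tm (- mb g))"
        using PTn[of "1 * Nm"] PN[of 1] P1 by (simp add: Nm_def)
      moreover have "g = 1 * Tm (mb g)" if "ma g = 1" "md g = 1"
        using that True by (simp add: mat2_eq_iff Tm_def)
      moreover have "g = (1 * Nm) * Tm (- mb g)" if "ma g = -1" "md g = -1"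
        using that True by (simp add: mat2_eq_iff Tm_def Nm_def)
      ultimately show ?thesis by metis
    next
      case False
      define x where "x = mc g"
      have x: "x \<noteq> 0" "k dvd x" using False c by (auto simp: x_def)
      define n where "n = - round (of_int (md g) / of_int x :: real)"
      define g1 where "g1 = g * Tm n"
      define y where "y = md g1"
      have g1: "mdet g1 = 1" "mc g1 = x" "k dvd mc g1" using det x by (auto simp: g1_def Tm_def x_def)
      have y: "2 * \<bar>y\<bar> \<le> \<bar>x\<bar>"
      proof -
        have "\<bar>of_int (round (of_int (md g) / of_int x :: real)) - of_int (md g) / of_int x\<bar> \<le> (1/2 :: real)"
          by (rule of_int_round_abs_le)
        hence "\<bar>of_int x\<bar> * \<bar>of_int (round (of_int (md g) / of_int x :: real)) - of_int (md g) / of_int x\<bar> \<le> \<bar>of_int x\<bar> * (1/2 :: real)"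
          by (rule mult_left_mono) simp
        also have "\<bar>of_int x\<bar> * \<bar>of_int (round (of_int (md g) / of_int x :: real)) - of_int (md g) / of_int x\<bar> = \<bar>of_int y :: real\<bar>"
          unfolding abs_mult[symmetric] using x
          by (subst abs_minus_cancel[symmetric]) (simp add: y_def g1_def n_def Tm_def x_def algebra_simps)
        finally have "of_int (2 * \<bar>y\<bar>) \<le> (of_int \<bar>x\<bar> :: real)" by simp
        thus ?thesis by (simp only: of_int_le_iff)
      qed
      have y0: "y \<noteq> 0"
      proof
        assume "y = 0"
        hence "- (mb g1 * x) = 1" using g1 by (simp add: mdet_def y_def)
        hence "x dvd 1" by (metis dvd_minus_iff dvd_triv_right)
        with x have "k dvd 1" using dvd_trans by blast
        thus False using k by auto
      qed
      have gg1: "g = g1 * Tm (- n)" by (simp add: g1_def mat2_eq_iff Tm_def)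
      have "P g1"
      proof -
        consider "k * \<bar>y\<bar> < 2 * \<bar>x\<bar>" "x * y < 0" | "k * \<bar>y\<bar> < 2 * \<bar>x\<bar>" "x * y > 0"
          | "k * \<bar>y\<bar> \<ge> 2 * \<bar>x\<bar>" "x * y < 0" | "k * \<bar>y\<bar> \<ge> 2 * \<bar>x\<bar>" "x * y > 0"
          using x y0 by (metis linorder_neqE_linordered_idom mult_eq_0_iff not_less)
        thus ?thesis
        proof cases
          case 1
          define g' where "g' = g1 * Vm k 1"
          have g': "mdet g' = 1" "k dvd mc g'" and c': "mc g' = x + k * y" using g1 by (auto simp: g'_def Vm_def y_def)
          have "\<bar>x + k * y\<bar> < \<bar>x\<bar>" using 1 k x y0 by (auto simp: mult_less_0_iff zero_less_mult_iff abs_if split: if_splits)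
          hence "P g'" using c' g' by (intro less.hyps) (auto simp: x_def)
          hence "P (g' * Vm k (-1))" using g' by (intro PV') auto
          also have "g' * Vm k (-1) = g1" by (simp add: g'_def Vm_def mat2_eq_iff algebra_simps)
          finally show ?thesis .
        next
          case 2
          define g' where "g' = g1 * Vm k (-1)"
          have g': "mdet g' = 1" "k dvd mc g'" and c': "mc g' = x - k * y" using g1 by (auto simp: g'_def Vm_def y_def)
          have "\<bar>x - k * y\<bar> < \<bar>x\<bar>" using 2 k x y0 by (auto simp: mult_less_0_iff zero_less_mult_iff abs_if split: if_splits)
          hence "P g'" using c' g' by (intro less.hyps) (auto simp: x_def)
          hence "P (g' * Vm k 1)" using g' by (intro PV) auto
          also have "g' * Vm k 1 = g1" by (simp add: g'_def Vm_def mat2_eq_iff algebra_simps)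
          finally show ?thesis .
        next
          case 3
          have k5: "k = 5" using 3 y k x by auto
          define g' where "g' = g1 * E1m"
          have c': "mc g' = 2 * x + 5 * y" using g1 by (simp add: g'_def E1m_def y_def)
          have g': "mdet g' = 1" "k dvd mc g'" using g1 k5 unfolding c' by (auto simp: g'_def E1m_def)
          have "\<bar>2 * x + 5 * y\<bar> < \<bar>x\<bar>" using 3 k5 x y by (auto simp: mult_less_0_iff abs_if split: if_splits)
          hence "P g'" using c' g' by (intro less.hyps) (auto simp: x_def)
          hence "P (g' * E1m * Nm)" using g' k5 by (intro PN PE1) (auto simp: E1m_def)
          also have "g' * E1m * Nm = g1" by (simp add: g'_def E1m_def Nm_def mat2_eq_iff)
          finally show ?thesis .
        next
          case 4
          have k5: "k = 5" using 4 y k x by auto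
          define g' where "g' = g1 * Tm (-1) * E2m"
          have c': "mc g' = - 2 * x + 5 * y" using g1 by (simp add: g'_def E2m_def Tm_def y_def)
          have g': "mdet g' = 1" "k dvd mc g'" using g1 k5 unfolding c' by (auto simp: g'_def E2m_def)
          have "\<bar>- 2 * x + 5 * y\<bar> < \<bar>x\<bar>" using 4 k5 x y by (auto simp: zero_less_mult_iff abs_if split: if_splits)
          hence "P g'" using c' g' by (intro less.hyps) (auto simp: x_def)
          hence "P (g' * E2m * Nm * Tm 1)" using g' k5 by (intro PT PN PE2) (auto simp: E2m_def Nm_def)
          also have "g' * E2m * Nm * Tm 1 = g1" by (simp add: g'_def E2m_def Nm_def Tm_def mat2_eq_iff)
          finally show ?thesis .
        qed
      qed
      thus ?thesis unfolding gg1 using g1 by (intro PTn) auto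
    qed
  qed
qed

section \<open>The character of the eta quotient\<close>

text \<open>
  These polynomials describe the characters of \<open>SL\<^sub>2(\<int>)\<close> of order 4, 3 and 2, which
  belong to the powers \<open>\<eta> ^ 6\<close>, \<open>\<eta> ^ 8\<close> and \<open>\<eta> ^ 12\<close>. Each takes the value \<open>1\<close> on the translation \<open>T\<close>.
\<close>

definition psi4 :: "int \<Rightarrow> int \<Rightarrow> int \<Rightarrow> int \<Rightarrow> int" where
  "psi4 a b c d = (1 - c * c) * (b * d + 3 * (c - 1) * d + c + 3) + c * (a + d - 3)"
definition psi3 :: "int \<Rightarrow> int \<Rightarrow> int \<Rightarrow> int \<Rightarrow> int" where
  "psi3 a b c d = (a + d) * c - b * d * (c * c - 1)"
definition psi2 :: "int \<Rightarrow> int \<Rightarrow> int \<Rightarrow> int \<Rightarrow> int" where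
  "psi2 a b c d = (1 + c) * b + c * (a + d + 1)"

lemma psi4_cong:
  "[a = a'] (mod 4) \<Longrightarrow> [b = b'] (mod 4) \<Longrightarrow> [c = c'] (mod 4) \<Longrightarrow> [d = d'] (mod 4) \<Longrightarrow> [psi4 a b c d = psi4 a' b' c' d'] (mod 4)"
  unfolding psi4_def by (intro cong_add cong_mult cong_diff) simp_all
lemma psi3_cong:
  "[a = a'] (mod 3) \<Longrightarrow> [b = b'] (mod 3) \<Longrightarrow> [c = c'] (mod 3) \<Longrightarrow> [d = d'] (mod 3) \<Longrightarrow> [psi3 a b c d = psi3 a' b' c' d'] (mod 3)"
  unfolding psi3_def by (intro cong_add cong_mult cong_diff) simp_all
lemma psi2_cong:
  "[a = a'] (mod 2) \<Longrightarrow> [b = b'] (mod 2) \<Longrightarrow> [c = c'] (mod 2) \<Longrightarrow> [d = d'] (mod 2) \<Longrightarrow> [psi2 a b c d = psi2 a' b' c' d'] (mod 2)"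
  unfolding psi2_def by (intro cong_add cong_mult cong_diff) simp_all

text \<open>
  A bounded quantifier over all residues, so that the identity of two polynomials on
  \<open>SL\<^sub>2(\<int> / m)\<close> is decided by computation.
\<close>

definition agree_on_SL2_mod :: "int \<Rightarrow> (int \<Rightarrow> int \<Rightarrow> int \<Rightarrow> int \<Rightarrow> int) \<Rightarrow> (int \<Rightarrow> int \<Rightarrow> int \<Rightarrow> int \<Rightarrow> int) \<Rightarrow> bool" where
  "agree_on_SL2_mod m f h \<longleftrightarrow> (\<forall>a\<in>set [0..m-1]. \<forall>b\<in>set [0..m-1]. \<forall>c\<in>set [0..m-1]. \<forall>d\<in>set [0..m-1]. (a * d - b * c) mod m = 1 \<longrightarrow> f a b c d mod m = h a b c d mod m)"

lemma agree_on_SL2_mod_apply: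
  assumes "agree_on_SL2_mod m f h" "m > 1"
    and "[f a b c d = f (a mod m) (b mod m) (c mod m) (d mod m)] (mod m)"
    and "[h a b c d = h (a mod m) (b mod m) (c mod m) (d mod m)] (mod m)"
    and "[a * d - b * c = 1] (mod m)"
  shows "(f a b c d - h a b c d) mod m = 0"
proof -
  have "x mod m \<in> set [0..m-1]" for x using assms(2) by simp
  moreover have "((a mod m) * (d mod m) - (b mod m) * (c mod m)) mod m = 1"
  proof -
    have "[(a mod m) * (d mod m) - (b mod m) * (c mod m) = a * d - b * c] (mod m)"
      by (intro cong_diff cong_mult) (simp_all add: Cong.cong_def)
    with assms(5) have "[(a mod m) * (d mod m) - (b mod m) * (c mod m) = 1] (mod m)"
      using cong_trans by blast
    thus ?thesis using assms(2) by (simp add: Cong.cong_def)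
  qed
  ultimately have "[f (a mod m) (b mod m) (c mod m) (d mod m) = h (a mod m) (b mod m) (c mod m) (d mod m)] (mod m)"
    using assms(1) unfolding agree_on_SL2_mod_def Cong.cong_def by blast
  hence "[f a b c d = h a b c d] (mod m)" using assms(3,4) by (meson cong_sym cong_trans)
  thus ?thesis by (simp add: cong_iff_dvd_diff)
qed

definition sgn3 :: "int \<Rightarrow> complex" where "sgn3 d = (if d mod 3 = 1 then 1 else - 1)"
definition sgn5 :: "int \<Rightarrow> complex" where "sgn5 d = (if d mod 5 = 1 \<or> d mod 5 = 4 then 1 else - 1)"

text \<open>
  Restricted to \<open>\<Gamma>\<^sub>0(k)\<close> this is the multiplier of \<open>\<eta>(k z) / \<eta>(z)\<close>. The factor with \<open>c / 3\<close> and the quadratic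
  characters of \<open>d\<close> live on \<open>\<Gamma>\<^sub>0(k)\<close> only, the others on all of \<open>SL\<^sub>2(\<int>)\<close>. The formula is used
  through its changes under right multiplication by each generator.
\<close>

definition chi :: "nat \<Rightarrow> mat2 \<Rightarrow> complex" where
  "chi k g = (if k = 3
     then ex (of_int (ma g * mb g + mc g div 3 * md g) / of_int 3) * ex (of_int (- psi4 (ma g) (mb g) (mc g) (md g)) / of_int 4) * sgn3 (md g)
     else ex (of_int (psi2 (ma g) (mb g) (mc g) (md g)) / of_int 2) * ex (of_int (- psi3 (ma g) (mb g) (mc g) (md g)) / of_int 3) * sgn5 (md g))"

lemma psi4_T: "agree_on_SL2_mod 4 (\<lambda>a b c d. psi4 a (a + b) c (c + d)) (\<lambda>a b c d. psi4 a b c d + 1)"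
  and psi4_V: "agree_on_SL2_mod 4 (\<lambda>a b c d. psi4 (a + 3 * b) b (c + 3 * d) d) (\<lambda>a b c d. psi4 a b c d + 1)"
  and psi4_N: "agree_on_SL2_mod 4 (\<lambda>a b c d. psi4 (-a) (-b) (-c) (-d)) (\<lambda>a b c d. psi4 a b c d + 2)"
  and psi3_T: "agree_on_SL2_mod 3 (\<lambda>a b c d. psi3 a (a + b) c (c + d)) (\<lambda>a b c d. psi3 a b c d + 1)"
  and psi3_V: "agree_on_SL2_mod 3 (\<lambda>a b c d. psi3 (a + 5 * b) b (c + 5 * d) d) (\<lambda>a b c d. psi3 a b c d + 1)"
  and psi3_N: "agree_on_SL2_mod 3 (\<lambda>a b c d. psi3 (-a) (-b) (-c) (-d)) (\<lambda>a b c d. psi3 a b c d)"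
  and psi3_E1: "agree_on_SL2_mod 3 (\<lambda>a b c d. psi3 (2 * a + 5 * b) (- a - 2 * b) (2 * c + 5 * d) (- c - 2 * d)) (\<lambda>a b c d. psi3 a b c d)"
  and psi3_E2: "agree_on_SL2_mod 3 (\<lambda>a b c d. psi3 (3 * a + 5 * b) (- 2 * a - 3 * b) (3 * c + 5 * d) (- 2 * c - 3 * d)) (\<lambda>a b c d. psi3 a b c d)"
  and psi2_T: "agree_on_SL2_mod 2 (\<lambda>a b c d. psi2 a (a + b) c (c + d)) (\<lambda>a b c d. psi2 a b c d + 1)"
  and psi2_V: "agree_on_SL2_mod 2 (\<lambda>a b c d. psi2 (a + 5 * b) b (c + 5 * d) d) (\<lambda>a b c d. psi2 a b c d + 1)"
  and psi2_N: "agree_on_SL2_mod 2 (\<lambda>a b c d. psi2 (-a) (-b) (-c) (-d)) (\<lambda>a b c d. psi2 a b c d)"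
  and psi2_E1: "agree_on_SL2_mod 2 (\<lambda>a b c d. psi2 (2 * a + 5 * b) (- a - 2 * b) (2 * c + 5 * d) (- c - 2 * d)) (\<lambda>a b c d. psi2 a b c d + 1)"
  and psi2_E2: "agree_on_SL2_mod 2 (\<lambda>a b c d. psi2 (3 * a + 5 * b) (- 2 * a - 3 * b) (3 * c + 5 * d) (- 2 * c - 3 * d)) (\<lambda>a b c d. psi2 a b c d + 1)"
  unfolding agree_on_SL2_mod_def psi4_def psi3_def psi2_def by code_simp+


lemma chi_one [simp]: "chi k 1 = 1"
  by (simp add: chi_def psi4_def psi2_def psi3_def sgn3_def sgn5_def)

lemma ex_shift:
  assumes "(a - (b + n)) mod M = 0" "M \<noteq> (0::int)"
  shows "ex (of_int a / of_int M) = ex (of_int b / of_int M) * ex (of_int n / of_int M)"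
  using ex_cong[OF assms] by (simp add: add_divide_distrib ex_add)

lemma ex_half: "ex (1/2) = - 1"
proof -
  have "ex (1/2) = exp (\<i> * of_real pi)" by (simp add: ex_def mult_ac)
  thus ?thesis by (simp add: exp_pi_i')
qed

lemma chi_3_steps:
  assumes g: "mdet g = 1" "3 dvd mc g"
  shows "chi 3 (g * Tm 1) = ex (1 / 12) * chi 3 g"
    and "chi 3 (g * Vm 3 1) = ex (1 / 12) * chi 3 g"
    and "chi 3 (g * Nm) = chi 3 g"
proof -
  obtain c' where c': "mc g = 3 * c'" using g by (elim dvdE)
  define a b d where abd: "a = ma g" "b = mb g" "d = md g"
  have det: "a * d - 3 * (b * c') = 1" using g by (simp add: mdet_def c' abd)
  hence det4: "[a * d - b * (3 * c') = 1] (mod 4)" by (simp add: mult_ac)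
  have "[a * d = 1] (mod 3)" using det by (simp add: cong_iff_dvd_diff) (metis add_diff_cancel_left' diff_add_cancel dvd_triv_left)
  hence ad: "a mod 3 = 1 \<and> d mod 3 = 1 \<or> a mod 3 = 2 \<and> d mod 3 = 2"
  proof -
    assume "[a * d = 1] (mod 3)"
    hence "((a mod 3) * (d mod 3)) mod 3 = 1" by (simp add: Cong.cong_def mod_mult_eq)
    moreover have "a mod 3 \<in> {0,1,2}" "d mod 3 \<in> {0,1,2}" by auto
    ultimately show ?thesis by auto
  qed
  hence a2: "(a * a) mod 3 = 1" and d2: "(d * d) mod 3 = 1"
    using mod_mult_eq[of a 3 a] mod_mult_eq[of d 3 d] by auto
  have e: "ex (1 / 3) * ex (- 1 / 4) = ex (1 / 12)" by (simp flip: ex_add)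
  have T3: "ex (of_int (a * (a + b) + c' * (3 * c' + d)) / of_int 3) = ex (of_int (a * b + c' * d) / of_int 3) * ex (of_int 1 / of_int 3)"
  proof (rule ex_shift)
    have eq: "a * (a + b) + c' * (3 * c' + d) - (a * b + c' * d + 1) = (a * a - 1) + 3 * (c' * c')" by (simp add: algebra_simps)
    have "3 dvd a * a - 1" using a2 by (simp add: mod_eq_dvd_iff[symmetric])
    hence "3 dvd a * (a + b) + c' * (3 * c' + d) - (a * b + c' * d + 1)" unfolding eq by (rule dvd_add) simp
    thus "(a * (a + b) + c' * (3 * c' + d) - (a * b + c' * d + 1)) mod 3 = 0" by (simp only: dvd_eq_mod_eq_0)
  qed simp
  have V3: "ex (of_int ((a + 3 * b) * b + (c' + d) * d) / of_int 3) = ex (of_int (a * b + c' * d) / of_int 3) * ex (of_int 1 / of_int 3)"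
  proof (rule ex_shift)
    have eq: "(a + 3 * b) * b + (c' + d) * d - (a * b + c' * d + 1) = (d * d - 1) + 3 * (b * b)" by (simp add: algebra_simps)
    have "3 dvd d * d - 1" using d2 by (simp add: mod_eq_dvd_iff[symmetric])
    hence "3 dvd (a + 3 * b) * b + (c' + d) * d - (a * b + c' * d + 1)" unfolding eq by (rule dvd_add) simp
    thus "((a + 3 * b) * b + (c' + d) * d - (a * b + c' * d + 1)) mod 3 = 0" by (simp only: dvd_eq_mod_eq_0)
  qed simp
  have T4: "ex (of_int (- psi4 a (a + b) (3 * c') (3 * c' + d)) / of_int 4) = ex (of_int (- psi4 a b (3 * c') d) / of_int 4) * ex (of_int (- 1) / of_int 4)"
  proof (rule ex_shift)
    have "(psi4 a (a + b) (3 * c') (3 * c' + d) - (psi4 a b (3 * c') d + 1)) mod 4 = 0"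
      by (rule agree_on_SL2_mod_apply[OF psi4_T]) (use det4 in \<open>auto intro!: psi4_cong cong_add simp: Cong.cong_def[of _ "_ mod _"]\<close>)
    thus "(- psi4 a (a + b) (3 * c') (3 * c' + d) - (- psi4 a b (3 * c') d + - 1)) mod 4 = 0" by (simp add: mod_eq_0_iff_dvd) (metis dvd_minus_iff minus_diff_eq diff_minus_eq_add uminus_add_conv_diff add.commute)
  qed simp
  have V4: "ex (of_int (- psi4 (a + 3 * b) b (3 * c' + 3 * d) d) / of_int 4) = ex (of_int (- psi4 a b (3 * c') d) / of_int 4) * ex (of_int (- 1) / of_int 4)"
  proof (rule ex_shift)
    have "(psi4 (a + 3 * b) b (3 * c' + 3 * d) d - (psi4 a b (3 * c') d + 1)) mod 4 = 0"
      by (rule agree_on_SL2_mod_apply[OF psi4_V]) (use det4 in \<open>auto intro!: psi4_cong cong_add cong_mult simp: Cong.cong_def[of _ "_ mod _"]\<close>)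
    thus "(- psi4 (a + 3 * b) b (3 * c' + 3 * d) d - (- psi4 a b (3 * c') d + - 1)) mod 4 = 0" by (simp add: mod_eq_0_iff_dvd) (metis dvd_minus_iff minus_diff_eq diff_minus_eq_add uminus_add_conv_diff add.commute)
  qed simp
  have N4: "ex (of_int (- psi4 (- a) (- b) (- (3 * c')) (- d)) / of_int 4) = ex (of_int (- psi4 a b (3 * c') d) / of_int 4) * ex (of_int (- 2) / of_int 4)"
  proof (rule ex_shift)
    have "(psi4 (- a) (- b) (- (3 * c')) (- d) - (psi4 a b (3 * c') d + 2)) mod 4 = 0"
      by (rule agree_on_SL2_mod_apply[OF psi4_N]) (use det4 in \<open>auto intro!: psi4_cong cong_add simp: Cong.cong_def[of _ "_ mod _"] cong_minus_minus_iff\<close>)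
    thus "(- psi4 (- a) (- b) (- (3 * c')) (- d) - (- psi4 a b (3 * c') d + - 2)) mod 4 = 0" by (simp add: mod_eq_0_iff_dvd) (metis dvd_minus_iff minus_diff_eq diff_minus_eq_add uminus_add_conv_diff add.commute)
  qed simp
  show "chi 3 (g * Tm 1) = ex (1 / 12) * chi 3 g"
    using T3 T4 by (simp add: chi_def Tm_def c' abd[symmetric] sgn3_def e[symmetric] mod_simps)
  show "chi 3 (g * Vm 3 1) = ex (1 / 12) * chi 3 g"
    using V3 V4 by (simp add: chi_def Vm_def c' abd[symmetric] sgn3_def e[symmetric] ring_distribs mult_ac)
  have dv: "- (3 * c') div 3 = - c'" by simp
  show "chi 3 (g * Nm) = chi 3 g"
    using N4 ad by (auto simp: chi_def Nm_def c' abd[symmetric] sgn3_def ex_minus ex_half zmod_zminus1_eq_if dv)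
qed


lemma chi_5_steps:
  assumes g: "mdet g = 1" "5 dvd mc g"
  shows "chi 5 (g * Tm 1) = ex (1 / 6) * chi 5 g"
    and "chi 5 (g * Vm 5 1) = ex (1 / 6) * chi 5 g"
    and "chi 5 (g * Nm) = chi 5 g"
    and "chi 5 (g * E1m) = chi 5 g"
    and "chi 5 (g * E2m) = chi 5 g"
proof -
  define a b c d where abd: "a = ma g" "b = mb g" "c = mc g" "d = md g"
  have det: "a * d - b * c = 1" using g by (simp add: mdet_def abd)
  hence det': "[a * d - b * c = 1] (mod M)" for M by simp
  have c5: "5 dvd c" using g abd by simp
  have d5: "d mod 5 = 1 \<or> d mod 5 = 2 \<or> d mod 5 = 3 \<or> d mod 5 = 4"
  proof -
    have "d mod 5 \<noteq> 0"
    proof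
      assume "d mod 5 = 0"
      hence "5 dvd d" by auto
      with c5 have "5 dvd a * d - b * c" by auto
      thus False using det by simp
    qed
    moreover have "d mod 5 \<in> {0,1,2,3,4}" by auto
    ultimately show ?thesis by auto
  qed
  have e: "ex (1 / 2) * ex (- 1 / 3) = ex (1 / 6)" by (simp flip: ex_add)
  have red: "ex (of_int (psi2 a' b' c' d') / of_int 2) * ex (of_int (- psi3 a' b' c' d') / of_int 3) =
        ex (of_int (psi2 a b c d) / of_int 2) * ex (of_int (- psi3 a b c d) / of_int 3) * (ex (of_int s / of_int 2) * ex (of_int (- t) / of_int 3))"
    if 2: "(psi2 a' b' c' d' - (psi2 a b c d + s)) mod 2 = 0" and 3: "(psi3 a' b' c' d' - (psi3 a b c d + t)) mod 3 = 0" for a' b' c' d' s t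
  proof -
    have "(- psi3 a' b' c' d' - (- psi3 a b c d + - t)) = - (psi3 a' b' c' d' - (psi3 a b c d + t))" by simp
    hence neg: "(- psi3 a' b' c' d' - (- psi3 a b c d + - t)) mod 3 = 0"
      using 3 by (simp only: mod_eq_0_iff_dvd dvd_minus_iff)
    show ?thesis by (simp only: ex_shift[OF 2] ex_shift[OF neg] mult_ac)
  qed
  have T2: "(psi2 a (a + b) c (c + d) - (psi2 a b c d + 1)) mod 2 = 0"
    by (rule agree_on_SL2_mod_apply[OF psi2_T])
      (use det' in \<open>auto intro!: psi2_cong cong_add cong_diff cong_mult simp: Cong.cong_def[of _ "_ mod _"] cong_minus_minus_iff\<close>)
  have T3: "(psi3 a (a + b) c (c + d) - (psi3 a b c d + 1)) mod 3 = 0"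
    by (rule agree_on_SL2_mod_apply[OF psi3_T])
      (use det' in \<open>auto intro!: psi3_cong cong_add cong_diff cong_mult simp: Cong.cong_def[of _ "_ mod _"] cong_minus_minus_iff\<close>)
  note T = T2 T3
  have V2: "(psi2 (a + 5 * b) b (c + 5 * d) d - (psi2 a b c d + 1)) mod 2 = 0"
    by (rule agree_on_SL2_mod_apply[OF psi2_V])
      (use det' in \<open>auto intro!: psi2_cong cong_add cong_diff cong_mult simp: Cong.cong_def[of _ "_ mod _"] cong_minus_minus_iff\<close>)
  have V3: "(psi3 (a + 5 * b) b (c + 5 * d) d - (psi3 a b c d + 1)) mod 3 = 0"
    by (rule agree_on_SL2_mod_apply[OF psi3_V])
      (use det' in \<open>auto intro!: psi3_cong cong_add cong_diff cong_mult simp: Cong.cong_def[of _ "_ mod _"] cong_minus_minus_iff\<close>)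
  note V = V2 V3
  have N2: "(psi2 (- a) (- b) (- c) (- d) - (psi2 a b c d)) mod 2 = 0"
    by (rule agree_on_SL2_mod_apply[OF psi2_N])
      (use det' in \<open>auto intro!: psi2_cong cong_add cong_diff cong_mult simp: Cong.cong_def[of _ "_ mod _"] cong_minus_minus_iff\<close>)
  have N3: "(psi3 (- a) (- b) (- c) (- d) - (psi3 a b c d)) mod 3 = 0"
    by (rule agree_on_SL2_mod_apply[OF psi3_N])
      (use det' in \<open>auto intro!: psi3_cong cong_add cong_diff cong_mult simp: Cong.cong_def[of _ "_ mod _"] cong_minus_minus_iff\<close>)
  note N = N2 N3
  have E12: "(psi2 (2 * a + 5 * b) (- a - 2 * b) (2 * c + 5 * d) (- c - 2 * d) - (psi2 a b c d + 1)) mod 2 = 0"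
    by (rule agree_on_SL2_mod_apply[OF psi2_E1])
      (use det' in \<open>auto intro!: psi2_cong cong_add cong_diff cong_mult simp: Cong.cong_def[of _ "_ mod _"] cong_minus_minus_iff\<close>)
  have E13: "(psi3 (2 * a + 5 * b) (- a - 2 * b) (2 * c + 5 * d) (- c - 2 * d) - psi3 a b c d) mod 3 = 0"
    by (rule agree_on_SL2_mod_apply[OF psi3_E1])
      (use det' in \<open>auto intro!: psi3_cong cong_add cong_diff cong_mult simp: Cong.cong_def[of _ "_ mod _"] cong_minus_minus_iff\<close>)
  note E1 = E12 E13
  have E22: "(psi2 (3 * a + 5 * b) (- 2 * a - 3 * b) (3 * c + 5 * d) (- 2 * c - 3 * d) - (psi2 a b c d + 1)) mod 2 = 0"
    by (rule agree_on_SL2_mod_apply[OF psi2_E2])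
      (use det' in \<open>auto intro!: psi2_cong cong_add cong_diff cong_mult simp: Cong.cong_def[of _ "_ mod _"] cong_minus_minus_iff\<close>)
  have E23: "(psi3 (3 * a + 5 * b) (- 2 * a - 3 * b) (3 * c + 5 * d) (- 2 * c - 3 * d) - psi3 a b c d) mod 3 = 0"
    by (rule agree_on_SL2_mod_apply[OF psi3_E2])
      (use det' in \<open>auto intro!: psi3_cong cong_add cong_diff cong_mult simp: Cong.cong_def[of _ "_ mod _"] cong_minus_minus_iff\<close>)
  note E2 = E22 E23
  obtain c' where c': "c = 5 * c'" using c5 by (elim dvdE)
  have sT: "sgn5 (c + d) = sgn5 d" by (simp add: sgn5_def c')
  have sN: "sgn5 (- d) = sgn5 d" using d5 by (auto simp: sgn5_def zmod_zminus1_eq_if)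
  have sE1: "sgn5 (- c - 2 * d) = - sgn5 d"
  proof -
    have "(- c - 2 * d) mod 5 = (3 * (d mod 5)) mod 5"
      by (simp add: mod_mult_right_eq) (simp add: c' mod_eq_dvd_iff algebra_simps)
    thus ?thesis using d5 by (auto simp: sgn5_def)
  qed
  have sE2: "sgn5 (- 2 * c - 3 * d) = - sgn5 d"
  proof -
    have "(- 2 * c - 3 * d) mod 5 = (2 * (d mod 5)) mod 5"
      by (simp add: mod_mult_right_eq) (simp add: c' mod_eq_dvd_iff algebra_simps)
    thus ?thesis using d5 by (auto simp: sgn5_def)
  qed
  have chi: "chi 5 h = ex (of_int (psi2 (ma h) (mb h) (mc h) (md h)) / of_int 2) * ex (of_int (- psi3 (ma h) (mb h) (mc h) (md h)) / of_int 3) * sgn5 (md h)" for h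
    by (simp add: chi_def)
  have sel: "ma (g * Tm 1) = a" "mb (g * Tm 1) = a + b" "mc (g * Tm 1) = c" "md (g * Tm 1) = c + d"
    "ma (g * Vm 5 1) = a + 5 * b" "mb (g * Vm 5 1) = b" "mc (g * Vm 5 1) = c + 5 * d" "md (g * Vm 5 1) = d"
    "ma (g * Nm) = - a" "mb (g * Nm) = - b" "mc (g * Nm) = - c" "md (g * Nm) = - d"
    "ma (g * E1m) = 2 * a + 5 * b" "mb (g * E1m) = - a - 2 * b" "mc (g * E1m) = 2 * c + 5 * d" "md (g * E1m) = - c - 2 * d"
    "ma (g * E2m) = 3 * a + 5 * b" "mb (g * E2m) = - 2 * a - 3 * b" "mc (g * E2m) = 3 * c + 5 * d" "md (g * E2m) = - 2 * c - 3 * d"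
    "ma g = a" "mb g = b" "mc g = c" "md g = d"
    by (simp_all add: Tm_def Vm_def Nm_def E1m_def E2m_def abd)
  show "chi 5 (g * Tm 1) = ex (1 / 6) * chi 5 g"
    unfolding chi sel red[OF T] sT by (simp add: e[symmetric])
  show "chi 5 (g * Vm 5 1) = ex (1 / 6) * chi 5 g"
    unfolding chi sel red[OF V] by (simp add: e[symmetric])
  show "chi 5 (g * Nm) = chi 5 g"
    unfolding chi sel sN using red[of "- a" "- b" "- c" "- d" 0 0] N by simp
  show "chi 5 (g * E1m) = chi 5 g"
    unfolding chi sel sE1 using red[of _ _ _ _ 1 0, OF E1(1)] E1(2) by (simp add: ex_half)
  show "chi 5 (g * E2m) = chi 5 g"
    unfolding chi sel sE2 using red[of _ _ _ _ 1 0, OF E2(1)] E2(2) by (simp add: ex_half)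
qed

text \<open>
  A matrix with a fixed point in the upper half plane cannot change a nonvanishing function of weight
  \<open>0\<close> by a constant other than \<open>1\<close>.
\<close>

lemma reg_eta_elliptic:
  assumes "mdet E = 1" "5 dvd mc E" "z0 \<in> uhp" "mact E z0 = z0" "z \<in> uhp"
  shows "reg_eta 5 (mact E z) = reg_eta 5 z"
proof -
  obtain c where c: "\<And>z. z \<in> uhp \<Longrightarrow> reg_eta 5 (mact E z) = c * reg_eta 5 z"
    by (rule reg_eta_Gamma0[of 5 E]) (use assms in auto)
  from c[OF assms(3)] have "c = 1" by (simp add: assms(4))
  with c[OF assms(5)] show ?thesis by simp
qed

text \<open>
  Both sides change by the same factor under each generator: \<open>T\<close> by the leading exponent of \<open>f\<close>, the lower triangular matrix by the same
  factor, and the elliptic elements and \<open>- 1\<close> not at all.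
\<close>

lemma reg_eta_chi:
  assumes k: "k \<in> {3, 5}" and g: "mdet g = 1" "int k dvd mc g" and z: "z \<in> uhp"
  shows "reg_eta k (mact g z) = chi k g * reg_eta k z"
proof -
  have k1: "k > 1" using k by auto
  define \<zeta> where "\<zeta> = ex ((real k - 1) / 24)"
  have z1: "\<zeta> = (if k = 3 then ex (1/12) else ex (1/6))" using k by (auto simp: \<zeta>_def)
  have z0: "\<zeta> \<noteq> 0" by (simp add: \<zeta>_def)
  have chiT: "chi k (h * Tm 1) = \<zeta> * chi k h" and chiV: "chi k (h * Vm (int k) 1) = \<zeta> * chi k h" and chiN: "chi k (h * Nm) = chi k h"
    if "mdet h = 1" "int k dvd mc h" for h
    using k chi_3_steps[of h] chi_5_steps[of h] that by (auto simp: z1)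
  have zi: "ex ((1 - real k) / 24) = inverse \<zeta>"
    unfolding \<zeta>_def ex_minus[symmetric] by (rule arg_cong[of _ _ ex]) (simp add: field_simps)
  have step: "\<forall>z\<in>uhp. reg_eta k (mact (h * A) z) = chi k (h * A) * reg_eta k z"
    if "mdet h = 1" "mdet A = 1" "\<forall>z\<in>uhp. reg_eta k (mact h z) = chi k h * reg_eta k z"
      "\<And>z. z \<in> uhp \<Longrightarrow> reg_eta k (mact A z) = c * reg_eta k z" "chi k (h * A) = c * chi k h" for h A c
  proof
    fix z assume z: "z \<in> uhp"
    have "reg_eta k (mact (h * A) z) = reg_eta k (mact h (mact A z))" using mact_mult[of h A z] that z by simp
    also have "\<dots> = chi k h * (c * reg_eta k z)" using that z mact_uhp[of A z] by simp
    finally show "reg_eta k (mact (h * A) z) = chi k (h * A) * reg_eta k z" using that(5) by simp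
  qed
  have k': "int k \<in> {3, 5}" using k by auto
  have "\<forall>z\<in>uhp. reg_eta k (mact g z) = chi k g * reg_eta k z"
    using k' g(1,2)
  proof (induction rule: Gamma0_induct)
    case (T g)
    show ?case
      by (rule step[where c = \<zeta>]) (use T chiT[of g] reg_eta_add_int[of k _ 1] in \<open>auto simp: \<zeta>_def\<close>)
  next
    case (T' g)
    have "g * Tm (-1) * Tm 1 = g" by (simp add: mat2_eq_iff Tm_def)
    hence "chi k g = \<zeta> * chi k (g * Tm (-1))" using chiT[of "g * Tm (-1)"] T' by (simp add: Tm_def)
    thus ?case
      by (intro step[where c = "inverse \<zeta>"]) (use T' reg_eta_add_int[of k _ "-1"] z0 zi in \<open>auto simp: field_simps\<close>)
  next
    case (V g)
    show ?case
      by (rule step[where c = \<zeta>]) (use V chiV[of g] reg_eta_lower[OF k1, of _ 1] in \<open>auto simp: \<zeta>_def Vm_def\<close>)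
  next
    case (V' g)
    have "g * Vm (int k) (-1) * Vm (int k) 1 = g" by (simp add: mat2_eq_iff Vm_def algebra_simps)
    hence "chi k g = \<zeta> * chi k (g * Vm (int k) (-1))" using chiV[of "g * Vm (int k) (-1)"] V' by (simp add: Vm_def)
    thus ?case
      by (intro step[where c = "inverse \<zeta>"]) (use V' reg_eta_lower[OF k1, of _ "-1"] z0 zi in \<open>auto simp: field_simps Vm_def\<close>)
  next
    case (N g)
    show ?case
      by (rule step[where c = 1]) (use N chiN[of g] in \<open>auto simp: Nm_def mact_def\<close>)
  next
    case (E1 g)
    have fp: "mact E1m (Complex (2/5) (1/5)) = Complex (2/5) (1/5)"
      by (simp add: mact_def E1m_def complex_eq_iff Re_divide Im_divide power2_eq_square)
    have "reg_eta 5 (mact E1m z) = reg_eta 5 z" if "z \<in> uhp" for z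
      by (rule reg_eta_elliptic[OF _ _ _ fp that]) (auto simp: E1m_def uhp_iff)
    thus ?case
      by (intro step[where c = 1]) (use E1 chi_5_steps(4)[of g] in \<open>auto simp: E1m_def\<close>)
  next
    case (E2 g)
    have fp: "mact E2m (Complex (3/5) (1/5)) = Complex (3/5) (1/5)"
      by (simp add: mact_def E2m_def complex_eq_iff Re_divide Im_divide power2_eq_square)
    have "reg_eta 5 (mact E2m z) = reg_eta 5 z" if "z \<in> uhp" for z
      by (rule reg_eta_elliptic[OF _ _ _ fp that]) (auto simp: E2m_def uhp_iff)
    thus ?case
      by (intro step[where c = 1]) (use E2 chi_5_steps(5)[of g] in \<open>auto simp: E2m_def\<close>)
  qed simp
  thus ?thesis using z by blast
qed

text \<open>
  With this \<open>N\<close> the exponent \<open>(k - 1) / 24\<close> equals \<open>k / N\<close>, so that \<open>f\<close> has an expansion in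
  \<open>q ^ (1 / N)\<close> starting with the \<open>k\<close>-th power, and the pole order \<open>(k - 1) / (24 k)\<close> at the cusps equals \<open>1 / N\<close>.
  It is also divisible enough for the orders of the characters that occur.
\<close>

definition level :: "nat \<Rightarrow> nat" where "level k = (if k = 3 then 36 else 30)"
text \<open>
  The quadratic characters modulo 12 and modulo 5.
\<close>

definition eps :: "nat \<Rightarrow> int \<Rightarrow> int" where
  "eps k d = (if k = 3 then (if d mod 4 = 1 then 1 else - 1) * (if d mod 3 = 1 then 1 else - 1)
     else (if d mod 5 = 1 \<or> d mod 5 = 4 then 1 else - 1))"

text \<open>
  Modulo \<open>N\<close> the matrix is diagonal, and only the dependence on the entry \<open>d\<close> survives.
\<close>

lemma chi_eps:
  assumes k: "k \<in> {3, 5}" and g: "mdet g = 1" "int (level k) dvd mb g" "int (level k) dvd mc g"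
  shows "chi k g = of_int (eps k (md g))"
proof (cases "k = 3")
  case True
  obtain b where b: "mb g = 36 * b" using g True by (auto simp: level_def elim!: dvdE)
  obtain c where c: "mc g = 36 * c" using g True by (auto simp: level_def elim!: dvdE)
  have det: "ma g * md g - 36 * (36 * (b * c)) = 1" using g by (simp add: mdet_def b c)
  have 1: "ex (of_int (ma g * mb g + mc g div 3 * md g) / of_int 3) = 1"
    using ex_cong[of "ma g * mb g + mc g div 3 * md g" 0 3] by (simp add: b c)
  have "psi4 (ma g) (mb g) (mc g) (md g) = 3 - 3 * md g + 4 * (9 * b * md g + 27 * c * md g + 9 * c - (9 * c * (36 * c)) * (36 * b * md g + 3 * (36 * c - 1) * md g + 36 * c + 3) + 9 * c * (ma g + md g - 3))"
    unfolding psi4_def b c by (simp add: algebra_simps)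
  hence ex4: "ex (of_int (- psi4 (ma g) (mb g) (mc g) (md g)) / of_int 4) = ex (of_int (3 * md g - 3) / of_int 4)"
    by (intro ex_cong) auto
  have "odd (md g)"
  proof
    assume "even (md g)"
    hence "even (ma g * md g - 36 * (36 * (b * c)))" by simp
    hence "even (1 :: int)" by (simp only: det)
    thus False by simp
  qed
  hence "md g mod 4 = 1 \<or> md g mod 4 = 3" by presburger
  hence 2: "ex (of_int (3 * md g - 3) / of_int 4) = (if md g mod 4 = 1 then 1 else - 1)"
  proof
    assume "md g mod 4 = 1"
    hence "(3 * md g - 3 - 0) mod 4 = 0" by presburger
    from ex_cong[OF this] show ?thesis using \<open>md g mod 4 = 1\<close> by simp
  next
    assume *: "md g mod 4 = 3"
    hence "(3 * md g - 3 - 2) mod 4 = 0" by presburger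
    from ex_cong[OF this] show ?thesis using * by (simp add: ex_half)
  qed
  show ?thesis unfolding chi_def using True 1 ex4 2 by (simp add: eps_def sgn3_def)
next
  case False
  with k have k5: "k = 5" by simp
  obtain b where b: "mb g = 30 * b" using g k5 by (auto simp: level_def elim!: dvdE)
  obtain c where c: "mc g = 30 * c" using g k5 by (auto simp: level_def elim!: dvdE)
  have 1: "ex (of_int (psi2 (ma g) (mb g) (mc g) (md g)) / of_int 2) = 1"
    using ex_cong[of "psi2 (ma g) (mb g) (mc g) (md g)" 0 2] by (simp add: psi2_def b c)
  have 2: "ex (of_int (- psi3 (ma g) (mb g) (mc g) (md g)) / of_int 3) = 1"
    using ex_cong[of "- psi3 (ma g) (mb g) (mc g) (md g)" 0 3] by (simp add: psi3_def b c mod_eq_0_iff_dvd)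
  show ?thesis unfolding chi_def using k5 1 2 by (simp add: eps_def sgn5_def)
qed

section \<open>Growth at the cusps\<close>

text \<open>
  The order of vanishing at infinity is at least \<open>lam / (2 \<pi>)\<close> in terms of \<open>q\<close>; negative \<open>lam\<close> allows a pole.
\<close>

definition decays :: "real \<Rightarrow> (complex \<Rightarrow> complex) \<Rightarrow> bool" where
  "decays lam h \<longleftrightarrow> (\<exists>C. \<exists>Y>0. \<forall>z. Im z \<ge> Y \<longrightarrow> norm (h z) \<le> C * exp (- lam * Im z))"

lemma decaysI: "Y > 0 \<Longrightarrow> (\<And>z. Im z \<ge> Y \<Longrightarrow> norm (h z) \<le> C * exp (- lam * Im z)) \<Longrightarrow> decays lam h"
  unfolding decays_def by blast

lemma decaysE:
  assumes "decays lam h"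
  obtains C Y where "C \<ge> 0" "Y > 0" "\<And>z. Im z \<ge> Y \<Longrightarrow> norm (h z) \<le> C * exp (- lam * Im z)"
proof -
  obtain C Y where Y: "Y > 0" and b: "\<And>z. Im z \<ge> Y \<Longrightarrow> norm (h z) \<le> C * exp (- lam * Im z)"
    using assms unfolding decays_def by blast
  show ?thesis
  proof (rule that[of "\<bar>C\<bar>" Y])
    fix z assume "Im z \<ge> Y"
    from b[OF this] show "norm (h z) \<le> \<bar>C\<bar> * exp (- lam * Im z)"
      by (rule order.trans) (simp add: mult_right_mono)
  qed (use Y in auto)
qed

lemma decays_cong: "(\<And>z. z \<in> uhp \<Longrightarrow> f z = g z) \<Longrightarrow> decays lam f \<longleftrightarrow> decays lam g"
  unfolding decays_def by (metis less_le_trans uhp_iff)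

lemma decays_cmult: assumes "decays lam f" shows "decays lam (\<lambda>z. c * f z)"
proof -
  obtain C Y where CY: "C \<ge> 0" "Y > 0" "\<And>z. Im z \<ge> Y \<Longrightarrow> norm (f z) \<le> C * exp (- lam * Im z)"
    using decaysE[OF assms] by blast
  show ?thesis
    by (rule decaysI[OF CY(2), of _ "norm c * C"]) (use CY(3) in \<open>auto simp: norm_mult mult.assoc intro: mult_left_mono\<close>)
qed

lemma decays_add: assumes "decays lam f" "decays lam g" shows "decays lam (\<lambda>z. f z + g z)"
proof -
  obtain C Y where CY: "C \<ge> 0" "Y > 0" "\<And>z. Im z \<ge> Y \<Longrightarrow> norm (f z) \<le> C * exp (- lam * Im z)"
    using decaysE[OF assms(1)] by blast
  obtain C' Y' where CY': "C' \<ge> 0" "Y' > 0" "\<And>z. Im z \<ge> Y' \<Longrightarrow> norm (g z) \<le> C' * exp (- lam * Im z)"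
    using decaysE[OF assms(2)] by blast
  show ?thesis
  proof (rule decaysI[of "max Y Y'" _ "C + C'"])
    fix z assume "max Y Y' \<le> Im z"
    hence "norm (f z) + norm (g z) \<le> (C + C') * exp (- lam * Im z)"
      using CY(3)[of z] CY'(3)[of z] by (simp add: distrib_right)
    thus "norm (f z + g z) \<le> (C + C') * exp (- lam * Im z)" using norm_triangle_ineq order.trans by blast
  qed (use CY in auto)
qed

lemma decays_0: "decays lam (\<lambda>_. 0)"
  by (rule decaysI[of 1 _ 0]) auto

lemma decays_sum: "(\<And>i. i \<in> I \<Longrightarrow> decays lam (f i)) \<Longrightarrow> decays lam (\<lambda>z. \<Sum>i\<in>I. f i z)"
  by (induction I rule: infinite_finite_induct) (auto intro: decays_0 decays_add)

lemma decays_mult: assumes "decays lam f" "decays \<mu> g" shows "decays (lam + \<mu>) (\<lambda>z. f z * g z)"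
proof -
  obtain C Y where CY: "C \<ge> 0" "Y > 0" "\<And>z. Im z \<ge> Y \<Longrightarrow> norm (f z) \<le> C * exp (- lam * Im z)"
    using decaysE[OF assms(1)] by blast
  obtain C' Y' where CY': "C' \<ge> 0" "Y' > 0" "\<And>z. Im z \<ge> Y' \<Longrightarrow> norm (g z) \<le> C' * exp (- \<mu> * Im z)"
    using decaysE[OF assms(2)] by blast
  show ?thesis
  proof (rule decaysI[of "max Y Y'" _ "C * C'"])
    fix z assume "max Y Y' \<le> Im z"
    hence "norm (f z) * norm (g z) \<le> (C * exp (- lam * Im z)) * (C' * exp (- \<mu> * Im z))"
      using CY(1) CY(3)[of z] CY'(3)[of z] by (intro mult_mono) auto
    also have "\<dots> = C * C' * exp (- (lam + \<mu>) * Im z)" by (simp add: exp_add[symmetric] algebra_simps)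
    finally show "norm (f z * g z) \<le> C * C' * exp (- (lam + \<mu>) * Im z)" by (simp add: norm_mult)
  qed (use CY in auto)
qed

lemma decays_power: assumes "decays lam f" shows "decays (real n * lam) (\<lambda>z. f z ^ n)"
proof (induction n)
  case 0
  show ?case by (rule decaysI[of 1 _ 1]) auto
next
  case (Suc n)
  from decays_mult[OF assms Suc] show ?case by (simp add: algebra_simps)
qed

text \<open>
  The imaginary part is multiplied by \<open>A / D \<ge> 1 / p\<close>.
\<close>

lemma decays_upper_triangular:
  assumes f: "decays lam f" and l: "lam \<ge> 0" and U: "mc U = 0" "ma U > 0" "md U > 0" "mdet U = p"
  shows "decays (lam / real_of_int p) (slash w U f)"
proof -
  obtain C Y where CY: "C \<ge> 0" "Y > 0" "\<And>z. Im z \<ge> Y \<Longrightarrow> norm (f z) \<le> C * exp (- lam * Im z)"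
    using decaysE[OF f] by blast
  have AD: "ma U * md U = p" using U by (simp add: mdet_def)
  have p: "p > 0" using mult_pos_pos[OF U(2,3)] AD by simp
  have "1 * md U \<le> ma U * md U" by (rule mult_right_mono) (use U in auto)
  hence dp: "real_of_int (md U) \<le> of_int p" using AD by simp
  show ?thesis
  proof (rule decaysI[of "Y * of_int p" _ C])
    fix z assume z: "Im z \<ge> Y * of_int p"
    hence z0: "Im z > 0" using CY p by (meson less_le_trans mult_pos_pos of_int_0_less_iff)
    have im: "Im (mact U z) = of_int (ma U) * Im z / of_int (md U)"
      using U by (simp add: mact_def Im_divide power2_eq_square)
    have "Im z / of_int p \<le> Im z / of_int (md U)" using dp U z0 by (intro divide_left_mono) auto
    also have "\<dots> \<le> Im (mact U z)"
      unfolding im using U z0 by (intro divide_right_mono) (auto simp: mult_le_cancel_right1)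
    finally have ge: "Im z / of_int p \<le> Im (mact U z)" .
    have "Y \<le> Im z / of_int p" using z p by (simp add: field_simps)
    hence Yle: "Im (mact U z) \<ge> Y" using ge by linarith
    have "norm (mj U z ^ w) \<ge> 1" using U by (simp add: mj_def norm_power)
    hence "norm (slash w U f z) \<le> norm (f (mact U z))"
      by (simp add: slash_def norm_divide divide_le_eq mult_le_cancel_left1)
    also have "\<dots> \<le> C * exp (- lam * Im (mact U z))" by (rule CY(3)[OF Yle])
    also have "\<dots> \<le> C * exp (- (lam / of_int p) * Im z)"
      using mult_left_mono[OF ge l] CY by (intro mult_left_mono) auto
    finally show "norm (slash w U f z) \<le> C * exp (- (lam / of_int p) * Im z)" .
  qed (use CY p in auto)
qed

text \<open>
  As a function of \<open>q ^ (1 / N)\<close> on the punctured disc, \<open>h\<close> grows more slowly than a simple pole,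
  so the singularity is removable. The function is defined on the disc through two branches of the logarithm, which periodicity
  glues together.
\<close>

lemma periodic_growth_imp_bounded:
  assumes N: "N > 0" and h: "h holomorphic_on uhp" and per: "\<And>z. z \<in> uhp \<Longrightarrow> h (z + of_nat N) = h z"
    and gr: "decays (- 2 * pi * \<theta> / real N) h" and th: "\<theta> < 1"
  shows "decays 0 h"
proof -
  obtain C Y where CY: "C \<ge> 0" "Y > 0" "\<And>z. Im z \<ge> Y \<Longrightarrow> norm (h z) \<le> C * exp (- (- 2 * pi * \<theta> / real N) * Im z)"
    using decaysE[OF gr] by blast
  have per_nat: "h (z + of_nat (n * N)) = h z" if "z \<in> uhp" for z n
  proof (induction n)
    case (Suc n)
    have "h (z + of_nat (n * N) + of_nat N) = h (z + of_nat (n * N))" using that by (intro per) (simp add: uhp_iff)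
    thus ?case using Suc by (simp add: algebra_simps)
  qed simp
  have per_int: "h (z + of_int n * of_nat N) = h z" if "z \<in> uhp" for z n
  proof (cases "n \<ge> 0")
    case True
    thus ?thesis using per_nat[OF that, of "nat n"] by simp
  next
    case False
    have "z + of_int n * of_nat N \<in> uhp" using that by (simp add: uhp_iff)
    from per_nat[OF this, of "nat (- n)"] False show ?thesis by simp
  qed
  define \<kappa> :: complex where "\<kappa> = of_nat N / (2 * of_real pi * \<i>)"
  have im\<kappa>: "Im (\<kappa> * L) = - (real N / (2 * pi)) * Re L" for L
    using N by (simp add: \<kappa>_def Im_divide Re_divide power2_eq_square divide_simps)
  have uhp\<kappa>: "\<kappa> * L \<in> uhp \<longleftrightarrow> Re L < 0" for L
    unfolding uhp_iff im\<kappa> using N by (simp add: mult_less_0_iff divide_less_0_iff zero_less_mult_iff)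
  define k where "k = (\<lambda>w. h (\<kappa> * Ln w))"
  have k_any: "h (\<kappa> * L) = k w" if "exp L = w" "norm w < 1" for L w
  proof -
    have w0: "w \<noteq> 0" using that by auto
    hence "exp L = exp (Ln w)" using that by simp
    then obtain n :: int where n: "L = Ln w + of_real (of_int (2 * n) * pi) * \<i>" using exp_eq by blast
    have "\<kappa> * L = \<kappa> * Ln w + of_int n * of_nat N" unfolding n \<kappa>_def by (simp add: field_simps)
    moreover have "\<kappa> * Ln w \<in> uhp"
      unfolding uhp\<kappa> using that w0 by simp
    ultimately show ?thesis using per_int by (simp add: k_def)
  qed
  have hol: "(\<lambda>w. h (\<kappa> * (Ln (c * w) + d))) holomorphic_on {w. norm w < 1 \<and> c * w \<notin> \<real>\<^sub>\<le>\<^sub>0}"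
    if cd: "c * exp d = 1" "norm c = 1" for c d
  proof -
    have "h \<circ> (\<lambda>w. \<kappa> * (Ln (c * w) + d)) holomorphic_on {w. norm w < 1 \<and> c * w \<notin> \<real>\<^sub>\<le>\<^sub>0}"
    proof (rule holomorphic_on_compose_gen[OF _ h])
      show "(\<lambda>w. \<kappa> * (Ln (c * w) + d)) holomorphic_on {w. norm w < 1 \<and> c * w \<notin> \<real>\<^sub>\<le>\<^sub>0}"
        by (intro holomorphic_intros) auto
      show "(\<lambda>w. \<kappa> * (Ln (c * w) + d)) ` {w. norm w < 1 \<and> c * w \<notin> \<real>\<^sub>\<le>\<^sub>0} \<subseteq> uhp"
      proof safe
        fix w assume w: "norm w < 1" "c * w \<notin> \<real>\<^sub>\<le>\<^sub>0"
        hence cw: "c * w \<noteq> 0" by auto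
        have "exp (Re d) = 1"
          using arg_cong[OF cd(1), of norm] cd(2) by (simp add: norm_mult norm_exp)
        hence "Re d = 0" by simp
        thus "\<kappa> * (Ln (c * w) + d) \<in> uhp"
          unfolding uhp\<kappa> using cw w cd(2) by (simp add: norm_mult)
      qed
    qed
    thus ?thesis by (simp add: o_def)
  qed
  have k_eq: "k w = h (\<kappa> * (Ln (c * w) + d))" if "c * exp d = 1" "norm w < 1" "w \<noteq> 0" "c \<noteq> 0" for c d w
  proof -
    have "exp (Ln (c * w) + d) = w" using that by (simp add: exp_add mult_ac)
    from k_any[OF this that(2)] show ?thesis by simp
  qed
  have "k holomorphic_on {w. norm w < 1 \<and> 1 * w \<notin> \<real>\<^sub>\<le>\<^sub>0}"
    using hol[of 1 0] by (simp add: k_def)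
  moreover have "k holomorphic_on {w. norm w < 1 \<and> - 1 * w \<notin> \<real>\<^sub>\<le>\<^sub>0}"
  proof -
    have c: "- 1 * exp (\<i> * of_real pi) = 1" by (simp add: exp_pi_i')
    have "(\<lambda>w. h (\<kappa> * (Ln (- 1 * w) + \<i> * of_real pi))) holomorphic_on {w. norm w < 1 \<and> - 1 * w \<notin> \<real>\<^sub>\<le>\<^sub>0}"
      by (rule hol[OF c]) simp
    thus ?thesis
    proof (rule holomorphic_transform)
      fix x :: complex assume x: "x \<in> {w. norm w < 1 \<and> - 1 * w \<notin> \<real>\<^sub>\<le>\<^sub>0}"
      hence "x \<noteq> 0" by auto
      thus "h (\<kappa> * (Ln (- 1 * x) + \<i> * of_real pi)) = k x" using k_eq[OF c, of x] x by simp
    qed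
  qed
  moreover have op: "open {w::complex. norm w < 1 \<and> c * w \<notin> \<real>\<^sub>\<le>\<^sub>0}" for c
  proof -
    have "open ((\<lambda>w::complex. c * w) -` (- \<real>\<^sub>\<le>\<^sub>0) \<inter> ball 0 1)"
      by (intro open_Int open_vimage) (auto simp: closed_nonpos_Reals_complex intro!: continuous_intros)
    also have "(\<lambda>w::complex. c * w) -` (- \<real>\<^sub>\<le>\<^sub>0) \<inter> ball 0 1 = {w. norm w < 1 \<and> c * w \<notin> \<real>\<^sub>\<le>\<^sub>0}" by auto
    finally show ?thesis .
  qed
  ultimately have "k holomorphic_on ({w. norm w < 1 \<and> 1 * w \<notin> \<real>\<^sub>\<le>\<^sub>0} \<union> {w. norm w < 1 \<and> - 1 * w \<notin> \<real>\<^sub>\<le>\<^sub>0})"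
    by (intro holomorphic_on_Un op)
  also have "({w. norm w < 1 \<and> 1 * w \<notin> \<real>\<^sub>\<le>\<^sub>0} \<union> {w. norm w < 1 \<and> - 1 * w \<notin> \<real>\<^sub>\<le>\<^sub>0}) = ball (0::complex) 1 - {0}"
    by (auto simp: complex_nonpos_Reals_iff complex_eq_iff)
  finally have holk: "k holomorphic_on ball 0 1 - {0}" .
  define r where "r = exp (- 2 * pi * Y / real N)"
  have r: "r > 0" "r < 1" using CY N by (auto simp: r_def)
  have kb: "norm (k w) \<le> C * norm w powr (- \<theta>)" if "norm w \<le> r" "w \<noteq> 0" for w
  proof -
    have w: "norm w < 1" using that r by simp
    have "ln (norm w) \<le> - 2 * pi * Y / real N"
      using that ln_le_cancel_iff[of "norm w" r] by (simp add: r_def)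
    hence "Y \<le> Im (\<kappa> * Ln w)" unfolding im\<kappa> using that N by (simp add: field_simps)
    from CY(3)[OF this] have "norm (k w) \<le> C * exp (- (- 2 * pi * \<theta> / real N) * Im (\<kappa> * Ln w))" by (simp add: k_def)
    also have "- (- 2 * pi * \<theta> / real N) * Im (\<kappa> * Ln w) = - \<theta> * ln (norm w)"
      unfolding im\<kappa> using that N by simp
    finally show ?thesis using that by (simp add: powr_def)
  qed
  have "((\<lambda>w. (w - 0) * k w) \<longlongrightarrow> 0) (at 0)"
  proof (rule Lim_null_comparison)
    have "eventually (\<lambda>w::complex. w \<in> ball 0 r) (at 0)" using r by (intro eventually_at_in_open') auto
    moreover have "eventually (\<lambda>w::complex. w \<noteq> 0) (at 0)" by (rule eventually_neq_at_within)
    ultimately show "eventually (\<lambda>w. norm ((w - 0) * k w) \<le> C * norm w powr (1 - \<theta>)) (at 0)"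
    proof eventually_elim
      case (elim w)
      have "norm ((w - 0) * k w) \<le> norm w * (C * norm w powr (- \<theta>))"
        using kb[of w] elim by (simp add: norm_mult mult_left_mono)
      also have "norm w * (C * norm w powr (- \<theta>)) = C * norm w powr (1 - \<theta>)"
        using elim powr_add[of "norm w" 1 "- \<theta>"] by simp
      finally show ?case .
    qed
    have "((\<lambda>w::complex. C * norm w powr (1 - \<theta>)) \<longlongrightarrow> C * 0) (at 0)"
    proof (intro tendsto_mult tendsto_const)
      have "((\<lambda>w::complex. norm w powr (1 - \<theta>)) \<longlongrightarrow> 0 powr (1 - \<theta>)) (at 0)"
        by (rule tendsto_powr2) (use th in \<open>auto intro!: tendsto_eq_intros\<close>)
      thus "((\<lambda>w::complex. norm w powr (1 - \<theta>)) \<longlongrightarrow> 0) (at 0)" by simp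
    qed
    thus "((\<lambda>w::complex. C * norm w powr (1 - \<theta>)) \<longlongrightarrow> 0) (at 0)" by simp
  qed
  then obtain g where g: "g holomorphic_on ball 0 1" "\<And>z. z \<in> ball 0 1 - {0} \<Longrightarrow> g z = k z"
    using holomorphic_on_extend_lim[OF holk] by (auto simp: interior_open)
  have "continuous_on (cball 0 r) g"
    by (rule continuous_on_subset[OF holomorphic_on_imp_continuous_on[OF g(1)]]) (use r in auto)
  hence "bounded (g ` cball 0 r)" by (intro compact_imp_bounded compact_continuous_image) auto
  then obtain M where "\<forall>x\<in>cball 0 r. norm (g x) \<le> M" unfolding bounded_iff by auto
  hence M: "norm (g x) \<le> M" if "norm x \<le> r" for x using that by simp
  show ?thesis
  proof (rule decaysI[OF CY(2), of _ M])
    fix z assume z: "Im z \<ge> Y"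
    define w where "w = exp (2 * of_real pi * \<i> * z / of_nat N)"
    have nw: "norm w \<le> r" using z N by (simp add: w_def norm_exp r_def divide_right_mono)
    have z': "\<kappa> * (2 * of_real pi * \<i> * z / of_nat N) = z" using N by (simp add: \<kappa>_def)
    have "h (\<kappa> * (2 * of_real pi * \<i> * z / of_nat N)) = k w"
      by (rule k_any[OF w_def[symmetric]]) (use nw r in linarith)
    hence "k w = h z" by (simp only: z')
    moreover have "w \<noteq> 0" by (simp add: w_def)
    hence "g w = k w" using nw r by (intro g(2)) auto
    ultimately show "norm (h z) \<le> M * exp (- 0 * Im z)" using M[OF nw] by simp
  qed
qed


section \<open>Modular forms and Hecke operators for matrices that are diagonal modulo N\<close>

text \<open>
  The group consists of the matrices that are diagonal modulo \<open>N\<close>, rather than of \<open>\<Gamma>\<^sub>0(N)\<close>: its translations are the multiples of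
  \<open>N\<close>, which fits expansions in \<open>q ^ (1 / N)\<close>, and only real characters of the diagonal entry occur.
\<close>

locale diagonal_character =
  fixes N :: nat and e :: "int \<Rightarrow> int"
  assumes N_pos: "N > 0"
    and e_cong: "\<And>d d'. int N dvd d - d' \<Longrightarrow> e d = e d'"
    and e_mult: "\<And>d d'. coprime d (int N) \<Longrightarrow> coprime d' (int N) \<Longrightarrow> e (d * d') = e d * e d'"
    and e_square: "\<And>d. e d * e d = 1"
    and e_one: "e 1 = 1"
begin

definition Gam :: "mat2 set" where
  "Gam = {g. mdet g = 1 \<and> int N dvd mb g \<and> int N dvd mc g}"

definition Del :: "nat \<Rightarrow> mat2 set" where
  "Del p = {A. mdet A = int p \<and> int N dvd mb A \<and> int N dvd mc A}"

text \<open>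
  The last condition concerns all cusps at once. With \<open>lam = 0\<close> this is the usual notion of a modular form; a positive
  \<open>lam\<close> prescribes a common order of vanishing.
\<close>

definition modular_form :: "nat \<Rightarrow> real \<Rightarrow> (complex \<Rightarrow> complex) \<Rightarrow> bool" where
  "modular_form w lam h \<longleftrightarrow> h holomorphic_on uhp
     \<and> (\<forall>g\<in>Gam. \<forall>z\<in>uhp. slash w g h z = of_int (e (md g)) * h z)
     \<and> (\<forall>g. mdet g = 1 \<longrightarrow> decays lam (slash w g h))"

lemma coprime_entries:
  assumes "mdet A = int p" "int N dvd mb A" "coprime (int p) (int N)"
  shows "coprime (ma A) (int N)"
proof (rule coprimeI)
  fix c assume c: "c dvd ma A" "c dvd int N"
  hence "c dvd mb A" using assms(2) dvd_trans by blast
  with c have "c dvd mdet A" unfolding mdet_def by auto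
  with assms(1,3) c show "is_unit c" by (metis coprime_common_divisor)
qed

lemma e_Gam: assumes "g \<in> Gam" shows "e (ma g) = e (md g)" "coprime (ma g) (int N)" "coprime (md g) (int N)"
proof -
  have g: "mdet g = int 1" "int N dvd mb g" "int N dvd mc g" using assms by (auto simp: Gam_def)
  show 1: "coprime (ma g) (int N)" by (rule coprime_entries[OF g(1,2)]) simp
  have "mdet (Mat2 (md g) (mb g) (mc g) (ma g)) = int 1" using g by (simp add: mdet_def mult.commute)
  from coprime_entries[OF this] g show 2: "coprime (md g) (int N)" by simp
  have "ma g * md g - 1 = mb g * mc g" using g by (simp add: mdet_def)
  hence "e (ma g * md g) = e 1" using g by (intro e_cong) auto
  hence "e (ma g) * e (md g) = 1" using e_mult[OF 1 2] e_one by simp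
  thus "e (ma g) = e (md g)" using e_square[of "md g"] by (metis mult.assoc mult.right_neutral mult_1)
qed

text \<open>
  Representatives of the matrices of determinant \<open>p\<close> modulo left multiplication by the group. The upper right entries are multiples
  of \<open>N\<close>, which is possible as \<open>p\<close> is prime to \<open>N\<close>.
\<close>

definition reps :: "nat \<Rightarrow> mat2 set" where
  "reps p = insert (Mat2 (int p) 0 0 1) ((\<lambda>j. Mat2 1 (int N * int j) 0 (int p)) ` {..<p})"

lemma reps_det: "A \<in> reps p \<Longrightarrow> mdet A = int p" by (auto simp: reps_def)
lemma reps_Del: "reps p \<subseteq> Del p" by (auto simp: reps_def Del_def)
lemma finite_reps [simp]: "finite (reps p)" by (simp add: reps_def)

lemma Del_mult_Gam: assumes "A \<in> Del p" "g \<in> Gam" shows "A * g \<in> Del p"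
  using assms by (auto simp: Del_def Gam_def)

lemma reps_exist:
  assumes p: "prime p" "coprime (int p) (int N)" and A: "A \<in> Del p"
  shows "\<exists>g\<in>Gam. \<exists>r\<in>reps p. A = g * r"
proof -
  define a b c d where abcd: "a = ma A" "b = mb A" "c = mc A" "d = md A"
  have det: "a * d - b * c = int p" and Nb: "int N dvd b" and Nc: "int N dvd c"
    using A by (auto simp: Del_def mdet_def abcd)
  have p0: "int p \<noteq> 0" using p(1) by auto
  have pp: "prime (int p)" using p by simp
  have upper: ?thesis if j: "int p dvd b - a * (int N * int j)" "int p dvd d - c * (int N * int j)" "j < p" for j
  proof -
    obtain b' where b': "b - a * (int N * int j) = int p * b'" using j by (elim dvdE)
    obtain d' where d': "d - c * (int N * int j) = int p * d'" using j by (elim dvdE)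
    define g where "g = Mat2 a b' c d'"
    have "int p * (a * d' - b' * c) = a * (d - c * (int N * int j)) - (b - a * (int N * int j)) * c"
      unfolding b' d' by (simp add: algebra_simps)
    also have "\<dots> = int p * 1" using det by (simp add: algebra_simps)
    finally have dg: "mdet g = 1" using p0 by (simp add: g_def)
    have "int N dvd int p * b'" unfolding b'[symmetric] using Nb by simp
    hence "int N dvd b'" using p(2) by (simp add: coprime_dvd_mult_right_iff coprime_commute)
    hence "g \<in> Gam" using dg Nc by (simp add: Gam_def g_def)
    moreover have "A = g * Mat2 1 (int N * int j) 0 (int p)"
      using b' d' by (simp add: mat2_eq_iff g_def abcd algebra_simps)
    ultimately show ?thesis using j(3) by (auto simp: reps_def)
  qed
  have solve: "\<exists>j<p. int p dvd y - x * (int N * int j)" if "\<not> int p dvd x" for x y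
  proof -
    have "coprime (x * int N) (int p)"
      using prime_imp_coprime[OF pp that] p(2) by (simp add: coprime_mult_left_iff coprime_commute)
    then obtain t where t: "[x * int N * t = 1] (mod int p)" using cong_solve_coprime_int by blast
    define j where "j = nat ((t * y) mod int p)"
    have jp: "int j = (t * y) mod int p" using p0 by (simp add: j_def)
    have "[x * int N * int j = x * int N * (t * y)] (mod int p)" unfolding jp by (intro cong_mult) (simp_all add: Cong.cong_def)
    also have "[x * int N * (t * y) = 1 * y] (mod int p)" using cong_mult[OF t, of y y] by (simp add: mult.assoc)
    finally have "int p dvd x * int N * int j - y" by (simp add: cong_iff_dvd_diff)
    hence "int p dvd y - x * (int N * int j)" by (metis dvd_minus_iff minus_diff_eq mult.assoc)
    moreover have "int j < int p" unfolding jp using p0 by simp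
    ultimately show ?thesis by auto
  qed
  show ?thesis
  proof (cases "int p dvd a")
    case False
    then obtain j where j: "j < p" "int p dvd b - a * (int N * int j)" using solve by blast
    have "int p dvd int p + c * (b - a * (int N * int j))" using j by simp
    also have "int p + c * (b - a * (int N * int j)) = a * (d - c * (int N * int j))"
      using det by (simp add: algebra_simps)
    finally have "int p dvd d - c * (int N * int j)" using False pp by (simp add: prime_dvd_mult_iff)
    thus ?thesis using upper j by blast
  next
    case a: True
    show ?thesis
    proof (cases "int p dvd c")
      case False
      then obtain j where j: "j < p" "int p dvd d - c * (int N * int j)" using solve by blast
      have "int p dvd a * (d - c * (int N * int j)) - int p" using j by simp
      also have "a * (d - c * (int N * int j)) - int p = c * (b - a * (int N * int j))"
        using det by (simp add: algebra_simps)
      finally have "int p dvd b - a * (int N * int j)" using False pp by (simp add: prime_dvd_mult_iff)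
      thus ?thesis using upper j by blast
    next
      case True
      obtain a' where a': "a = int p * a'" using a by (elim dvdE)
      obtain c' where c': "c = int p * c'" using True by (elim dvdE)
      have "int p * (a' * d - b * c') = int p * 1" using det by (simp add: a' c' algebra_simps)
      hence "a' * d - b * c' = 1" using p0 by simp
      moreover have "int N dvd c'" using Nc p(2) by (simp add: c' coprime_dvd_mult_right_iff coprime_commute)
      ultimately have "Mat2 a' b c' d \<in> Gam" using Nb by (simp add: Gam_def)
      moreover have "A = Mat2 a' b c' d * Mat2 (int p) 0 0 1"
        using a' c' by (simp add: mat2_eq_iff abcd)
      ultimately show ?thesis by (auto simp: reps_def)
    qed
  qed
qed

lemma reps_unique:
  assumes p: "prime p" "coprime (int p) (int N)" and r: "r \<in> reps p" "r' \<in> reps p" and g: "r = g * r'"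
  shows "r = r'"
proof -
  have p1: "int p > 1" using prime_gt_1_nat[OF p(1)] by simp
  from r(1) consider (inf) "r = Mat2 (int p) 0 0 1" | (fin) i where "i < p" "r = Mat2 1 (int N * int i) 0 (int p)"
    by (auto simp: reps_def)
  thus ?thesis
  proof cases
    case 1: inf
    show ?thesis
    proof (rule ccontr)
      assume "r \<noteq> r'"
      with r(2) 1 obtain j where "r' = Mat2 1 (int N * int j) 0 (int p)" by (auto simp: reps_def)
      with g 1 have "md g * int p = 1" by (auto simp: mat2_eq_iff)
      thus False using p1 by (auto simp: zmult_eq_1_iff)
    qed
  next
    case 2: (fin i)
    from r(2) consider "r' = Mat2 (int p) 0 0 1" | (snd) j where "j < p" "r' = Mat2 1 (int N * int j) 0 (int p)"
      by (auto simp: reps_def)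
    thus ?thesis
    proof cases
      case 1
      with g 2 have "ma g * int p = 1" by (auto simp: mat2_eq_iff)
      thus ?thesis using p1 by (auto simp: zmult_eq_1_iff)
    next
      case j: (snd j)
      with g 2 have "int N * int i = int N * int j + mb g * int p" by (auto simp: mat2_eq_iff)
      hence "int N * (int i - int j) = mb g * int p" by (simp add: algebra_simps)
      hence "int p dvd int N * (int i - int j)" by simp
      hence dv: "int p dvd int i - int j" using p(2) by (simp add: coprime_dvd_mult_right_iff)
      have "int i - int j = 0"
        using zdvd_imp_le[OF dv] zdvd_imp_le[of "int p" "int j - int i"] dv 2(1) j(1)
        by (cases "int i - int j" "0 :: int" rule: linorder_cases) (auto simp: dvd_diff_commute)
      thus ?thesis using 2 j by simp
    qed
  qed
qed

text \<open>
  The factor \<open>e (ma A)\<close> makes the summand depend on the coset of \<open>A\<close> only.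
\<close>

definition hterm :: "nat \<Rightarrow> (complex \<Rightarrow> complex) \<Rightarrow> mat2 \<Rightarrow> complex \<Rightarrow> complex" where
  "hterm w h A z = of_int (e (ma A)) * slash w A h z"

definition hecke :: "nat \<Rightarrow> nat \<Rightarrow> (complex \<Rightarrow> complex) \<Rightarrow> complex \<Rightarrow> complex" where
  "hecke w p h z = of_nat p ^ (w - 1) * (\<Sum>A\<in>reps p. hterm w h A z)"

lemma hterm_Gam_mult:
  assumes h: "modular_form w lam h" and p: "p > 0" "coprime (int p) (int N)"
    and g: "g \<in> Gam" and A: "A \<in> Del p" and z: "z \<in> uhp"
  shows "hterm w h (g * A) z = hterm w h A z"
proof -
  have dA: "mdet A = int p" "int N dvd mb A" "int N dvd mc A" and dg: "mdet g = 1" "int N dvd mb g" "int N dvd mc g"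
    using A g by (auto simp: Del_def Gam_def)
  have "slash w (g * A) h z = slash w A (slash w g h) z" using dA dg p z by (intro slash_mult) auto
  also have "\<dots> = slash w A (\<lambda>z. of_int (e (md g)) * h z) z"
    by (rule slash_cong) (use h g dA p z in \<open>auto simp: modular_form_def\<close>)
  finally have 1: "slash w (g * A) h z = of_int (e (md g)) * slash w A h z" by (simp add: slash_def)
  have "e (ma (g * A)) = e (ma g * ma A)" by (rule e_cong) (use dA dg in auto)
  also have "\<dots> = e (ma g) * e (ma A)"
    by (intro e_mult e_Gam(2)[OF g] coprime_entries[OF dA(1,2) p(2)])
  finally have 2: "e (ma (g * A)) = e (md g) * e (ma A)" using e_Gam[OF g] by simp
  have "(of_int (e (md g)) :: complex) * of_int (e (md g)) = 1" using e_square[of "md g"] by (metis of_int_1 of_int_mult)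
  hence "of_int (e (md g)) * of_int (e (md g)) * (of_int (e (ma A)) * slash w A h z) = of_int (e (ma A)) * slash w A h z"
    by simp
  thus ?thesis unfolding hterm_def 1 2 by (simp only: of_int_mult mult_ac)
qed

text \<open>
  Right multiplication by an element of the group permutes the cosets. For the growth, every summand is
  brought to upper triangular form, which costs at most a factor \<open>p\<close> in the exponent.
\<close>

lemma hecke_modular_form:
  assumes h: "modular_form w lam h" and lam: "lam \<ge> 0" and p: "prime p" "coprime (int p) (int N)"
  shows "modular_form w (lam / real p) (hecke w p h)"
  unfolding modular_form_def
proof (intro conjI ballI allI impI)
  have p0: "p > 0" using p by (simp add: prime_gt_0_nat)
  have hol: "h holomorphic_on uhp" using h by (simp add: modular_form_def)
  have "(\<lambda>z. of_nat p ^ (w - 1) * (\<Sum>A\<in>reps p. of_int (e (ma A)) * slash w A h z)) holomorphic_on uhp"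
    using reps_det p0 by (intro holomorphic_intros holomorphic_slash hol) auto
  thus "hecke w p h holomorphic_on uhp" by (simp add: hecke_def[abs_def] hterm_def)
next
  have p0: "p > 0" using p by (simp add: prime_gt_0_nat)
  fix g z assume g: "g \<in> Gam" and z: "z \<in> uhp"
  define \<rho> where "\<rho> = (\<lambda>A. SOME r. r \<in> reps p \<and> (\<exists>\<gamma>\<in>Gam. A * g = \<gamma> * r))"
  have \<rho>: "\<rho> A \<in> reps p \<and> (\<exists>\<gamma>\<in>Gam. A * g = \<gamma> * \<rho> A)" if "A \<in> reps p" for A
  proof -
    have "A * g \<in> Del p" using that reps_Del g Del_mult_Gam by blast
    from reps_exist[OF p this] have "\<exists>r. r \<in> reps p \<and> (\<exists>\<gamma>\<in>Gam. A * g = \<gamma> * r)" by blast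
    thus ?thesis unfolding \<rho>_def by (rule someI_ex)
  qed
  have inj: "inj_on \<rho> (reps p)"
  proof (rule inj_onI)
    fix A B assume AB: "A \<in> reps p" "B \<in> reps p" "\<rho> A = \<rho> B"
    obtain \<gamma> where \<gamma>: "\<gamma> \<in> Gam" "A * g = \<gamma> * \<rho> A" using \<rho>[OF AB(1)] by blast
    obtain \<delta> where \<delta>: "\<delta> \<in> Gam" "B * g = \<delta> * \<rho> A" using \<rho>[OF AB(2)] AB(3) by auto
    have dg: "mdet g = 1" "mdet \<delta> = 1" using g \<delta> by (auto simp: Gam_def)
    have "\<gamma> * adj \<delta> * B = \<gamma> * adj \<delta> * (B * g) * adj g"
      by (simp only: mult.assoc mult_adj(1)[OF dg(1)] mult_1_right)
    also have "\<dots> = \<gamma> * (adj \<delta> * \<delta>) * \<rho> A * adj g" by (simp only: \<delta>(2) mult.assoc)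
    also have "\<dots> = A * g * adj g" by (simp only: mult_adj(2)[OF dg(2)] mult_1_right \<gamma>(2))
    also have "\<dots> = A" by (simp only: mult.assoc mult_adj(1)[OF dg(1)] mult_1_right)
    finally have "A = \<gamma> * adj \<delta> * B" by simp
    thus "A = B" by (rule reps_unique[OF p AB(1,2)])
  qed
  have im: "\<rho> ` reps p = reps p"
    by (rule endo_inj_surj[OF finite_reps _ inj]) (use \<rho> in auto)
  have dg: "mdet g = 1" "int N dvd mb g" "int N dvd mc g" using g by (auto simp: Gam_def)
  have eg: "(of_int (e (md g)) :: complex) * of_int (e (md g)) = 1" using e_square[of "md g"] by (metis of_int_1 of_int_mult)
  have tm: "slash w g (hterm w h A) z = of_int (e (md g)) * hterm w h (\<rho> A) z" if A: "A \<in> reps p" for A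
  proof -
    have AD: "A \<in> Del p" using A reps_Del by auto
    hence dA: "mdet A = int p" "int N dvd mb A" "int N dvd mc A" by (auto simp: Del_def)
    obtain \<gamma> where \<gamma>: "\<gamma> \<in> Gam" "A * g = \<gamma> * \<rho> A" using \<rho>[OF A] by blast
    have "e (ma (A * g)) = e (ma A * ma g)" by (rule e_cong) (use dA dg in auto)
    also have "\<dots> = e (ma A) * e (md g)"
      using e_mult[OF coprime_entries[OF dA(1,2) p(2)] e_Gam(2)[OF g]] e_Gam(1)[OF g] by simp
    finally have e1: "e (ma (A * g)) = e (ma A) * e (md g)" .
    have "slash w g (hterm w h A) z = of_int (e (ma A)) * slash w g (slash w A h) z"
      by (simp add: hterm_def slash_def)
    also have "slash w g (slash w A h) z = slash w (A * g) h z"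
      using dA dg p0 z by (intro slash_mult[symmetric]) auto
    also have "of_int (e (ma A)) * slash w (A * g) h z = of_int (e (md g)) * hterm w h (A * g) z"
    proof -
      have "of_int (e (ma A)) * slash w (A * g) h z = of_int (e (md g)) * of_int (e (md g)) * (of_int (e (ma A)) * slash w (A * g) h z)"
        unfolding eg by simp
      thus ?thesis unfolding hterm_def e1 by (simp only: of_int_mult mult_ac)
    qed
    also have "hterm w h (A * g) z = hterm w h (\<rho> A) z"
      unfolding \<gamma>(2) using \<rho>[OF A] reps_Del by (intro hterm_Gam_mult[OF h p0 p(2) \<gamma>(1) _ z]) auto
    finally show ?thesis .
  qed
  have "slash w g (hecke w p h) z = of_nat p ^ (w - 1) * (\<Sum>A\<in>reps p. slash w g (hterm w h A) z)"
    by (simp add: slash_def hecke_def sum_divide_distrib[symmetric])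
  also have "(\<Sum>A\<in>reps p. slash w g (hterm w h A) z) = (\<Sum>A\<in>reps p. of_int (e (md g)) * hterm w h (\<rho> A) z)"
    by (intro sum.cong refl tm)
  also have "\<dots> = of_int (e (md g)) * (\<Sum>A\<in>\<rho> ` reps p. hterm w h A z)"
    by (simp add: sum.reindex[OF inj] sum_distrib_left)
  also have "of_nat p ^ (w - 1) * (of_int (e (md g)) * (\<Sum>A\<in>\<rho> ` reps p. hterm w h A z)) = of_int (e (md g)) * hecke w p h z"
    by (simp only: hecke_def im mult_ac)
  finally show "slash w g (hecke w p h) z = of_int (e (md g)) * hecke w p h z" .
next
  have p0: "p > 0" using p by (simp add: prime_gt_0_nat)
  fix g assume g: "mdet g = 1"
  have "decays (lam / real p) (\<lambda>z. of_nat p ^ (w - 1) * (\<Sum>A\<in>reps p. of_int (e (ma A)) * slash w (A * g) h z))"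
  proof (intro decays_cmult decays_sum)
    fix A assume A: "A \<in> reps p"
    have dA: "mdet (A * g) = int p" using reps_det[OF A] g by simp
    obtain \<sigma> U where s: "mdet \<sigma> = 1" "A * g = \<sigma> * U" and U: "mc U = 0" "ma U > 0" "md U > 0" "mdet U = mdet (A * g)"
      by (rule upper_triangular_decomposition[of "A * g"]) (use dA p0 in auto)
    have "decays lam (slash w \<sigma> h)" using h s by (simp add: modular_form_def)
    from decays_upper_triangular[OF this lam U(1-3), of "int p" w] U(4) dA
    have "decays (lam / real p) (slash w U (slash w \<sigma> h))" by simp
    also have "?this \<longleftrightarrow> decays (lam / real p) (slash w (A * g) h)"
      by (rule decays_cong) (use s U dA p0 in \<open>simp add: slash_mult\<close>)
    finally show "decays (lam / real p) (slash w (A * g) h)" .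
  qed
  also have "?this \<longleftrightarrow> decays (lam / real p) (slash w g (hecke w p h))"
  proof (rule decays_cong)
    fix z assume z: "z \<in> uhp"
    have eq: "slash w (A * g) h z = slash w g (slash w A h) z" if "A \<in> reps p" for A
      using reps_det[OF that] g p0 z by (intro slash_mult) auto
    have "(\<Sum>A\<in>reps p. of_int (e (ma A)) * slash w (A * g) h z) = (\<Sum>A\<in>reps p. hterm w h A (mact g z)) / mj g z ^ w"
      unfolding sum_divide_distrib by (intro sum.cong refl) (subst eq, simp_all add: hterm_def slash_def)
    thus "of_nat p ^ (w - 1) * (\<Sum>A\<in>reps p. of_int (e (ma A)) * slash w (A * g) h z) = slash w g (hecke w p h) z"
      by (simp add: slash_def hecke_def)
  qed
  finally show "decays (lam / real p) (slash w g (hecke w p h))" .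
qed

end

section \<open>A form vanishing to high order at infinity is zero\<close>

lemma holomorphic_prod_eq_0:
  assumes "finite I" "\<And>i. i \<in> I \<Longrightarrow> f i holomorphic_on uhp" "\<And>z. z \<in> uhp \<Longrightarrow> (\<Prod>i\<in>I. f i z) = (0::complex)"
  shows "\<exists>i\<in>I. \<forall>z\<in>uhp. f i z = 0"
  using assms
proof (induction I rule: finite_induct)
  case empty
  have "\<i> \<in> uhp" by (simp add: uhp_iff)
  from empty(2)[OF this] show ?case by simp
next
  case (insert x I)
  show ?case
  proof (cases "\<forall>z\<in>uhp. f x z = 0")
    case False
    then obtain z0 where z0: "z0 \<in> uhp" "f x z0 \<noteq> 0" by blast
    have cont: "continuous_on uhp (f x)" by (intro holomorphic_on_imp_continuous_on insert) simp
    define S where "S = uhp \<inter> f x -` (- {0})"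
    have S: "open S" unfolding S_def by (intro continuous_open_preimage cont) auto
    have holP: "(\<lambda>z. \<Prod>i\<in>I. f i z) holomorphic_on uhp" by (intro holomorphic_on_prod insert) simp
    have "(\<Prod>i\<in>I. f i z) = 0" if "z \<in> uhp" for z
    proof (rule analytic_continuation_open[OF S open_uhp _ connected_uhp _ holP holomorphic_on_const _ that])
      show "S \<noteq> {}" using z0 by (auto simp: S_def)
      show "S \<subseteq> uhp" by (auto simp: S_def)
      fix w assume "w \<in> S"
      thus "(\<Prod>i\<in>I. f i w) = 0" using insert.prems(2)[of w] insert.hyps by (auto simp: S_def)
    qed
    hence "\<exists>i\<in>I. \<forall>z\<in>uhp. f i z = 0" using insert.prems(1) by (intro insert.IH) blast+
    thus ?thesis by blast
  qed blast
qed

lemma decays_const: "decays 0 (\<lambda>_. c)"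
  by (rule decaysI[of 1 _ "norm c"]) auto

lemma decays_prod:
  assumes "finite I" "\<And>i. i \<in> I \<Longrightarrow> decays 0 (f i)"
  shows "decays 0 (\<lambda>z. \<Prod>i\<in>I. f i z)"
  using assms
proof (induction I rule: finite_induct)
  case empty
  show ?case by (simp add: decays_const)
next
  case (insert x I)
  have "decays 0 (\<lambda>z. \<Prod>i\<in>I. f i z)" using insert.prems by (intro insert.IH) blast
  from decays_mult[OF insert.prems[of x] this] show ?case using insert.hyps by simp
qed

lemma decays_Delta: "decays (2 * pi) Delta"
proof -
  obtain M where up: "\<And>z. Im z \<ge> 1 \<Longrightarrow> norm (Delta z) \<le> exp M * exp (- 2 * pi * Im z)"
    and lo: "\<And>z. Im z \<ge> 1 \<Longrightarrow> norm (Delta z) \<ge> exp (- M) * exp (- 2 * pi * Im z)"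
    using Delta_bounds by blast
  show ?thesis by (rule decaysI[of 1 _ "exp M"]) (use up in simp_all)
qed

lemma decays_inverse_Delta: "decays (- 2 * pi) (\<lambda>z. inverse (Delta z))"
proof -
  obtain M where up: "\<And>z. Im z \<ge> 1 \<Longrightarrow> norm (Delta z) \<le> exp M * exp (- 2 * pi * Im z)"
    and lo: "\<And>z. Im z \<ge> 1 \<Longrightarrow> norm (Delta z) \<ge> exp (- M) * exp (- 2 * pi * Im z)"
    using Delta_bounds by blast
  show ?thesis
  proof (rule decaysI[of 1 _ "exp M"])
    fix z assume "1 \<le> Im z"
    from le_imp_inverse_le[OF lo[OF this]]
    have "norm (inverse (Delta z)) \<le> inverse (exp (- M) * exp (- 2 * pi * Im z))" by (simp add: norm_inverse)
    also have "\<dots> = exp M * exp (- (- 2 * pi) * Im z)" by (simp add: exp_minus)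
    finally show "norm (inverse (Delta z)) \<le> exp M * exp (- (- 2 * pi) * Im z)" .
  qed simp
qed

text \<open>
  A function on the compactified fundamental domain that vanishes at the cusp attains its maximum
  modulus in the upper half plane, and so is constant.
\<close>

lemma level_one_weight_zero_vanishes:
  assumes F: "F holomorphic_on uhp" and inv: "\<And>g z. mdet g = 1 \<Longrightarrow> z \<in> uhp \<Longrightarrow> F (mact g z) = F z"
    and dec: "decays d F" "d > 0" and z1: "z1 \<in> uhp"
  shows "F z1 = 0"
proof (rule ccontr)
  assume nz: "F z1 \<noteq> 0"
  define v where "v = norm (F z1)"
  have v: "v > 0" using nz by (simp add: v_def)
  obtain C Y where CY: "C \<ge> 0" "Y > 0" "\<And>z. Im z \<ge> Y \<Longrightarrow> norm (F z) \<le> C * exp (- d * Im z)"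
    using decaysE[OF dec(1)] by blast
  have "((\<lambda>y. C * exp (- d * y)) \<longlongrightarrow> 0) at_top" using dec(2)
  proof -
    have "((\<lambda>y. exp (- d * y)) \<longlongrightarrow> 0) at_top" using dec(2) by real_asymp
    from tendsto_mult_left[OF this, of C] show ?thesis by simp
  qed
  hence "eventually (\<lambda>y. C * exp (- d * y) < v) at_top" using v by (rule order_tendstoD)
  then obtain Y1 where Y1: "\<And>y. y \<ge> Y1 \<Longrightarrow> C * exp (- d * y) < v" by (auto simp: eventually_at_top_linorder)
  define Y2 where "Y2 = max 1 (max Y Y1)"
  have small: "norm (F z) < v" if "Im z \<ge> Y2" for z
    using CY(3)[of z] Y1[of "Im z"] that by (simp add: Y2_def)
  define S where "S = cbox (Complex (-1/2) (1/2)) (Complex (1/2) Y2)"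
  have S: "S \<subseteq> uhp" by (auto simp: S_def in_cbox_complex_iff uhp_iff)
  have "Complex 0 1 \<in> S" by (auto simp: S_def in_cbox_complex_iff Y2_def)
  hence Sne: "S \<noteq> {}" by blast
  have "continuous_on S (\<lambda>z. norm (F z))"
    by (intro continuous_on_norm continuous_on_subset[OF holomorphic_on_imp_continuous_on[OF F] S])
  then obtain z2 where z2: "z2 \<in> S" "\<And>z. z \<in> S \<Longrightarrow> norm (F z) \<le> norm (F z2)"
  proof -
    have "compact S" by (simp add: S_def)
    from continuous_attains_sup[OF this Sne \<open>continuous_on S (\<lambda>z. norm (F z))\<close>] show ?thesis
      using that by blast
  qed
  have red: "\<exists>z'. norm (F z') = norm (F z) \<and> (z' \<in> S \<or> Im z' \<ge> Y2)" if z: "z \<in> uhp" for z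
  proof -
    obtain g where g: "mdet g = 1" "\<bar>Re (mact g z)\<bar> \<le> 1/2" "Im (mact g z) \<ge> 1/2"
      using fundamental_domain[OF z] by blast
    have "norm (F (mact g z)) = norm (F z)" using inv[OF g(1) z] by simp
    moreover have "mact g z \<in> S \<or> Im (mact g z) \<ge> Y2" using g by (auto simp: S_def in_cbox_complex_iff abs_le_iff)
    ultimately show ?thesis by blast
  qed
  have v2: "v \<le> norm (F z2)"
  proof -
    obtain z' where z': "norm (F z') = v" "z' \<in> S \<or> Im z' \<ge> Y2" using red[OF z1] by (auto simp: v_def)
    from z'(2) show ?thesis
    proof
      assume "z' \<in> S" thus ?thesis using z2(2)[of z'] z'(1) by simp
    next
      assume "Im z' \<ge> Y2" thus ?thesis using small[of z'] z'(1) by simp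
    qed
  qed
  have max: "norm (F z) \<le> norm (F z2)" if z: "z \<in> uhp" for z
  proof -
    obtain z' where z': "norm (F z') = norm (F z)" "z' \<in> S \<or> Im z' \<ge> Y2" using red[OF z] by blast
    from z'(2) show ?thesis
    proof
      assume "z' \<in> S" thus ?thesis using z2(2)[of z'] z'(1) by simp
    next
      assume "Im z' \<ge> Y2" thus ?thesis using small[of z'] z'(1) v2 by simp
    qed
  qed
  have "F constant_on uhp"
    by (rule maximum_modulus_principle[OF F open_uhp connected_uhp open_uhp order.refl _ max]) (use z2(1) S in blast)+
  then obtain c where c: "\<And>z. z \<in> uhp \<Longrightarrow> F z = c" by (auto simp: constant_on_def)
  have "Complex 0 Y2 \<in> uhp" by (simp add: uhp_iff Y2_def)
  hence "F (Complex 0 Y2) = F z1" using c[of "Complex 0 Y2"] c[OF z1] by simp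
  thus False using small[of "Complex 0 Y2"] by (simp add: v_def)
qed

context diagonal_character
begin

text \<open>
  Extended by \<open>0\<close> outside the upper half plane, so that equal functions there are equal as elements of a set.
\<close>

definition conjugate :: "nat \<Rightarrow> (complex \<Rightarrow> complex) \<Rightarrow> mat2 \<Rightarrow> complex \<Rightarrow> complex" where
  "conjugate w h g = (\<lambda>z. if z \<in> uhp then slash w g h z else 0)"

definition conjugates :: "nat \<Rightarrow> (complex \<Rightarrow> complex) \<Rightarrow> (complex \<Rightarrow> complex) set" where
  "conjugates w h = conjugate w h ` {g. mdet g = 1}"

lemma conjugate_cong_level:
  assumes h: "\<And>g z. g \<in> Gam \<Longrightarrow> z \<in> uhp \<Longrightarrow> slash w g h z = of_int (e (md g)) * h z" and g: "mdet g = 1" "mdet g' = 1"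
    and c: "ma g mod int N = ma g' mod int N" "mb g mod int N = mb g' mod int N"
      "mc g mod int N = mc g' mod int N" "md g mod int N = md g' mod int N"
  shows "conjugate w h g = conjugate w h g'"
proof
  fix z
  define t where "t = g' * adj g"
  have g't: "g' = t * g" using mult_adj(2)[OF g(1)] by (simp add: t_def mult.assoc)
  have dt: "mdet t = 1" using g by (simp add: t_def)
  have "int N dvd mb t" "int N dvd mc t" "int N dvd md t - 1"
  proof -
    have e: "[ma g = ma g'] (mod int N)" "[mb g = mb g'] (mod int N)" "[mc g = mc g'] (mod int N)" "[md g = md g'] (mod int N)"
      using c by (simp_all add: Cong.cong_def)
    have "[mb t = 0] (mod int N)"
    proof -
      have "[ma g' * - mb g + mb g' * ma g = ma g' * - mb g' + mb g' * ma g'] (mod int N)"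
        using e by (intro cong_add cong_mult cong_refl) (simp_all add: cong_minus_minus_iff)
      thus ?thesis by (simp add: t_def)
    qed
    moreover have "[mc t = 0] (mod int N)"
    proof -
      have "[mc g' * md g + md g' * - mc g = mc g' * md g' + md g' * - mc g'] (mod int N)"
        using e by (intro cong_add cong_mult cong_refl) (simp_all add: cong_minus_minus_iff)
      thus ?thesis by (simp add: t_def)
    qed
    moreover have "[md t = 1] (mod int N)"
    proof -
      have "[mc g' * - mb g + md g' * ma g = mc g' * - mb g' + md g' * ma g'] (mod int N)"
        using e by (intro cong_add cong_mult cong_refl) (simp_all add: cong_minus_minus_iff)
      also have "mc g' * - mb g' + md g' * ma g' = 1" using g(2) by (simp add: mdet_def algebra_simps)
      finally show ?thesis by (simp add: t_def)
    qed
    ultimately show "int N dvd mb t" "int N dvd mc t" "int N dvd md t - 1" by (simp_all add: cong_iff_dvd_diff)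
  qed
  hence t: "t \<in> Gam" "e (md t) = 1" using dt e_cong[of "md t" 1] e_one by (auto simp: Gam_def)
  show "conjugate w h g z = conjugate w h g' z"
  proof (cases "z \<in> uhp")
    case True
    have "slash w g' h z = slash w g (slash w t h) z" unfolding g't using dt g True by (intro slash_mult) auto
    also have "\<dots> = slash w g h z"
      by (rule slash_cong) (use h t g True in auto)
    finally show ?thesis using True by (simp add: conjugate_def)
  qed (simp add: conjugate_def)
qed

text \<open>
  The conjugate by \<open>g\<close> depends on \<open>g\<close> modulo \<open>N\<close> only.
\<close>

lemma card_conjugates:
  assumes h: "modular_form w lam h"
  shows "finite (conjugates w h)" "card (conjugates w h) \<le> N ^ 4"
proof -
  let ?R = "\<lambda>g. (ma g mod int N, mb g mod int N, mc g mod int N, md g mod int N)"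
  let ?B = "{0..<int N} \<times> {0..<int N} \<times> {0..<int N} \<times> {0..<int N}"
  have fin: "finite ?B" by simp
  have cB: "card ?B = N ^ 4" by (simp add: card_cartesian_product power_numeral_reduce)
  define pick where "pick = (\<lambda>r. conjugate w h (SOME g. mdet g = 1 \<and> ?R g = r))"
  have sub: "conjugates w h \<subseteq> pick ` ?B"
  proof
    fix \<phi> assume "\<phi> \<in> conjugates w h"
    then obtain g where g: "mdet g = 1" "\<phi> = conjugate w h g" by (auto simp: conjugates_def)
    have "\<exists>g'. mdet g' = 1 \<and> ?R g' = ?R g" using g by blast
    from someI_ex[OF this] have "mdet (SOME g'. mdet g' = 1 \<and> ?R g' = ?R g) = 1" "?R (SOME g'. mdet g' = 1 \<and> ?R g' = ?R g) = ?R g" by blast+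
    hence "pick (?R g) = conjugate w h g" unfolding pick_def using g by (intro conjugate_cong_level) (use h in \<open>auto simp: modular_form_def\<close>)
    moreover have "?R g \<in> ?B" using N_pos by simp
    ultimately show "\<phi> \<in> pick ` ?B" using g by (metis (no_types, lifting) imageI)
  qed
  show "finite (conjugates w h)" using sub fin finite_subset by blast
  have "card (conjugates w h) \<le> card (pick ` ?B)" using sub fin by (intro card_mono) auto
  also have "\<dots> \<le> card ?B" by (rule card_image_le[OF fin])
  finally show "card (conjugates w h) \<le> N ^ 4" using cB by simp
qed

lemma conjugates_slash:
  assumes g: "mdet g = 1"
  shows "bij_betw (\<lambda>\<phi>. conjugate w \<phi> g) (conjugates w h) (conjugates w h)"
proof -
  have cc: "conjugate w (conjugate w h g1) g2 = conjugate w h (g1 * g2)" if "mdet g1 = 1" "mdet g2 = 1" for g1 g2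
  proof
    fix z
    show "conjugate w (conjugate w h g1) g2 z = conjugate w h (g1 * g2) z"
    proof (cases "z \<in> uhp")
      case True
      have "slash w g2 (conjugate w h g1) z = slash w g2 (slash w g1 h) z"
        by (rule slash_cong) (use that True in \<open>auto simp: conjugate_def\<close>)
      also have "\<dots> = slash w (g1 * g2) h z" using that True by (intro slash_mult[symmetric]) auto
      finally show ?thesis using True by (simp add: conjugate_def)
    qed (simp add: conjugate_def)
  qed
  show ?thesis
  proof (rule bij_betwI[of _ _ _ "\<lambda>\<phi>. conjugate w \<phi> (adj g)"])
    show "(\<lambda>\<phi>. conjugate w \<phi> g) \<in> conjugates w h \<rightarrow> conjugates w h"
      using g cc by (auto simp: conjugates_def)
    show "(\<lambda>\<phi>. conjugate w \<phi> (adj g)) \<in> conjugates w h \<rightarrow> conjugates w h"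
      using g cc by (auto simp: conjugates_def)
    show "conjugate w (conjugate w \<phi> g) (adj g) = \<phi>" if "\<phi> \<in> conjugates w h" for \<phi>
      using that g mult_adj(1)[OF g] by (auto simp: conjugates_def cc mult.assoc)
    show "conjugate w (conjugate w \<phi> (adj g)) g = \<phi>" if "\<phi> \<in> conjugates w h" for \<phi>
      using that g mult_adj(2)[OF g] by (auto simp: conjugates_def cc mult.assoc)
  qed
qed

text \<open>
  The product of all distinct conjugates is a form for the full modular group of weight \<open>w n\<close>, where \<open>n \<le> N ^ 4\<close>. Its 12th power
  divided by \<open>Delta ^ (w n)\<close> has weight \<open>0\<close> and still vanishes at infinity if one factor vanishes to an order
  \<open>B > w n / 12\<close>. Then the product is zero, hence one conjugate, hence all of them.
\<close>

theorem modular_form_eq_0: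
  assumes h: "modular_form w 0 h" and dec: "decays (2 * pi * B) h" and B: "12 * B > real (w * N ^ 4)"
    and z: "z \<in> uhp"
  shows "h z = 0"
proof -
  define I where "I = conjugates w h"
  define n where "n = card I"
  have I: "finite I" and n: "n \<le> N ^ 4" unfolding I_def n_def using card_conjugates[OF h] by auto
  define P where "P = (\<lambda>z. \<Prod>\<phi>\<in>I. \<phi> z)"
  have holI: "\<phi> holomorphic_on uhp" if "\<phi> \<in> I" for \<phi>
  proof -
    obtain g where g: "mdet g = 1" "\<phi> = conjugate w h g" using \<open>\<phi> \<in> I\<close> by (auto simp: I_def conjugates_def)
    have "slash w g h holomorphic_on uhp" using h g by (intro holomorphic_slash) (auto simp: modular_form_def)
    thus ?thesis unfolding g(2) by (rule holomorphic_transform) (simp add: conjugate_def)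
  qed
  have holP: "P holomorphic_on uhp" unfolding P_def by (intro holomorphic_on_prod holI)
  have decI: "decays 0 \<phi>" if "\<phi> \<in> I" for \<phi>
  proof -
    obtain g where g: "mdet g = 1" "\<phi> = conjugate w h g" using \<open>\<phi> \<in> I\<close> by (auto simp: I_def conjugates_def)
    have "decays 0 (slash w g h)" using h g by (simp add: modular_form_def)
    thus ?thesis unfolding g(2) by (subst decays_cong[of _ "slash w g h"]) (auto simp: conjugate_def)
  qed
  define \<phi>1 where "\<phi>1 = conjugate w h 1"
  have \<phi>1: "\<phi>1 \<in> I" by (auto simp: \<phi>1_def I_def conjugates_def)
  have dec1: "decays (2 * pi * B) \<phi>1"
    using dec by (subst decays_cong[of _ h]) (auto simp: \<phi>1_def conjugate_def)
  have "decays (2 * pi * B + 0) (\<lambda>z. \<phi>1 z * (\<Prod>\<phi>\<in>I - {\<phi>1}. \<phi> z))"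
    using I by (intro decays_mult[OF dec1] decays_prod decI) blast+
  moreover have "P = (\<lambda>z. \<phi>1 z * (\<Prod>\<phi>\<in>I - {\<phi>1}. \<phi> z))"
    unfolding P_def by (rule ext) (rule prod.remove[OF I \<phi>1])
  ultimately have decP: "decays (2 * pi * B) P" by simp
  have Pinv: "P (mact g z) = mj g z ^ (w * n) * P z" if g: "mdet g = 1" and z: "z \<in> uhp" for g z
  proof -
    have mj: "mj g z \<noteq> 0" using mj_nonzero[of g z] g z by simp
    have "P z = (\<Prod>\<phi>\<in>I. conjugate w \<phi> g z)"
      unfolding P_def I_def by (rule prod.reindex_bij_betw[OF conjugates_slash[OF g], symmetric])
    also have "\<dots> = (\<Prod>\<phi>\<in>I. \<phi> (mact g z) / mj g z ^ w)" using z by (simp add: conjugate_def slash_def)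
    also have "\<dots> = P (mact g z) / mj g z ^ (w * n)"
      by (simp add: P_def prod_dividef n_def power_mult)
    finally show ?thesis using mj by simp
  qed
  define F where "F = (\<lambda>z. P z ^ 12 * inverse (Delta z) ^ (w * n))"
  have holF: "F holomorphic_on uhp" unfolding F_def
    by (intro holomorphic_intros holP holomorphic_Delta) auto
  have Finv: "F (mact g z) = F z" if g: "mdet g = 1" and z: "z \<in> uhp" for g z
  proof -
    have mj: "mj g z \<noteq> 0" using mj_nonzero[of g z] g z by simp
    have "F (mact g z) = (mj g z ^ (w * n) * P z) ^ 12 * inverse (mj g z ^ 12 * Delta z) ^ (w * n)"
      using Pinv[OF g z] Delta_modular[OF g z] by (simp add: F_def)
    also have "\<dots> = ((mj g z ^ 12) ^ (w * n) * inverse (mj g z ^ 12) ^ (w * n)) * F z"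
    proof -
      have "(mj g z ^ (w * n)) ^ 12 = (mj g z ^ 12) ^ (w * n)"
        by (simp only: power_mult[symmetric] mult.commute)
      thus ?thesis by (simp only: F_def power_mult_distrib inverse_mult_distrib mult_ac)
    qed
    also have "(mj g z ^ 12) ^ (w * n) * inverse (mj g z ^ 12) ^ (w * n) = 1"
      using mj by (simp only: power_mult_distrib[symmetric]) simp
    also have "1 * F z = F z" by simp
    finally show ?thesis .
  qed
  have dF: "decays (real 12 * (2 * pi * B) + real (w * n) * (- 2 * pi)) F"
    unfolding F_def by (intro decays_mult decays_power decP decays_inverse_Delta)
  have dpos: "real 12 * (2 * pi * B) + real (w * n) * (- 2 * pi) > 0"
  proof -
    have "real (w * n) \<le> real (w * N ^ 4)" using n by (simp only: of_nat_le_iff mult_le_mono2)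
    hence "12 * B - real (w * n) > 0" using B by linarith
    hence "2 * pi * (12 * B - real (w * n)) > 0" by simp
    thus ?thesis by (simp add: algebra_simps)
  qed
  have "F z = 0" if "z \<in> uhp" for z
    by (rule level_one_weight_zero_vanishes[OF holF Finv dF dpos that])
  hence P0: "P z = 0" if "z \<in> uhp" for z using that unfolding F_def by simp
  have "\<exists>\<phi>\<in>I. \<forall>z\<in>uhp. \<phi> z = 0"
    by (rule holomorphic_prod_eq_0[of I "\<lambda>\<phi>. \<phi>", OF I holI]) (use P0 in \<open>simp_all add: P_def\<close>)
  then obtain \<phi> where \<phi>: "\<phi> \<in> I" "\<forall>z\<in>uhp. \<phi> z = 0" by blast
  then obtain g where g: "mdet g = 1" "\<phi> = conjugate w h g" by (auto simp: I_def conjugates_def)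
  define z' where "z' = mact (adj g) z"
  have z': "z' \<in> uhp" unfolding z'_def using g z by (intro mact_uhp) auto
  have "mact g z' = z" unfolding z'_def using mact_mult[of g "adj g" z] g z mult_adj(1)[OF g(1)] by simp
  hence "h z / mj g z' ^ w = 0" using \<phi> g z' by (auto simp: conjugate_def slash_def)
  thus ?thesis using mj_nonzero[of g z'] g z' by simp
qed

end

section \<open>Expansions at infinity\<close>

definition qn :: "nat \<Rightarrow> complex \<Rightarrow> complex" where
  "qn N z = exp (2 * of_real pi * \<i> * z / of_nat N)"

lemma norm_qn: "norm (qn N z) = exp (- 2 * pi * Im z / real N)"
  by (simp add: qn_def norm_exp)
lemma qn_nonzero [simp]: "qn N z \<noteq> 0" by (simp add: qn_def)
lemma norm_qn_less: "N > 0 \<Longrightarrow> z \<in> uhp \<Longrightarrow> norm (qn N z) < 1" by (simp add: norm_qn uhp_iff)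

definition q_expansion :: "nat \<Rightarrow> (nat \<Rightarrow> int) \<Rightarrow> (complex \<Rightarrow> complex) \<Rightarrow> bool" where
  "q_expansion N a h \<longleftrightarrow> (\<forall>z\<in>uhp. (\<lambda>n. of_int (a n) * qn N z ^ n) sums h z)"

lemma qn_surj: assumes "N > 0" "w \<noteq> 0" "norm w < 1" shows "\<exists>z\<in>uhp. qn N z = w"
proof
  let ?z = "of_nat N / (2 * of_real pi * \<i>) * Ln w"
  show "qn N ?z = w" using assms by (simp add: qn_def)
  have "Im ?z = - (real N / (2 * pi)) * Re (Ln w)"
    using assms(1) by (simp add: Im_divide Re_divide power2_eq_square divide_simps)
  moreover have "ln (norm w) < 0" using assms by simp
  ultimately show "?z \<in> uhp" using assms unfolding uhp_iff
    by (simp only: Re_Ln) (simp add: mult_less_0_iff divide_less_0_iff zero_less_mult_iff)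
qed

text \<open>
  The tail of the series after the first \<open>B\<close> terms is compared with its value at a fixed point.
\<close>

lemma q_expansion_decays:
  assumes N: "N > 0" and q: "q_expansion N a h" and z0: "\<And>n. n < B \<Longrightarrow> a n = 0"
  shows "decays (2 * pi * (real B / real N)) h"
proof -
  define r where "r = qn N \<i>"
  have i: "\<i> \<in> uhp" by (simp add: uhp_iff)
  define s where "s = qn N (\<i> / 2)"
  have "\<i> / 2 \<in> uhp" by (simp add: uhp_iff)
  hence "summable (\<lambda>n. of_int (a n) * s ^ n)" using q by (auto simp: q_expansion_def s_def sums_iff)
  moreover have "norm r < norm s" using N by (simp add: r_def s_def norm_qn divide_strict_right_mono)
  ultimately have sr: "summable (\<lambda>n. norm (of_int (a n) * r ^ n))" by (rule powser_insidea)
  have r0: "norm r > 0" by (simp add: r_def)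
  define M where "M = (\<Sum>n. norm (of_int (a n) * r ^ n)) / norm r ^ B"
  show ?thesis
  proof (rule decaysI[of 1 _ M])
    fix z assume z: "1 \<le> Im z"
    hence zu: "z \<in> uhp" by (simp add: uhp_iff)
    define t where "t = norm (qn N z)"
    have t: "0 < t" "t \<le> norm r" using z N by (auto simp: t_def r_def norm_qn divide_right_mono)
    have le: "norm (of_int (a n) * qn N z ^ n) \<le> norm (of_int (a n) * r ^ n) / norm r ^ B * t ^ B" for n
    proof (cases "n < B")
      case False
      then obtain j where j: "n = B + j" using le_Suc_ex not_less by blast
      have "t ^ j \<le> norm r ^ j" using t by (intro power_mono) auto
      hence "\<bar>of_int (a n)\<bar> * (t ^ B * t ^ j) \<le> \<bar>of_int (a n)\<bar> * (t ^ B * norm r ^ j)"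
        using t by (intro mult_left_mono) auto
      thus ?thesis using r0 by (simp add: norm_mult norm_power j power_add t_def mult_ac)
    qed (simp add: z0)
    have sm: "summable (\<lambda>n. norm (of_int (a n) * r ^ n) / norm r ^ B * t ^ B)"
      by (intro summable_mult2 summable_divide sr)
    have sn: "summable (\<lambda>n. norm (of_int (a n) * qn N z ^ n))"
      by (rule summable_comparison_test'[OF sm, of 0]) (simp only: real_norm_def abs_norm_cancel le)
    have "h z = (\<Sum>n. of_int (a n) * qn N z ^ n)" using q zu by (simp add: q_expansion_def sums_iff)
    hence "norm (h z) \<le> (\<Sum>n. norm (of_int (a n) * qn N z ^ n))" using summable_norm[OF sn] by simp
    also have "\<dots> \<le> (\<Sum>n. norm (of_int (a n) * r ^ n) / norm r ^ B * t ^ B)" by (rule suminf_le[OF le sn sm])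
    also have "\<dots> = M * t ^ B"
      using suminf_mult2[OF summable_divide[OF sr, of "norm r ^ B"], of "t ^ B"] suminf_divide[OF sr, of "norm r ^ B"]
      by (simp add: M_def)
    also have "t ^ B = exp (- (2 * pi * (real B / real N)) * Im z)"
      by (simp add: t_def norm_qn exp_of_nat_mult[symmetric])
    finally show "norm (h z) \<le> M * exp (- (2 * pi * (real B / real N)) * Im z)" .
  qed simp
qed

lemma q_expansion_0_imp:
  assumes N: "N > 0" and q: "q_expansion N a h" and h: "\<And>z. z \<in> uhp \<Longrightarrow> h z = 0"
  shows "a n = 0"
proof -
  define A where "A = Abs_fps (\<lambda>n. of_int (a n) :: complex)"
  have s: "(\<lambda>n. fps_nth A n * w ^ n) sums 0" if "w \<noteq> 0" "norm w < 1" for w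
    using qn_surj[OF N that] q h by (auto simp: q_expansion_def A_def)
  have "conv_radius (fps_nth A) \<ge> 1"
    by (rule conv_radius_geI_ex') (use s in \<open>auto simp: sums_iff\<close>)
  hence rad: "fps_conv_radius A > 0" unfolding fps_conv_radius_def by (rule less_le_trans[rotated]) simp
  have c: "isCont (eval_fps A) 0"
    by (rule continuous_eval_fps) (use rad in \<open>auto intro: continuous_ident simp: zero_ereal_def[symmetric]\<close>)
  have ev: "eventually (\<lambda>w. eval_fps A w = 0) (at 0)"
  proof -
    have "eventually (\<lambda>w::complex. w \<in> ball 0 1) (at 0)" by (rule eventually_at_in_open') auto
    moreover have "eventually (\<lambda>w::complex. w \<noteq> 0) (at 0)" by (rule eventually_neq_at_within)
    ultimately show ?thesis by eventually_elim (use s in \<open>auto simp: eval_fps_def sums_iff\<close>)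
  qed
  have "eval_fps A 0 = 0"
  proof (rule tendsto_unique)
    show "(eval_fps A \<longlongrightarrow> eval_fps A 0) (at 0)" using c by (simp add: isCont_def)
    show "(eval_fps A \<longlongrightarrow> 0) (at 0)" by (rule tendsto_eventually[OF ev])
  qed auto
  with ev have "eventually (\<lambda>w. eval_fps A w = eval_fps 0 w) (nhds 0)"
    by (auto simp: eventually_at_filter elim!: eventually_mono)
  hence "A = 0" by (intro eval_fps_eqD rad) auto
  hence "fps_nth A n = 0" by simp
  thus ?thesis by (simp add: A_def)
qed

lemma sum_roots_of_unity:
  assumes "p > 0"
  shows "(\<Sum>j<p. exp (2 * of_real pi * \<i> * of_nat (j * n) / of_nat p)) = (if p dvd n then of_nat p else (0::complex))"
proof -
  define \<zeta> where "\<zeta> = exp (2 * of_real pi * \<i> * of_nat n / of_nat p)"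
  have pw: "exp (2 * of_real pi * \<i> * of_nat (j * n) / of_nat p) = \<zeta> ^ j" for j
    by (simp add: \<zeta>_def exp_of_nat_mult[symmetric] mult_ac)
  have one: "\<zeta> = 1 \<longleftrightarrow> p dvd n"
    using complex_root_unity_eq_1[of p n] assms by (simp add: \<zeta>_def mult_ac)
  have "\<zeta> ^ p = exp (2 * of_real pi * \<i> * of_nat n)"
    using assms by (simp add: \<zeta>_def exp_of_nat_mult[symmetric])
  also have "\<dots> = 1" using qq_add_int[of 0 "int n"] by (simp add: qq_def)
  finally have "\<zeta> ^ p = 1" .
  thus ?thesis unfolding pw using one by (auto simp: geometric_sum)
qed

text \<open>
  The roots of unity filter out the exponents divisible by \<open>p\<close>.
\<close>

lemma q_expansion_average:
  assumes N: "N > 0" and p: "p > 0" and q: "q_expansion N a h" and z: "z \<in> uhp"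
  shows "(\<lambda>n. of_int (a (p * n)) * qn N z ^ n) sums ((\<Sum>j<p. h ((z + of_nat (N * j)) / of_nat p)) / of_nat p)"
proof -
  define x where "x = qn N (z / of_nat p)"
  have up: "(z + of_nat (N * j)) / of_nat p \<in> uhp" for j
    using z p by (simp add: uhp_iff Im_divide_of_nat)
  have xq: "qn N ((z + of_nat (N * j)) / of_nat p) ^ n = x ^ n * exp (2 * of_real pi * \<i> * of_nat (j * n) / of_nat p)" for j n
  proof -
    have "qn N ((z + of_nat (N * j)) / of_nat p) = x * exp (2 * of_real pi * \<i> * of_nat j / of_nat p)"
      unfolding x_def qn_def exp_add[symmetric] using N p by (intro arg_cong[of _ _ exp]) (simp add: field_simps)
    moreover have "exp (2 * of_real pi * \<i> * of_nat j / of_nat p) ^ n = exp (2 * of_real pi * \<i> * of_nat (j * n) / of_nat p)"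
      by (simp add: exp_of_nat_mult[symmetric] mult_ac)
    ultimately show ?thesis by (simp add: power_mult_distrib)
  qed
  have xp: "x ^ p = qn N z"
    using p by (simp add: x_def qn_def exp_of_nat_mult[symmetric])
  have "(\<lambda>n. \<Sum>j<p. of_int (a n) * qn N ((z + of_nat (N * j)) / of_nat p) ^ n) sums (\<Sum>j<p. h ((z + of_nat (N * j)) / of_nat p))"
    using q up unfolding q_expansion_def by (intro sums_sum) blast
  also have "(\<lambda>n. \<Sum>j<p. of_int (a n) * qn N ((z + of_nat (N * j)) / of_nat p) ^ n) = (\<lambda>n. if p dvd n then of_nat p * of_int (a n) * x ^ n else 0)"
  proof
    fix n
    have "(\<Sum>j<p. of_int (a n) * qn N ((z + of_nat (N * j)) / of_nat p) ^ n) = of_int (a n) * x ^ n * (\<Sum>j<p. exp (2 * of_real pi * \<i> * of_nat (j * n) / of_nat p))"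
      unfolding xq sum_distrib_left by (simp add: mult_ac)
    thus "(\<Sum>j<p. of_int (a n) * qn N ((z + of_nat (N * j)) / of_nat p) ^ n) = (if p dvd n then of_nat p * of_int (a n) * x ^ n else 0)"
      unfolding sum_roots_of_unity[OF p] by simp
  qed
  finally have s: "(\<lambda>n. if p dvd n then of_nat p * of_int (a n) * x ^ n else 0) sums (\<Sum>j<p. h ((z + of_nat (N * j)) / of_nat p))" .
  have "strict_mono (\<lambda>n. p * n)" using p by (auto simp: strict_mono_def)
  moreover have "(if p dvd n then of_nat p * of_int (a n) * x ^ n else 0) = 0" if "n \<notin> range (\<lambda>n. p * n)" for n
    using that by (auto elim!: dvdE)
  ultimately have "(\<lambda>n. if p dvd p * n then of_nat p * of_int (a (p * n)) * x ^ (p * n) else 0) sums (\<Sum>j<p. h ((z + of_nat (N * j)) / of_nat p))"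
    using sums_mono_reindex[of "\<lambda>n. p * n" "\<lambda>n. if p dvd n then of_nat p * of_int (a n) * x ^ n else 0"] s by blast
  hence "(\<lambda>n. of_nat p * of_int (a (p * n)) * qn N z ^ n) sums (\<Sum>j<p. h ((z + of_nat (N * j)) / of_nat p))"
    by (simp add: power_mult xp)
  from sums_divide[OF this, of "of_nat p"] show ?thesis using p by (simp add: mult.assoc)
qed

context diagonal_character
begin

lemma hecke_explicit:
  assumes p: "prime p" and w: "w > 0"
  shows "hecke w p h z = of_int (e (int p) * int p ^ (w - 1)) * h (of_nat p * z) + (\<Sum>j<p. h ((z + of_nat (N * j)) / of_nat p)) / of_nat p"
proof -
  have p1: "p > 1" using prime_gt_1_nat[OF p] .
  let ?B = "\<lambda>j. Mat2 1 (int N * int j) 0 (int p)"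
  have inj: "inj_on ?B {..<p}" using N_pos by (auto intro!: inj_onI)
  have "(\<Sum>A\<in>reps p. hterm w h A z) = hterm w h (Mat2 (int p) 0 0 1) z + (\<Sum>A\<in>?B ` {..<p}. hterm w h A z)"
    unfolding reps_def using p1 by (subst sum.insert) auto
  also have "(\<Sum>A\<in>?B ` {..<p}. hterm w h A z) = (\<Sum>j<p. h ((z + of_nat (N * j)) / of_nat p)) / of_nat p ^ w"
    by (simp add: sum.reindex[OF inj] hterm_def slash_def mact_def mj_def e_one sum_divide_distrib)
  also have "hterm w h (Mat2 (int p) 0 0 1) z = of_int (e (int p)) * h (of_nat p * z)"
    by (simp add: hterm_def slash_def mact_def mj_def)
  finally have "hecke w p h z = of_nat p ^ (w - 1) * (of_int (e (int p)) * h (of_nat p * z)) +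
      of_nat p ^ (w - 1) * ((\<Sum>j<p. h ((z + of_nat (N * j)) / of_nat p)) / of_nat p ^ w)"
    by (simp only: hecke_def distrib_left)
  also have "of_nat p ^ (w - 1) * ((\<Sum>j<p. h ((z + of_nat (N * j)) / of_nat p)) / of_nat p ^ w) = (\<Sum>j<p. h ((z + of_nat (N * j)) / of_nat p)) / of_nat p"
    using w p1 by (cases w) (auto simp: field_simps)
  finally show ?thesis by (simp add: mult_ac)
qed

lemma hecke_q_expansion:
  assumes p: "prime p" and w: "w > 0" and q: "q_expansion N a h"
  shows "q_expansion N (\<lambda>n. a (p * n) + (if p dvd n then (e (int p) * int p ^ (w - 1)) * a (n div p) else 0)) (hecke w p h)"
  unfolding q_expansion_def
proof
  fix z assume z: "z \<in> uhp"
  have p0: "p > 0" using p by (simp add: prime_gt_0_nat)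
  have pz: "of_nat p * z \<in> uhp" by (rule uhp_scale[OF z p0])
  have qp: "qn N (of_nat p * z) = qn N z ^ p"
    by (simp add: qn_def exp_of_nat_mult[symmetric] mult_ac)
  have "(\<lambda>n. of_int (a n) * (qn N z ^ p) ^ n) sums h (of_nat p * z)"
    using q pz unfolding q_expansion_def by (simp flip: qp)
  from sums_stretch[OF p0 this]
  have "(\<lambda>n. of_int (e (int p) * int p ^ (w - 1)) * ((if p dvd n then of_int (a (n div p)) else 0) * qn N z ^ n)) sums
      (of_int (e (int p) * int p ^ (w - 1)) * h (of_nat p * z))" by (rule sums_mult)
  note sm = sums_add[OF q_expansion_average[OF N_pos p0 q z] this]
  have "of_int (a (p * n)) * qn N z ^ n + of_int (e (int p) * int p ^ (w - 1)) * ((if p dvd n then of_int (a (n div p)) else 0) * qn N z ^ n)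
      = of_int (a (p * n) + (if p dvd n then (e (int p) * int p ^ (w - 1)) * a (n div p) else 0)) * qn N z ^ n" for n
    by (cases "p dvd n") (simp_all add: distrib_right)
  note sm [unfolded this]
  moreover have "(\<Sum>j<p. h ((z + of_nat (N * j)) / of_nat p)) / of_nat p + of_int (e (int p) * int p ^ (w - 1)) * h (of_nat p * z) = hecke w p h z"
    by (subst hecke_explicit[OF p w]) (rule add.commute)
  ultimately show "(\<lambda>n. of_int (a (p * n) + (if p dvd n then (e (int p) * int p ^ (w - 1)) * a (n div p) else 0)) * qn N z ^ n) sums hecke w p h z"
    by (simp only:)
qed

end

section \<open>Integral sequences modulo a prime and the pigeonhole argument\<close>

lemma subgroup_multiple:
  fixes L :: "(nat \<Rightarrow> int) set"
  assumes ne: "L \<noteq> {}" and diff: "\<And>a b. a \<in> L \<Longrightarrow> b \<in> L \<Longrightarrow> (\<lambda>n. a n - b n) \<in> L" and a: "a \<in> L"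
  shows "(\<lambda>n. c * a n) \<in> L"
proof -
  have 0: "(\<lambda>_. 0) \<in> L" using diff[OF a a] by simp
  have neg: "(\<lambda>n. - b n) \<in> L" if "b \<in> L" for b using diff[OF 0 that] by simp
  have add: "(\<lambda>n. b n + b' n) \<in> L" if "b \<in> L" "b' \<in> L" for b b' using diff[OF that(1) neg[OF that(2)]] by simp
  show ?thesis
  proof (induction c rule: int_induct[where k = 0])
    case base show ?case using 0 by simp
  next
    case (step1 i) from add[OF step1(2) a] show ?case by (simp add: algebra_simps)
  next
    case (step2 i) from diff[OF step2(2) a] show ?case by (simp add: algebra_simps)
  qed
qed

text \<open>
  A group of integer sequences that are determined by their first \<open>B\<close> entries is a finitely generated free abelian group, so it
  is finite modulo \<open>m L\<close>. The induction splits off the last of these entries, whose values form an ideal of the integers, as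
  multiples of one sequence with the least positive value.
\<close>

lemma finite_mod_representatives:
  fixes L :: "(nat \<Rightarrow> int) set"
  assumes m: "m > 0"
    and ne: "L \<noteq> {}" and diff: "\<And>a b. a \<in> L \<Longrightarrow> b \<in> L \<Longrightarrow> (\<lambda>n. a n - b n) \<in> L"
    and det: "\<And>a. a \<in> L \<Longrightarrow> (\<forall>i<B. a i = 0) \<Longrightarrow> a = (\<lambda>_. 0)"
  shows "\<exists>S. finite S \<and> (\<forall>a\<in>L. \<exists>s\<in>S. \<forall>n. int m dvd a n - s n)"
  using ne diff det
proof (induction B arbitrary: L)
  case 0
  hence "a = (\<lambda>_. 0)" if "a \<in> L" for a using that by blast
  thus ?case by (intro exI[of _ "{\<lambda>_. 0}"]) auto
next
  case (Suc B L)
  note diff = Suc.prems(2)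
  have mult: "(\<lambda>n. c * a n) \<in> L" if "a \<in> L" for a c using subgroup_multiple[OF Suc.prems(1) diff that] .
  obtain a0 where a0: "a0 \<in> L" using Suc.prems(1) by blast
  have zero: "(\<lambda>_. 0) \<in> L" using diff[OF a0 a0] by simp
  define L0 where "L0 = {a\<in>L. a B = 0}"
  have "\<exists>S. finite S \<and> (\<forall>a\<in>L0. \<exists>s\<in>S. \<forall>n. int m dvd a n - s n)"
  proof (rule Suc.IH)
    show "L0 \<noteq> {}" using zero by (auto simp: L0_def)
    show "(\<lambda>n. a n - b n) \<in> L0" if "a \<in> L0" "b \<in> L0" for a b using that diff by (auto simp: L0_def)
    show "a = (\<lambda>_. 0)" if "a \<in> L0" "\<forall>i<B. a i = 0" for a
      by (rule Suc.prems(3)) (use that in \<open>auto simp: L0_def less_Suc_eq\<close>)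
  qed
  then obtain S where "finite S \<and> (\<forall>a\<in>L0. \<exists>s\<in>S. \<forall>n. int m dvd a n - s n)" by (elim exE)
  hence S: "finite S" "\<And>a. a \<in> L0 \<Longrightarrow> \<exists>s\<in>S. \<forall>n. int m dvd a n - s n" by simp_all
  show ?case
  proof (cases "L0 = L")
    case True
    thus ?thesis using S by blast
  next
    case False
    then obtain a1 where a1: "a1 \<in> L" "a1 B \<noteq> 0" by (auto simp: L0_def)
    define Q where "Q = (\<lambda>d. d > 0 \<and> (\<exists>a\<in>L. a B = int d))"
    have QI: "Q d" if "a \<in> L" "a B = int d" "d > 0" for a d
      unfolding Q_def by (rule conjI[OF that(3) bexI[of _ a]]) (use that in simp_all)
    have 1: "(\<lambda>n. sgn (a1 B) * a1 n) \<in> L" by (rule mult[OF a1(1)])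
    have 2: "sgn (a1 B) * a1 B = int (nat \<bar>a1 B\<bar>)" by (simp add: sgn_if abs_if)
    have "Q (nat \<bar>a1 B\<bar>)" by (rule QI[OF 1 2]) (use a1(2) in simp)
    hence Qd: "Q (LEAST d. Q d)" by (rule LeastI)
    define d where "d = (LEAST d. Q d)"
    have "d > 0 \<and> (\<exists>a\<in>L. a B = int d)" using Qd by (simp only: Q_def d_def)
    then obtain a2 where a2: "a2 \<in> L" "a2 B = int d" and d: "d > 0" by (elim conjE bexE)
    have dvd: "int d dvd a B" if "a \<in> L" for a
    proof (rule ccontr)
      assume "\<not> int d dvd a B"
      hence "a B mod int d \<noteq> 0" by (simp only: dvd_eq_mod_eq_0 not_False_eq_True)
      moreover have "a B mod int d \<ge> 0" using d by simp
      ultimately have r: "a B mod int d > 0" by linarith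
      have 1: "(\<lambda>n. a n - (a B div int d) * a2 n) \<in> L" by (rule diff[OF that mult[OF a2(1)]])
      have 2: "a B - (a B div int d) * a2 B = int (nat (a B mod int d))" using r unfolding a2(2) minus_div_mult_eq_mod by simp
      have "Q (nat (a B mod int d))" by (rule QI[OF 1 2]) (use r in simp)
      hence "d \<le> nat (a B mod int d)" unfolding d_def by (rule Least_le)
      moreover have "a B mod int d < int d" using d by simp
      ultimately show False using r by linarith
    qed
    define S' where "S' = (\<lambda>(j, s) n. int j * a2 n + s n) ` ({..<m} \<times> S)"
    show ?thesis
    proof (intro exI[of _ S'] conjI ballI)
      show "finite S'" using S(1) by (simp add: S'_def)
      fix a assume a: "a \<in> L"
      define t where "t = a B div int d"
      have tB: "a B = t * int d" using dvd[OF a] by (simp add: t_def)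
      have "(\<lambda>n. a n - t * a2 n) \<in> L" by (rule diff[OF a mult[OF a2(1)]])
      hence "(\<lambda>n. a n - t * a2 n) \<in> L0" using tB a2 by (simp add: L0_def)
      from S(2)[OF this] obtain s where "s \<in> S" "\<forall>n. int m dvd (a n - t * a2 n) - s n" by (elim bexE)
      hence s: "s \<in> S" "\<And>n. int m dvd (a n - t * a2 n) - s n" by simp_all
      define j where "j = nat (t mod int m)"
      have j: "j < m" "int j = t mod int m" using m by (auto simp: j_def nat_less_iff)
      have "int m dvd t - int j" unfolding j(2) by simp
      hence "int m dvd (t - int j) * a2 n + ((a n - t * a2 n) - s n)" for n using s(2)[of n] by (intro dvd_add dvd_mult2) 
      hence "int m dvd a n - (int j * a2 n + s n)" for n by (simp add: algebra_simps)
      thus "\<exists>s\<in>S'. \<forall>n. int m dvd a n - s n"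
        by (intro bexI[of _ "\<lambda>n. int j * a2 n + s n"] allI) (use j(1) s(1) in \<open>auto simp: S'_def intro!: image_eqI[of _ _ "(j, s)"]\<close>)
    qed
  qed
qed

definition hecke_seq :: "nat \<Rightarrow> int \<Rightarrow> (nat \<Rightarrow> int) \<Rightarrow> nat \<Rightarrow> int" where
  "hecke_seq l c a n = a (l * n) + (if l dvd n then c * a (n div l) else 0)"

text \<open>
  These are the analogues of the Hecke operators at powers of \<open>l\<close>.
\<close>

fun hecke_iter :: "nat \<Rightarrow> int \<Rightarrow> (nat \<Rightarrow> int) \<Rightarrow> nat \<Rightarrow> nat \<Rightarrow> int" where
  "hecke_iter l c a 0 = (\<lambda>_. 0)"
| "hecke_iter l c a (Suc 0) = a"
| "hecke_iter l c a (Suc (Suc k)) = (\<lambda>n. hecke_seq l c (hecke_iter l c a (Suc k)) n - c * hecke_iter l c a k n)"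

text \<open>
  On multiples of powers of \<open>l\<close> the iterated operator produces the values of \<open>a\<close> at higher powers, up to a term of the
  previous iterate. For \<open>j = 0\<close> that term disappears, and the value of the iterate is \<open>a (l ^ k n)\<close>.
\<close>

lemma hecke_iter_value:
  assumes l: "l > 1" and n: "\<not> l dvd n"
  shows "hecke_iter l c a (Suc k) (l ^ j * n) - c * (if j = 0 then 0 else hecke_iter l c a k (l ^ (j - 1) * n)) = a (l ^ (k + j) * n)"
proof (induction k arbitrary: j)
  case (Suc k)
  have "hecke_iter l c a (Suc (Suc k)) (l ^ j * n) =
     hecke_iter l c a (Suc k) (l ^ Suc j * n) + (if j = 0 then 0 else c * hecke_iter l c a (Suc k) (l ^ (j - 1) * n)) - c * hecke_iter l c a k (l ^ j * n)"
  proof (cases j)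
    case 0
    thus ?thesis using n by (simp add: hecke_seq_def)
  next
    case (Suc j')
    have 1: "l * (l ^ j * n) = l ^ Suc j * n" and 2: "l ^ j * n div l = l ^ (j - 1) * n" and 3: "l dvd l ^ j * n"
      using l by (simp_all add: Suc mult.assoc)
    show ?thesis using Suc by (simp only: hecke_iter.simps hecke_seq_def 1 2 3 if_True) (use l in \<open>simp add: mult.assoc\<close>)
  qed
  thus ?case using Suc[of "Suc j"] by (cases j) simp_all
qed simp

text \<open>
  Modulo \<open>m\<close> there are finitely many states \<open>(W (k + 1), W k)\<close>, and as \<open>c\<close> is invertible the recursion can be run
  backwards. So the sequence of states is purely periodic and returns to the initial state, where \<open>W 0 = 0\<close>. At the corresponding
  index all values of \<open>a\<close> at \<open>l ^ k n\<close> vanish modulo \<open>m\<close>.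
\<close>

lemma hecke_pigeonhole:
  fixes L :: "(nat \<Rightarrow> int) set"
  assumes m: "prime m" and c: "\<not> int m dvd c" and l: "l > 1"
    and ne: "L \<noteq> {}" and diff: "\<And>a b. a \<in> L \<Longrightarrow> b \<in> L \<Longrightarrow> (\<lambda>n. a n - b n) \<in> L"
    and det: "\<And>a. a \<in> L \<Longrightarrow> (\<forall>i<B. a i = 0) \<Longrightarrow> a = (\<lambda>_. 0)"
    and hecke: "\<And>a. a \<in> L \<Longrightarrow> hecke_seq l c a \<in> L" and a: "a \<in> L"
  shows "\<exists>k. \<forall>n. \<not> l dvd n \<longrightarrow> int m dvd a (l ^ k * n)"
proof -
  have m0: "m > 0" using m by (simp add: prime_gt_0_nat)
  define W where "W = hecke_iter l c a"
  have W0: "W 0 = (\<lambda>_. 0)" by (simp add: W_def)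
  have WS: "W (Suc (Suc k)) n = hecke_seq l c (W (Suc k)) n - c * W k n" for k n by (simp add: W_def)
  have WL: "W k \<in> L \<and> W (Suc k) \<in> L" for k
  proof (induction k)
    case 0
    have "(\<lambda>_. 0) \<in> L" using diff[OF a a] by simp
    thus ?case using a by (simp add: W_def)
  next
    case (Suc k)
    have "(\<lambda>n. hecke_seq l c (W (Suc k)) n - c * W k n) \<in> L"
      by (rule diff[OF hecke subgroup_multiple[OF ne diff]]) (use Suc in blast)+
    thus ?case using Suc by (simp add: W_def)
  qed
  define red where "red = (\<lambda>(a :: nat \<Rightarrow> int) n. a n mod int m)"
  obtain S where "finite S \<and> (\<forall>a\<in>L. \<exists>s\<in>S. \<forall>n. int m dvd a n - s n)"
    by (rule exE[OF finite_mod_representatives[OF m0 ne diff det]])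
  hence S: "finite S" "\<And>a. a \<in> L \<Longrightarrow> \<exists>s\<in>S. \<forall>n. int m dvd a n - s n" by simp_all
  have "red ` L \<subseteq> red ` S"
  proof safe
    fix a assume "a \<in> L"
    from S(2)[OF this] obtain s where "s \<in> S" "\<forall>n. int m dvd a n - s n" by (elim bexE)
    hence s: "s \<in> S" "\<And>n. int m dvd a n - s n" by simp_all
    have "red a = red s" unfolding red_def by (rule ext) (simp only: mod_eq_dvd_iff s(2))
    thus "red a \<in> red ` S" using s(1) by (rule image_eqI)
  qed
  hence fin: "finite (red ` L)" using S(1) finite_subset by blast
  define P where "P = (\<lambda>k. (red (W (Suc k)), red (W k)))"
  have "range P \<subseteq> red ` L \<times> red ` L" using WL by (auto simp: P_def)
  hence "finite (range P)" using fin finite_subset by blast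
  hence "\<not> inj P" using range_inj_infinite by metis
  then obtain i' j' where "i' \<noteq> j'" "P i' = P j'" by (auto simp: inj_def)
  hence "i' < j' \<and> P i' = P j' \<or> j' < i' \<and> P j' = P i'" by auto
  then obtain i j where ij: "i < j" "P i = P j" by (elim disjE) blast+
  have redD: "red x = red y \<longleftrightarrow> (\<forall>n. int m dvd x n - y n)" for x y
    by (auto simp: red_def fun_eq_iff mod_eq_dvd_iff)
  have cancel: "P i' = P j'" if "P (Suc i') = P (Suc j')" for i' j'
  proof -
    have 1: "int m dvd W (Suc i') n - W (Suc j') n" and 2: "int m dvd W (Suc (Suc i')) n - W (Suc (Suc j')) n" for n
      using that unfolding P_def prod.inject redD by (iprover+)
    have "int m dvd W i' n - W j' n" for n
    proof -
      have "int m dvd hecke_seq l c (W (Suc i')) n - hecke_seq l c (W (Suc j')) n"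
      proof -
        have "hecke_seq l c (W (Suc i')) n - hecke_seq l c (W (Suc j')) n =
          (W (Suc i') (l * n) - W (Suc j') (l * n)) + (if l dvd n then c * (W (Suc i') (n div l) - W (Suc j') (n div l)) else 0)"
          by (simp add: hecke_seq_def algebra_simps)
        also have "int m dvd \<dots>" using 1 by (intro dvd_add) (auto intro: dvd_mult)
        finally show ?thesis .
      qed
      from dvd_diff[OF this 2[of n]] have "int m dvd c * (W i' n - W j' n)" unfolding WS by (simp add: algebra_simps)
      thus ?thesis using m c by (simp add: prime_dvd_mult_iff)
    qed
    thus ?thesis using 1 unfolding P_def prod.inject redD by iprover
  qed
  have "P (i - r) = P (j - r)" if "r \<le> i" for r
    using that
  proof (induction r)
    case (Suc r)
    have e: "Suc (i - Suc r) = i - r" "Suc (j - Suc r) = j - r" using Suc.prems ij by auto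
    show ?case by (rule cancel) (use Suc e in simp)
  qed (use ij in simp)
  from this[of i] have "P 0 = P (j - i)" by simp
  hence "red (W (j - i)) = red (\<lambda>_. 0)" by (simp add: P_def W0)
  hence z: "int m dvd W (j - i) n" for n by (auto simp: redD)
  define k where "k = j - i - 1"
  have k: "j - i = Suc k" using ij by (simp add: k_def)
  show ?thesis
  proof (intro exI[of _ k] allI impI)
    fix n assume n: "\<not> l dvd n"
    have "W (Suc k) n = a (l ^ k * n)" using hecke_iter_value[OF l n, of c a k 0] by (simp add: W_def)
    thus "int m dvd a (l ^ k * n)" using z[of n] k by simp
  qed
qed

section \<open>Products of expansions\<close>

lemma q_expansion_abs_summable:
  assumes N: "N > 0" and q: "q_expansion N a h" and z: "z \<in> uhp"
  shows "summable (\<lambda>n. norm (of_int (a n) * qn N z ^ n))"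
proof (rule powser_insidea)
  have "z / 2 \<in> uhp" using z by (simp add: uhp_iff)
  thus "summable (\<lambda>n. of_int (a n) * qn N (z / 2) ^ n)" using q unfolding q_expansion_def sums_iff by blast
  show "norm (qn N z) < norm (qn N (z / 2))"
    unfolding norm_qn using z N by (simp add: uhp_iff divide_strict_right_mono)
qed

lemma q_expansion_mult:
  assumes N: "N > 0" and A: "q_expansion N (fps_nth A) g" and B: "q_expansion N (fps_nth B) h"
  shows "q_expansion N (fps_nth (A * B)) (\<lambda>z. g z * h z)"
  unfolding q_expansion_def
proof
  fix z assume z: "z \<in> uhp"
  have sA: "(\<Sum>n. of_int (fps_nth A n) * qn N z ^ n) = g z" and sB: "(\<Sum>n. of_int (fps_nth B n) * qn N z ^ n) = h z"
    using A B z unfolding q_expansion_def sums_iff by blast+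
  have "(\<lambda>n. \<Sum>i\<le>n. of_int (fps_nth A i) * qn N z ^ i * (of_int (fps_nth B (n - i)) * qn N z ^ (n - i))) sums (g z * h z)"
    using Cauchy_product_sums[OF q_expansion_abs_summable[OF N A z] q_expansion_abs_summable[OF N B z]]
    unfolding sA sB .
  moreover have "(\<Sum>i\<le>n. of_int (fps_nth A i) * qn N z ^ i * (of_int (fps_nth B (n - i)) * qn N z ^ (n - i))) = of_int (fps_nth (A * B) n) * qn N z ^ n" for n
  proof -
    have "of_int (fps_nth (A * B) n) * qn N z ^ n = (\<Sum>i\<le>n. of_int (fps_nth A i) * of_int (fps_nth B (n - i)) * qn N z ^ n)"
      by (simp add: fps_mult_nth atLeast0AtMost sum_distrib_right)
    also have "\<dots> = (\<Sum>i\<le>n. of_int (fps_nth A i) * qn N z ^ i * (of_int (fps_nth B (n - i)) * qn N z ^ (n - i)))"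
    proof (rule sum.cong[OF refl])
      fix i assume "i \<in> {..n}"
      hence "qn N z ^ n = qn N z ^ i * qn N z ^ (n - i)" by (simp flip: power_add)
      thus "of_int (fps_nth A i) * of_int (fps_nth B (n - i)) * qn N z ^ n = of_int (fps_nth A i) * qn N z ^ i * (of_int (fps_nth B (n - i)) * qn N z ^ (n - i))"
        by simp
    qed
    finally show ?thesis by simp
  qed
  ultimately show "(\<lambda>n. of_int (fps_nth (A * B) n) * qn N z ^ n) sums (g z * h z)" by simp
qed

lemma q_expansion_X_power: "q_expansion N (fps_nth (fps_X ^ j)) (\<lambda>z. qn N z ^ j)"
  unfolding q_expansion_def
proof
  fix z
  have "(\<lambda>n. if n = j then qn N z ^ n else 0) sums qn N z ^ j" by (rule sums_single)
  also have "(\<lambda>n. if n = j then qn N z ^ n else 0) = (\<lambda>n. of_int (fps_nth (fps_X ^ j) n) * qn N z ^ n)"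
    by (rule ext) (simp add: fps_X_power_nth)
  finally show "(\<lambda>n. of_int (fps_nth (fps_X ^ j) n) * qn N z ^ n) sums qn N z ^ j" .
qed

lemma q_expansion_power:
  assumes N: "N > 0" and A: "q_expansion N (fps_nth A) g"
  shows "q_expansion N (fps_nth (A ^ n)) (\<lambda>z. g z ^ n)"
proof (induction n)
  case 0
  show ?case using q_expansion_X_power[of N 0] by (simp only: power_0)
next
  case (Suc n)
  show ?case using q_expansion_mult[OF N A Suc] by simp
qed

lemma qn_power_level: "N > 0 \<Longrightarrow> qn N z ^ N = qq z"
  by (simp add: qn_def qq_def exp_of_nat_mult[symmetric])

lemma q_expansion_stretch:
  assumes N: "N > 0" and A: "int_expansion A g"
  shows "q_expansion N (fps_nth (stretch N A)) (\<lambda>z. g (qq z))"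
  unfolding q_expansion_def
proof
  fix z assume "z \<in> uhp"
  from int_expansion_sums[OF int_expansion_stretch[OF A N] norm_qn_less[OF N this]]
  show "(\<lambda>n. of_int (fps_nth (stretch N A) n) * qn N z ^ n) sums g (qq z)"
    by (simp only: qn_power_level[OF N])
qed

lemma q_expansion_diff:
  assumes "q_expansion N a g" "q_expansion N b h"
  shows "q_expansion N (\<lambda>n. a n - b n) (\<lambda>z. g z - h z)"
  using assms unfolding q_expansion_def by (auto simp: left_diff_distrib intro: sums_diff)

section \<open>Taking every m-th coefficient\<close>

definition decimate :: "nat \<Rightarrow> int fps \<Rightarrow> int fps" where
  "decimate m A = Abs_fps (\<lambda>n. fps_nth A (m * n))"

lemma fps_mult_stretch_nth:
  assumes m: "m > 0"
  shows "fps_nth (A * stretch m B) n = (\<Sum>i\<le>n div m. fps_nth A (n - m * i) * fps_nth B i)"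
proof -
  have "fps_nth (A * stretch m B) n = fps_nth (stretch m B * A) n" by (simp add: mult.commute)
  also have "\<dots> = (\<Sum>j\<le>n. fps_nth (stretch m B) j * fps_nth A (n - j))"
    by (simp add: fps_mult_nth atLeast0AtMost)
  also have "\<dots> = (\<Sum>j\<in>(\<lambda>i. m * i) ` {..n div m}. fps_nth (stretch m B) j * fps_nth A (n - j))"
  proof (rule sum.mono_neutral_right)
    show "(\<lambda>i. m * i) ` {..n div m} \<subseteq> {..n}"
      using m by (auto simp: less_eq_div_iff_mult_less_eq mult.commute)
    show "\<forall>j\<in>{..n} - (\<lambda>i. m * i) ` {..n div m}. fps_nth (stretch m B) j * fps_nth A (n - j) = 0"
    proof
      fix j assume j: "j \<in> {..n} - (\<lambda>i. m * i) ` {..n div m}"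
      have "\<not> m dvd j"
      proof
        assume "m dvd j"
        then obtain i where i: "j = m * i" by (elim dvdE)
        hence "i \<le> n div m" using j m by (simp add: less_eq_div_iff_mult_less_eq mult.commute)
        thus False using j i by auto
      qed
      thus "fps_nth (stretch m B) j * fps_nth A (n - j) = 0" by (simp add: stretch_nth)
    qed
  qed simp
  also have "\<dots> = (\<Sum>i\<le>n div m. fps_nth (stretch m B) (m * i) * fps_nth A (n - m * i))"
    using m by (subst sum.reindex) (auto simp: inj_on_def)
  finally show ?thesis using m by (simp add: stretch_nth mult.commute)
qed

text \<open>
  The operator is linear over series in \<open>x ^ m\<close>.
\<close>

lemma decimate_mult_stretch:
  assumes m: "m > 0"
  shows "decimate m (A * stretch m B) = decimate m A * B"
proof (rule fps_ext)
  fix n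
  have "fps_nth (decimate m (A * stretch m B)) n = (\<Sum>i\<le>n. fps_nth A (m * (n - i)) * fps_nth B i)"
    using m by (simp add: decimate_def fps_mult_stretch_nth[OF m] right_diff_distrib')
  also have "\<dots> = fps_nth (B * decimate m A) n"
    by (simp add: fps_mult_nth atLeast0AtMost decimate_def mult.commute)
  finally show "fps_nth (decimate m (A * stretch m B)) n = fps_nth (decimate m A * B) n"
    by (simp only: mult.commute)
qed

lemma stretch_mult:
  assumes m: "m > 0"
  shows "stretch m (A * B) = stretch m A * stretch m B"
proof (rule fps_ext)
  fix n
  show "fps_nth (stretch m (A * B)) n = fps_nth (stretch m A * stretch m B) n"
  proof (cases "m dvd n")
    case True
    then obtain k where k: "n = m * k" by (elim dvdE)
    have "fps_nth (stretch m A * stretch m B) n = (\<Sum>i\<le>k. fps_nth A (k - i) * fps_nth B i)"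
      using m unfolding fps_mult_stretch_nth[OF m] k by (simp add: stretch_nth right_diff_distrib'[symmetric])
    also have "\<dots> = fps_nth (B * A) k"
      unfolding fps_mult_nth atLeast0AtMost by (rule sum.cong[OF refl mult.commute])
    also have "B * A = A * B" by (rule mult.commute)
    finally show ?thesis using m by (simp add: stretch_nth k)
  next
    case False
    have "fps_nth (stretch m A) (n - m * i) = 0" if "i \<le> n div m" for i
    proof -
      have "m * i \<le> n" using that m by (simp add: less_eq_div_iff_mult_less_eq mult.commute)
      hence n: "(n - m * i) + m * i = n" by simp
      have "\<not> m dvd n - m * i"
      proof
        assume "m dvd n - m * i"
        hence "m dvd (n - m * i) + m * i" by (rule dvd_add) simp
        thus False using False n by simp
      qed
      thus ?thesis by (simp add: stretch_nth)
    qed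
    hence "fps_nth (stretch m A * stretch m B) n = 0"
      unfolding fps_mult_stretch_nth[OF m] by (intro sum.neutral ballI) simp
    thus ?thesis using False by (simp add: stretch_nth)
  qed
qed

lemma stretch_1: "m > 0 \<Longrightarrow> stretch m 1 = 1"
  by (rule fps_ext) (auto simp: stretch_nth elim!: dvdE)

context diagonal_character
begin

lemma modular_form_diff:
  assumes f: "modular_form w lam f" and g: "modular_form w lam g"
  shows "modular_form w lam (\<lambda>z. f z - g z)"
proof -
  have sl: "slash w A (\<lambda>z. f z - g z) z = slash w A f z - slash w A g z" for A z
    by (simp add: slash_def diff_divide_distrib)
  have "decays lam (slash w A (\<lambda>z. f z - g z))" if "mdet A = 1" for A
  proof -
    have "decays lam (\<lambda>z. slash w A f z + (- 1) * slash w A g z)"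
      using f g that unfolding modular_form_def by (intro decays_add decays_cmult) blast+
    moreover have "(\<lambda>z. slash w A f z + (- 1) * slash w A g z) = slash w A (\<lambda>z. f z - g z)"
      by (rule ext) (simp add: sl)
    ultimately show ?thesis by simp
  qed
  thus ?thesis using f g unfolding modular_form_def sl
    by (auto intro!: holomorphic_on_diff simp: right_diff_distrib)
qed

definition expansions :: "nat \<Rightarrow> (nat \<Rightarrow> int) set" where
  "expansions w = {a. \<exists>h. modular_form w 0 h \<and> q_expansion N a h}"

text \<open>
  The integral expansions of forms of weight \<open>w\<close> form a group stable under the Hecke operator at \<open>l\<close>, and finitely many coefficients
  determine a form. The pigeonhole argument therefore applies.
\<close>

theorem coefficients_vanish_mod_prime:
  assumes w: "w > 0" and m: "prime m" and l: "prime l" "coprime (int l) (int N)" "l \<noteq> m"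
    and h: "modular_form w 0 h" and q: "q_expansion N a h"
  shows "\<exists>k. \<forall>n. \<not> l dvd n \<longrightarrow> int m dvd a (l ^ k * n)"
proof (rule hecke_pigeonhole[where c = "e (int l) * int l ^ (w - 1)" and L = "expansions w" and B = "w * N ^ 5 + 1"])
  \<comment> \<open>the bound on the number of coefficients: a zero of order \<open>(w * N ^ 5 + 1) / N\<close> in \<open>q\<close> exceeds \<open>w * N ^ 4 / 12\<close>\<close>
  show "prime m" by fact
  show "l > 1" using prime_gt_1_nat[OF l(1)] .
  have "e (int l) * e (int l) = 1" by (rule e_square)
  hence "is_unit (e (int l))" by (metis dvd_triv_left)
  moreover have "\<not> int m dvd int l ^ (w - 1)"
  proof
    assume "int m dvd int l ^ (w - 1)"
    moreover have "prime (int m)" using m by simp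
    ultimately have "int m dvd int l" using prime_dvd_power by blast
    hence "m dvd l" by simp
    thus False using primes_dvd_imp_eq[OF m l(1)] l(3) by simp
  qed
  ultimately show "\<not> int m dvd e (int l) * int l ^ (w - 1)"
    by (simp add: dvd_mult_unit_iff')
  show "a \<in> expansions w" using h q unfolding expansions_def by blast
  thus "expansions w \<noteq> {}" by blast
  show "(\<lambda>n. a n - b n) \<in> expansions w" if "a \<in> expansions w" "b \<in> expansions w" for a b
    using that modular_form_diff q_expansion_diff unfolding expansions_def mem_Collect_eq by metis
  show "hecke_seq l (e (int l) * int l ^ (w - 1)) a \<in> expansions w" if a: "a \<in> expansions w" for a
  proof -
    obtain h where h: "modular_form w 0 h" "q_expansion N a h" using a unfolding expansions_def by blast
    have "modular_form w (0 / real l) (hecke w l h)" by (rule hecke_modular_form[OF h(1) _ l(1,2)]) simp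
    moreover have "q_expansion N (hecke_seq l (e (int l) * int l ^ (w - 1)) a) (hecke w l h)"
      using hecke_q_expansion[OF l(1) w h(2)] by (simp only: hecke_seq_def[abs_def])
    ultimately show ?thesis unfolding expansions_def by auto
  qed
  show "a = (\<lambda>_. 0)" if a: "a \<in> expansions w" "\<forall>i<w * N ^ 5 + 1. a i = 0" for a
  proof -
    obtain h where h: "modular_form w 0 h" "q_expansion N a h" using a(1) unfolding expansions_def by blast
    have d: "decays (2 * pi * (real (w * N ^ 5 + 1) / real N)) h"
      by (rule q_expansion_decays[OF N_pos h(2)]) (use a(2) in blast)
    have "h z = 0" if "z \<in> uhp" for z
    proof (rule modular_form_eq_0[OF h(1) d _ that])
      have "real (w * N ^ 4) = real (w * N ^ 5) / real N" using N_pos by (simp add: power_numeral_reduce)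
      also have "\<dots> < real (w * N ^ 5 + 1) / real N" using N_pos by (intro divide_strict_right_mono) auto
      also have "\<dots> \<le> 12 * (real (w * N ^ 5 + 1) / real N)"
      proof -
        have gen: "x \<le> 12 * x" if "0 \<le> x" for x :: real using that by simp
        show ?thesis by (rule gen) simp
      qed
      finally show "real (w * N ^ 4) < 12 * (real (w * N ^ 5 + 1) / real N)" .
    qed
    thus ?thesis using q_expansion_0_imp[OF N_pos h(2)] by blast
  qed
qed

end


context diagonal_character
begin

text \<open>
  Division by \<open>Delta\<close> may create a pole at a cusp, of order \<open>\<theta>\<close> in \<open>q ^ (1 / N)\<close>. If \<open>\<theta> < 1\<close> there is none, because
  every conjugate has period \<open>N\<close>.
\<close>

lemma divide_Delta_modular_form:
  assumes F: "modular_form (w + 12) lam F" and lam: "lam - 2 * pi = - 2 * pi * \<theta> / real N" and th: "\<theta> < 1"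
  shows "modular_form w 0 (\<lambda>z. F z / Delta z)"
proof -
  define H where "H = (\<lambda>z. F z / Delta z)"
  have sl: "slash w g H z = slash (w + 12) g F z * inverse (Delta z)" if "mdet g = 1" "z \<in> uhp" for g z
    using Delta_modular[OF that] by (simp add: slash_def H_def power_add divide_inverse mult_ac)
  have hol: "H holomorphic_on uhp"
    unfolding H_def using F holomorphic_Delta by (intro holomorphic_on_divide) (auto simp: modular_form_def)
  have inv: "slash w g H z = of_int (e (md g)) * H z" if "g \<in> Gam" "z \<in> uhp" for g z
  proof -
    have "mdet g = 1" using that by (simp add: Gam_def)
    thus ?thesis using sl[of g z] F that by (simp add: modular_form_def H_def divide_inverse)
  qed
  have dec: "decays 0 (slash w g H)" if g: "mdet g = 1" for g
  proof (rule periodic_growth_imp_bounded[OF N_pos _ _ _ th])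
    show "slash w g H holomorphic_on uhp" using hol g by (intro holomorphic_slash) auto
    have "decays (lam + - 2 * pi) (\<lambda>z. slash (w + 12) g F z * inverse (Delta z))"
      using F g by (intro decays_mult decays_inverse_Delta) (auto simp: modular_form_def)
    also have "?this \<longleftrightarrow> decays (lam + - 2 * pi) (slash w g H)"
      by (rule decays_cong) (use sl[OF g] in simp)
    finally show "decays (- 2 * pi * \<theta> / real N) (slash w g H)" using lam by simp
    fix z assume z: "z \<in> uhp"
    have zN: "z + of_nat N \<in> uhp" using z by (simp add: uhp_iff)
    have "conjugate w H (g * Tm (int N)) = conjugate w H g"
      by (rule conjugate_cong_level[OF inv]) (use g in \<open>auto simp: Tm_def\<close>)
    hence "conjugate w H (g * Tm (int N)) z = conjugate w H g z" by (rule fun_cong)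
    hence "slash w (g * Tm (int N)) H z = slash w g H z" using z by (simp add: conjugate_def)
    moreover have "slash w (g * Tm (int N)) H z = slash w (Tm (int N)) (slash w g H) z"
      using g z by (intro slash_mult) auto
    ultimately show "slash w g H (z + of_nat N) = slash w g H z" by (simp add: slash_def[of w "Tm _"])
  qed
  show ?thesis using hol inv dec unfolding modular_form_def H_def by blast
qed

end

lemma eps_diagonal_character:
  assumes "k \<in> {3, 5}"
  shows "diagonal_character (level k) (eps k)"
proof
  show "level k > 0" by (simp add: level_def)
  show "eps k 1 = 1" by (simp add: eps_def)
  show "eps k d * eps k d = 1" for d by (simp add: eps_def)
  show "eps k d = eps k d'" if "int (level k) dvd d - d'" for d d'
  proof (cases "k = 3")
    case True
    have "4 dvd d - d'" "3 dvd d - d'" using that True by (auto simp: level_def intro: dvd_trans[of _ "36"])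
    hence "d mod 4 = d' mod 4" "d mod 3 = d' mod 3" by (simp_all add: mod_eq_dvd_iff)
    thus ?thesis using True by (simp add: eps_def)
  next
    case False
    have "5 dvd d - d'" using that False by (auto simp: level_def intro: dvd_trans[of _ "30"])
    hence "d mod 5 = d' mod 5" by (simp add: mod_eq_dvd_iff)
    thus ?thesis using False by (simp add: eps_def)
  qed
  have nd: "\<not> p dvd d" if "coprime d (int (level k))" "p dvd int (level k)" "p > 1" for p d :: int
  proof
    assume "p dvd d"
    with that have "is_unit p" by (meson coprime_common_divisor)
    thus False using that(3) by simp
  qed
  show "eps k (d * d') = eps k d * eps k d'" if d: "coprime d (int (level k))" and d': "coprime d' (int (level k))" for d d'
  proof (cases "k = 3")
    case True
    have L: "(2::int) dvd int (level k)" "(3::int) dvd int (level k)" using True by (simp_all add: level_def)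
    have "d mod 4 = 1 \<or> d mod 4 = 3" "d' mod 4 = 1 \<or> d' mod 4 = 3"
      using nd[OF d L(1)] nd[OF d' L(1)] by presburger+
    moreover have "d mod 3 = 1 \<or> d mod 3 = 2" "d' mod 3 = 1 \<or> d' mod 3 = 2"
      using nd[OF d L(2)] nd[OF d' L(2)] by presburger+
    moreover have "(d * d') mod 4 = (d mod 4) * (d' mod 4) mod 4" "(d * d') mod 3 = (d mod 3) * (d' mod 3) mod 3"
      by (simp_all add: mod_mult_eq)
    ultimately show ?thesis unfolding eps_def using True by (elim disjE) simp_all
  next
    case False
    have L: "(5::int) dvd int (level k)" using False by (simp add: level_def)
    have "d mod 5 = 1 \<or> d mod 5 = 2 \<or> d mod 5 = 3 \<or> d mod 5 = 4" "d' mod 5 = 1 \<or> d' mod 5 = 2 \<or> d' mod 5 = 3 \<or> d' mod 5 = 4"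
      using nd[OF d L] nd[OF d' L] by presburger+
    moreover have "(d * d') mod 5 = (d mod 5) * (d' mod 5) mod 5" by (simp add: mod_mult_eq)
    ultimately show ?thesis unfolding eps_def using False by (elim disjE) simp_all
  qed
qed

section \<open>Arithmetic progressions of zeros\<close>

text \<open>
  The congruence \<open>M t = s\<close> modulo \<open>N\<close> and the condition \<open>t = 1\<close> modulo \<open>l\<close> are solved together by the Chinese remainder
  theorem.
\<close>

lemma progression_of_zeros:
  fixes b :: "nat \<Rightarrow> nat"
  assumes l: "l > 1" "coprime l N" and N: "N > 0" and M: "coprime M N" "M > 0"
    and z: "\<And>t n. \<not> l dvd t \<Longrightarrow> M * t = s + N * n \<Longrightarrow> m dvd b n"
  shows "\<exists>n0 D. D > 0 \<and> (\<forall>u. m dvd b (n0 + D * u))"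
proof -
  obtain x where x: "[M * x = Suc 0] (mod N)" using cong_solve_coprime_nat[OF M(1)] by blast
  obtain t0 where t0: "[t0 = x * s] (mod N)" "[t0 = 1] (mod l)"
    using binary_chinese_remainder_nat[of N l "x * s" 1] l(2) by (auto simp: coprime_commute)
  \<comment> \<open>shifted so that \<open>M t1 \<ge> s\<close>, which makes the index \<open>(M t1 - s) / N\<close> a natural number\<close>
  define t1 where "t1 = t0 + N * l * s"
  have "[M * t1 = M * (x * s)] (mod N)"
  proof (rule cong_mult[OF cong_refl])
    show "[t1 = x * s] (mod N)" using t0(1) by (simp add: t1_def Cong.cong_def mult.assoc)
  qed
  also have "[M * (x * s) = Suc 0 * s] (mod N)" using cong_mult[OF x cong_refl[of s]] by (simp only: mult.assoc)
  finally have c: "[M * t1 = s] (mod N)" by simp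
  have "1 \<le> M * (N * l)" using M(2) N l(1) by (simp add: Suc_le_eq)
  hence "1 * s \<le> M * (N * l) * s" by (rule mult_le_mono1)
  also have "\<dots> \<le> M * t1" by (simp add: t1_def algebra_simps)
  finally have ge: "s \<le> M * t1" by simp
  obtain n1 where n1: "M * t1 = s + N * n1" using ge c by (metis cong_le_nat mult.commute add.commute)
  have lt: "\<not> l dvd t1 + N * l * u" for u
  proof
    assume "l dvd t1 + N * l * u"
    hence "l dvd t0 + l * (N * s + N * u)" by (simp add: t1_def algebra_simps)
    hence "l dvd t0" by (metis dvd_add_left_iff dvd_triv_left)
    hence "[1 = 0] (mod l)" using t0(2) by (metis cong_0_iff cong_sym cong_trans)
    thus False using l(1) by (simp add: Cong.cong_def)
  qed
  show ?thesis
  proof (intro exI conjI allI)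
    show "M * l > 0" using M(2) l(1) by simp
    fix u
    have "M * (t1 + N * l * u) = s + N * (n1 + M * l * u)" using n1 by (simp add: algebra_simps)
    from z[OF lt this] show "m dvd b (n1 + M * l * u)" .
  qed
qed

lemma positive_density_of_progression:
  fixes Z :: "nat set"
  assumes D: "D > 0" and Z: "\<And>u. n0 + D * u \<in> Z"
  shows "infinite {n\<in>Z. 0 < n} \<and> (\<exists>c::real. 0 < c \<and> (\<forall>\<^sub>F X :: real in at_top. real (card {n. real n \<le> X \<and> n \<in> Z}) \<ge> c * X))"
proof
  have inj: "inj (\<lambda>u. n0 + D * Suc u)" using D by (auto simp: inj_def)
  have "(\<lambda>u. n0 + D * Suc u) ` UNIV \<subseteq> {n\<in>Z. 0 < n}" using Z[of "Suc _"] D by auto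
  thus "infinite {n\<in>Z. 0 < n}" using range_inj_infinite[OF inj] finite_subset by blast
  show "\<exists>c::real. 0 < c \<and> (\<forall>\<^sub>F X :: real in at_top. real (card {n. real n \<le> X \<and> n \<in> Z}) \<ge> c * X)"
  proof (intro exI conjI)
    show "0 < 1 / (2 * real D)" using D by simp
    show "\<forall>\<^sub>F X :: real in at_top. real (card {n. real n \<le> X \<and> n \<in> Z}) \<ge> 1 / (2 * real D) * X"
      using eventually_ge_at_top[of "2 * real n0"]
    proof eventually_elim
      case (elim X)
      define K where "K = nat \<lfloor>(X - real n0) / real D\<rfloor>"
      have X0: "(X - real n0) / real D \<ge> 0" using elim D by simp
      have fin: "finite {n. real n \<le> X \<and> n \<in> Z}"
        by (rule finite_subset[of _ "{..nat \<lfloor>X\<rfloor>}"]) (auto simp: le_nat_floor)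
      have sub: "(\<lambda>u. n0 + D * u) ` {..K} \<subseteq> {n. real n \<le> X \<and> n \<in> Z}"
      proof safe
        fix u assume "u \<le> K"
        hence "real u \<le> real K" by simp
        also have "real K \<le> (X - real n0) / real D" using X0 unfolding K_def by simp
        finally have "real D * real u \<le> X - real n0" using D by (simp add: field_simps)
        thus "real (n0 + D * u) \<le> X" by simp
      qed (use Z in auto)
      have "card {..K} = card ((\<lambda>u. n0 + D * u) ` {..K})" using D by (intro card_image[symmetric]) (auto simp: inj_on_def)
      also have "\<dots> \<le> card {n. real n \<le> X \<and> n \<in> Z}" by (rule card_mono[OF fin sub])
      finally have c: "real K + 1 \<le> real (card {n. real n \<le> X \<and> n \<in> Z})" by simp
      have "(X - real n0) / real D \<le> real K + 1" using X0 unfolding K_def by linarith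
      moreover have "1 / (2 * real D) * X \<le> (X - real n0) / real D" using elim D by (simp add: field_simps)
      ultimately show ?case using c by linarith
    qed
  qed
qed

section \<open>Expansions of the eta quotients\<close>

lemma b_reg_eq_parts: "b_reg k n = card (parts_in (\<lambda>i. \<not> k dvd i) n)"
  by (simp add: b_reg_def regular_partitions_def parts_in_def)

definition part_fps :: "int fps" where "part_fps = parts_fps (\<lambda>_. True)"
text \<open>
  The coefficients of Euler's product \<open>\<Prod>(1 - x ^ n)\<close>, obtained as inverse of the partition series; in this way they are
  integers by construction.
\<close>

definition euler_fps :: "int fps" where "euler_fps = fps_right_inverse part_fps 1"

lemma part_euler_inverse: "part_fps * euler_fps = 1"
  unfolding euler_fps_def by (rule fps_right_inverse) (simp add: part_fps_def parts_fps_def card_parts_0)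

definition euler_log :: "complex \<Rightarrow> complex" where "euler_log = eval_fps (logser (\<lambda>_. True))"

lemma part_expansion: "int_expansion part_fps (\<lambda>x. exp (euler_log x))"
  unfolding part_fps_def euler_log_def by (rule parts_expansion)

lemma euler_expansion: "int_expansion euler_fps (\<lambda>x. inverse (exp (euler_log x)))"
  by (rule int_expansion_inverse[OF part_expansion part_euler_inverse]) simp

lemma Delta_eq: "Delta z = qq z * inverse (exp (euler_log (qq z))) ^ 24"
proof -
  have "inverse (exp y) ^ 24 = exp (- 24 * y)" for y :: complex
  proof -
    have "exp (- 24 * y) = exp (of_nat 24 * (- y))" by simp
    also have "\<dots> = exp (- y) ^ 24" by (rule exp_of_nat_mult)
    finally show ?thesis by (simp only: exp_minus)
  qed
  thus ?thesis by (simp only: Delta_def euler_log_def)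
qed

definition eta_fps :: "nat \<Rightarrow> nat \<Rightarrow> int fps" where
  "eta_fps N r = stretch N (euler_fps ^ r)"

lemma Delta_q_expansion:
  assumes N: "N > 0"
  shows "q_expansion N (fps_nth (fps_X ^ N * eta_fps N 24)) Delta"
proof -
  have "q_expansion N (fps_nth (fps_X ^ N * eta_fps N 24)) (\<lambda>z. qn N z ^ N * inverse (exp (euler_log (qq z))) ^ 24)"
    unfolding eta_fps_def
    by (intro q_expansion_mult N q_expansion_X_power q_expansion_stretch[OF N, of _ "\<lambda>x. inverse (exp (euler_log x)) ^ 24"]
        int_expansion_power euler_expansion)
  thus ?thesis unfolding qn_power_level[OF N] Delta_eq[symmetric] .
qed

lemma reg_eta_q_expansion:
  assumes k: "k \<in> {3, 5}"
  shows "q_expansion (level k) (fps_nth (fps_X ^ k * stretch (level k) (parts_fps (\<lambda>i. \<not> k dvd i)))) (reg_eta k)"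
proof -
  have N: "level k > 0" by (simp add: level_def)
  have "qn (level k) z ^ k = exp (2 * of_real pi * \<i> * z * of_real ((real k - 1) / 24))" for z
    using k by (auto simp: qn_def exp_of_nat_mult[symmetric] level_def field_simps)
  hence "(\<lambda>z. qn (level k) z ^ k * exp (eval_fps (logser (\<lambda>i. \<not> k dvd i)) (qq z))) = reg_eta k"
    by (intro ext) (simp add: reg_eta_def)
  moreover have "q_expansion (level k) (fps_nth (fps_X ^ k * stretch (level k) (parts_fps (\<lambda>i. \<not> k dvd i))))
      (\<lambda>z. qn (level k) z ^ k * exp (eval_fps (logser (\<lambda>i. \<not> k dvd i)) (qq z)))"
    by (intro q_expansion_mult N q_expansion_X_power q_expansion_stretch[OF N, of _ "\<lambda>x. exp (eval_fps (logser (\<lambda>i. \<not> k dvd i)) x)"] parts_expansion)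
  ultimately show ?thesis by simp
qed

lemma reg_eta_decays:
  assumes k: "k \<in> {3, 5}" and g: "mdet g = 1"
  shows "decays (- 2 * pi / real (level k)) (\<lambda>z. reg_eta k (mact g z))"
proof -
  have k1: "k > 1" using k by auto
  obtain C where C: "\<forall>z. Im z \<ge> real k \<longrightarrow> norm (reg_eta k (mact g z)) \<le> C * exp (2 * pi * Im z * ((real k - 1) / (24 * real k)))"
    using reg_eta_growth[OF k1 g] by blast
  show ?thesis
  proof (rule decaysI[of "real k" _ C])
    fix z assume z: "Im z \<ge> real k"
    have "2 * pi * Im z * ((real k - 1) / (24 * real k)) = - (- 2 * pi / real (level k)) * Im z"
      using k by (auto simp: level_def)
    with C[rule_format, OF z] show "norm (reg_eta k (mact g z)) \<le> C * exp (- (- 2 * pi / real (level k)) * Im z)" by simp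
  qed (use k in auto)
qed

text \<open>
  The function \<open>f \<Delta> ^ m\<close> vanishes at every cusp to an order of at least \<open>m - 1 / N\<close> in \<open>q\<close>.
\<close>

lemma reg_eta_Delta_modular_form:
  assumes k: "k \<in> {3, 5}"
  shows "diagonal_character.modular_form (level k) (eps k) (12 * m) (2 * pi * (real m - 1 / real (level k))) (\<lambda>z. reg_eta k z * Delta z ^ m)"
proof -
  interpret diagonal_character "level k" "eps k" by (rule eps_diagonal_character[OF k])
  define G where "G = (\<lambda>z. reg_eta k z * Delta z ^ m)"
  have sl: "slash (12 * m) g G z = reg_eta k (mact g z) * Delta z ^ m" if "mdet g = 1" "z \<in> uhp" for g z
    using Delta_modular[OF that] mj_nonzero[of g z] that
    by (simp add: slash_def G_def power_mult_distrib power_mult)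
  have "G holomorphic_on uhp" unfolding G_def by (intro holomorphic_intros holomorphic_reg_eta holomorphic_Delta)
  moreover have "slash (12 * m) g G z = of_int (eps k (md g)) * G z" if g: "g \<in> Gam" and z: "z \<in> uhp" for g z
  proof -
    have d: "mdet g = 1" "int (level k) dvd mb g" "int (level k) dvd mc g" using g by (auto simp: Gam_def)
    have "int k dvd int (level k)" using k by (auto simp: level_def)
    hence "int k dvd mc g" using d(3) dvd_trans by blast
    hence "reg_eta k (mact g z) = of_int (eps k (md g)) * reg_eta k z"
      using reg_eta_chi[OF k d(1) _ z] chi_eps[OF k d] by simp
    thus ?thesis using sl[OF d(1) z] by (simp add: G_def)
  qed
  moreover have "decays (2 * pi * (real m - 1 / real (level k))) (slash (12 * m) g G)" if g: "mdet g = 1" for g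
  proof -
    have "decays (- 2 * pi / real (level k) + real m * (2 * pi)) (\<lambda>z. reg_eta k (mact g z) * Delta z ^ m)"
      by (intro decays_mult decays_power decays_Delta reg_eta_decays k g)
    also have "- 2 * pi / real (level k) + real m * (2 * pi) = 2 * pi * (real m - 1 / real (level k))"
      by (simp add: algebra_simps)
    finally show ?thesis by (subst decays_cong[OF sl[OF g]])
  qed
  ultimately show ?thesis unfolding modular_form_def G_def by blast
qed

lemma dvd_decimate: "of_nat m dvd A \<Longrightarrow> of_nat m dvd decimate d A"
  unfolding of_nat_dvd_fps_iff by (simp add: decimate_def)

lemma decimate_diff: "decimate d (A - B) = decimate d A - decimate d B"
  by (rule fps_ext) (simp add: decimate_def)

section \<open>Zeros modulo a prime not dividing the level\<close>

text \<open>
  The quotient \<open>H = T\<^sub>m (f \<Delta> ^ m) / \<Delta>\<close> is a holomorphic modular form of weight \<open>12 m - 12\<close>: the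
  Hecke operator divides the order of vanishing \<open>m - 1 / N\<close> by \<open>m\<close>, so that dividing by \<open>\<Delta>\<close> leaves a pole
  of order at most \<open>1 / (m N)\<close> in \<open>q\<close>, which is less than the smallest possible one. Modulo \<open>m\<close> the Hecke operator takes every
  \<open>m\<close>-th coefficient, and \<open>\<Delta> ^ m\<close> becomes \<open>\<Delta>(m z)\<close>, which this operation turns into \<open>\<Delta>\<close>. So the
  \<open>n\<close>-th coefficient of \<open>H\<close> is congruent to that of index \<open>m n\<close> of \<open>f\<close>, which is \<open>b_k((m n - k) / N)\<close>.
\<close>

theorem zeros_coprime_to_level:
  assumes k: "k \<in> {3, 5}" and m: "prime m" "coprime m (level k)"
  shows "\<exists>n0 D. D > 0 \<and> (\<forall>u. m dvd b_reg k (n0 + D * u))"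
proof -
  interpret diagonal_character "level k" "eps k" by (rule eps_diagonal_character[OF k])
  define N where "N = level k"
  have N: "N > 0" by (simp add: N_def level_def)
  have m0: "m > 0" using m by (simp add: prime_gt_0_nat)
  have m1: "m > 1" by (rule prime_gt_1_nat[OF m(1)])
  define G where "G = (\<lambda>z. reg_eta k z * Delta z ^ m)"
  define FX where "FX = fps_X ^ k * stretch N (parts_fps (\<lambda>i. \<not> k dvd i))"
  define SD where "SD = eta_fps N 24"
  define DX where "DX = fps_X ^ N * SD"
  define PX where "PX = stretch N (part_fps ^ 24)"
  define AG where "AG = FX * DX ^ m"
  have SP: "SD * PX = 1"
  proof -
    have "euler_fps ^ 24 * part_fps ^ 24 = 1"
      by (simp only: power_mult_distrib[symmetric] mult.commute[of euler_fps] part_euler_inverse power_one)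
    thus ?thesis unfolding SD_def PX_def eta_fps_def by (simp only: stretch_mult[OF N, symmetric] stretch_1[OF N])
  qed
  have AG: "q_expansion N (fps_nth AG) G"
    unfolding AG_def G_def FX_def DX_def SD_def
    using q_expansion_mult[OF N reg_eta_q_expansion[OF k, folded N_def] q_expansion_power[OF N Delta_q_expansion[OF N], of m]] .
  define c where "c = eps k (int m) * int m ^ (12 * m - 1)"
  define Tt where "Tt = Abs_fps (hecke_seq m c (fps_nth AG))"
  define TG where "TG = hecke (12 * m) m G"
  have Tn: "fps_nth Tt = hecke_seq m c (fps_nth AG)" by (rule ext) (simp add: Tt_def)
  have Tt: "q_expansion N (fps_nth Tt) TG"
    using hecke_q_expansion[OF m(1) _ AG[unfolded N_def], where w = "12 * m"] m0
    unfolding Tn TG_def c_def N_def hecke_seq_def[abs_def] by simp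
  have TGm: "modular_form (12 * m) (2 * pi * (real m - 1 / real N) / real m) TG"
    unfolding TG_def
  proof (rule hecke_modular_form[OF _ _ m(1)])
    show "modular_form (12 * m) (2 * pi * (real m - 1 / real N)) G"
      unfolding G_def N_def by (rule reg_eta_Delta_modular_form[OF k])
    have "1 / real N \<le> 1" "1 \<le> real m" using N m0 by auto
    thus "2 * pi * (real m - 1 / real N) \<ge> 0" by (intro mult_nonneg_nonneg) auto
    show "coprime (int m) (int (level k))" using m(2) by simp
  qed
  define w where "w = 12 * m - 12"
  have w12: "w + 12 = 12 * m" and w0: "w > 0" using m1 by (simp_all add: w_def)
  define H where "H = (\<lambda>z. TG z / Delta z)"
  have Hm: "modular_form w 0 H"
    unfolding H_def
  proof (rule divide_Delta_modular_form)
    show "modular_form (w + 12) (2 * pi * (real m - 1 / real N) / real m) TG" using TGm w12 by simp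
    show "2 * pi * (real m - 1 / real N) / real m - 2 * pi = - 2 * pi * (1 / real m) / real (level k)"
      using m0 N by (simp add: N_def[symmetric] field_simps)
    show "1 / real m < 1" using m1 by simp
  qed
  \<comment> \<open>the first \<open>N\<close> coefficients of \<open>T\<^sub>m (f \<Delta> ^ m)\<close> vanish, so division by \<open>\<Delta> = q \<dots>\<close> gives a power series\<close>
  have AGlow: "AG = fps_X ^ (N * m) * (FX * SD ^ m)"
    by (simp add: AG_def DX_def power_mult_distrib power_mult mult_ac)
  have AG0: "fps_nth AG j = 0" if "j < N * m" for j
    unfolding AGlow fps_X_power_mult_nth using that by simp
  have Tt0: "fps_nth Tt n = 0" if "n < N" for n
  proof -
    have "m * n < N * m" using that m0 by (simp add: mult.commute)
    moreover have "n div m < N * m"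
    proof -
      have "n div m \<le> n" by (rule div_le_dividend)
      also have "n < N" by (rule that)
      also have "N * 1 \<le> N * m" using m0 by (intro mult_le_mono2) simp
      finally show ?thesis by simp
    qed
    ultimately show ?thesis using AG0 by (simp add: Tt_def hecke_seq_def)
  qed
  define Sh where "Sh = fps_shift N Tt"
  have TtSh: "Tt = fps_X ^ N * Sh"
    by (rule fps_ext) (use Tt0 in \<open>auto simp: Sh_def fps_X_power_mult_nth\<close>)
  have Sh: "q_expansion N (fps_nth Sh) (\<lambda>z. TG z / qn N z ^ N)"
    unfolding q_expansion_def
  proof
    fix z assume z: "z \<in> uhp"
    have "(\<lambda>n. of_int (fps_nth Tt n) * qn N z ^ n) sums TG z" using Tt z by (simp add: q_expansion_def)
    hence "(\<lambda>n. of_int (fps_nth Tt (n + N)) * qn N z ^ (n + N)) sums (TG z - (\<Sum>i<N. of_int (fps_nth Tt i) * qn N z ^ i))"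
      by (rule sums_split_initial_segment)
    also have "(\<Sum>i<N. of_int (fps_nth Tt i) * qn N z ^ i) = 0" using Tt0 by (intro sum.neutral) auto
    finally have "(\<lambda>n. of_int (fps_nth Tt (n + N)) * qn N z ^ (n + N) / qn N z ^ N) sums ((TG z - 0) / qn N z ^ N)"
      by (rule sums_divide)
    thus "(\<lambda>n. of_int (fps_nth Sh n) * qn N z ^ n) sums (TG z / qn N z ^ N)"
      by (simp add: Sh_def power_add)
  qed
  define HH where "HH = Sh * PX"
  have "q_expansion N (fps_nth HH) (\<lambda>z. TG z / qn N z ^ N * exp (euler_log (qq z)) ^ 24)"
    unfolding HH_def PX_def
    by (intro q_expansion_mult N Sh q_expansion_stretch[OF N, of _ "\<lambda>x. exp (euler_log x) ^ 24"] int_expansion_power part_expansion)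
  moreover have "(\<lambda>z. TG z / qn N z ^ N * exp (euler_log (qq z)) ^ 24) = H"
    unfolding H_def Delta_eq qn_power_level[OF N] by (rule ext) (simp add: power_inverse divide_inverse mult_ac)
  ultimately have HH: "q_expansion N (fps_nth HH) H" by simp
  \<comment> \<open>modulo \<open>m\<close>: \<open>\<Delta> ^ m\<close> is a series in \<open>q ^ m\<close>, and \<open>T\<^sub>m\<close> takes every \<open>m\<close>-th coefficient, since its second term has the factor \<open>m ^ (12 m - 1)\<close>\<close>
  have "of_nat m dvd AG - FX * stretch m DX"
    unfolding AG_def right_diff_distrib[symmetric] by (rule dvd_mult[OF fps_power_prime_cong_stretch[OF m(1)]])
  from dvd_decimate[OF this, of m] have 1: "of_nat m dvd decimate m AG - decimate m FX * DX"
    unfolding decimate_diff decimate_mult_stretch[OF m0] .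
  have 2: "of_nat m dvd Tt - decimate m AG"
    unfolding of_nat_dvd_fps_iff
  proof
    fix n
    have "int m dvd c" using m1 unfolding c_def by (intro dvd_mult dvd_power) auto
    thus "int m dvd fps_nth (Tt - decimate m AG) n" by (simp add: Tt_def decimate_def hecke_seq_def)
  qed
  have "of_nat m dvd (Tt - decimate m AG) + (decimate m AG - decimate m FX * DX)" by (rule dvd_add[OF 2 1])
  also have "(Tt - decimate m AG) + (decimate m AG - decimate m FX * DX) = fps_X ^ N * (Sh - decimate m FX * SD)"
    unfolding TtSh DX_def by (simp add: algebra_simps)
  finally have 3: "int m dvd fps_nth (fps_X ^ N * (Sh - decimate m FX * SD)) n" for n
    unfolding of_nat_dvd_fps_iff by blast
  have 4: "of_nat m dvd Sh - decimate m FX * SD"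
    unfolding of_nat_dvd_fps_iff
  proof
    fix n
    show "int m dvd fps_nth (Sh - decimate m FX * SD) n" using 3[of "n + N"] by (simp add: fps_X_power_mult_nth)
  qed
  have "HH - decimate m FX = (Sh - decimate m FX * SD) * PX + decimate m FX * (SD * PX - 1)"
    by (simp add: HH_def algebra_simps)
  hence "of_nat m dvd HH - decimate m FX" using 4 SP by simp
  hence 5: "int m dvd fps_nth HH n - fps_nth FX (m * n)" for n
    unfolding of_nat_dvd_fps_iff by (simp add: decimate_def)
  \<comment> \<open>any prime different from \<open>m\<close> and prime to the level \<open>36\<close> or \<open>30\<close> would do\<close>
  define l where "l = (if m = 7 then 11 else 7 :: nat)"
  have "prime (7::nat)" "prime (11::nat)" by simp_all
  hence l: "prime l" "l \<noteq> m" by (auto simp: l_def)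
  have cop: "coprime l N"
  proof -
    have "\<not> l dvd N" using k by (auto simp: l_def N_def level_def)
    thus ?thesis using l(1) prime_imp_coprime by blast
  qed
  obtain K where K: "\<And>n. \<not> l dvd n \<Longrightarrow> int m dvd fps_nth HH (l ^ K * n)"
    using coefficients_vanish_mod_prime[OF w0 m(1) l(1) _ l(2) Hm HH[unfolded N_def]] cop unfolding N_def by auto
  show ?thesis
  proof (rule progression_of_zeros[where l = l and N = N and M = "m * l ^ K" and s = k])
    show "l > 1" using l prime_gt_1_nat by blast
    show "coprime (m * l ^ K) N" using m(2) cop by (simp add: N_def)
    show "m * l ^ K > 0" using m0 \<open>l > 1\<close> by simp
    fix t n assume t: "\<not> l dvd t" "m * l ^ K * t = k + N * n"
    have "int m dvd fps_nth HH (l ^ K * t) - (fps_nth HH (l ^ K * t) - fps_nth FX (m * (l ^ K * t)))"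
      by (rule dvd_diff[OF K[OF t(1)] 5])
    hence "int m dvd fps_nth FX (k + N * n)" using t(2) by (simp add: mult.assoc)
    also have "fps_nth FX (k + N * n) = int (b_reg k n)"
      using N by (simp add: FX_def fps_X_power_mult_nth stretch_nth parts_fps_def b_reg_eq_parts)
    finally show "m dvd b_reg k n" by simp
  qed (use cop N in auto)
qed


section \<open>The five-regular partitions modulo five\<close>

text \<open>
  This is \<open>\<eta> ^ 4\<close>, of weight 2, with leading exponent \<open>4 / 24 = 1 / 6\<close>.
\<close>

definition eta4 :: "complex \<Rightarrow> complex" where
  "eta4 z = qn 6 z ^ 1 * inverse (exp (euler_log (qq z))) ^ 4"

lemma eta4_q_expansion: "q_expansion 6 (fps_nth (fps_X ^ 1 * eta_fps 6 4)) eta4"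
  unfolding eta4_def[abs_def] eta_fps_def
  by (intro q_expansion_mult q_expansion_X_power q_expansion_stretch[of 6 _ "\<lambda>x. inverse (exp (euler_log x)) ^ 4"]
      int_expansion_power euler_expansion) simp_all

lemma eta4_power_6: "eta4 z ^ 6 = Delta z"
proof -
  have "(x ^ 4) ^ 6 = x ^ 24" for x :: complex unfolding power_mult[symmetric] by simp
  moreover have "qn 6 z ^ 6 = qq z" by (rule qn_power_level) simp
  ultimately show ?thesis by (simp only: eta4_def Delta_eq power_mult_distrib power_one_right)
qed

lemma eta4_nonzero [simp]: "eta4 z \<noteq> 0" by (simp add: eta4_def)

lemma holomorphic_eta4: "eta4 holomorphic_on uhp"
proof -
  have "euler_log \<circ> qq holomorphic_on uhp"
    unfolding euler_log_def
  proof (rule holomorphic_on_compose_gen[OF _ holomorphic_eval_logser])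
    show "qq holomorphic_on uhp" unfolding qq_def[abs_def] by (intro holomorphic_intros)
  qed (use norm_qq_less in auto)
  thus ?thesis unfolding eta4_def[abs_def] qn_def o_def by (intro holomorphic_intros) auto
qed

lemma eta4_add_int: "eta4 (z + of_int n) = ex (of_int n / 6) * eta4 z"
proof -
  have "qn 6 (z + of_int n) = ex (of_int n / 6) * qn 6 z"
    unfolding qn_def ex_def exp_add[symmetric] by (rule arg_cong[of _ _ exp]) (simp add: field_simps)
  thus ?thesis by (simp only: eta4_def qq_add_int power_one_right mult.assoc)
qed

text \<open>
  The sign follows by comparing both sides at the fixed point \<open>\<i>\<close>.
\<close>

lemma eta4_inversion:
  assumes z: "z \<in> uhp" shows "eta4 (- 1 / z) = - (z ^ 2 * eta4 z)"
proof -
  define h where "h = (\<lambda>z. slash 2 Sm eta4 z / eta4 z)"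
  have "h holomorphic_on uhp" unfolding h_def
    by (intro holomorphic_on_divide holomorphic_slash holomorphic_eta4) auto
  moreover have "h z ^ 24 = 1" if z: "z \<in> uhp" for z
  proof -
    have z0: "z \<noteq> 0" using z by (auto simp: uhp_iff)
    have p: "x ^ 24 = (x ^ 6) ^ 4" for x :: complex by (simp add: power_mult[symmetric])
    have "h z ^ 24 = Delta (- 1 / z) ^ 4 / ((z ^ 2) ^ 24 * Delta z ^ 4)"
      unfolding h_def slash_def mact_Sm mj_Sm power_divide p[of "eta4 _"] eta4_power_6 by (simp add: mult.commute)
    also have "\<dots> = 1" unfolding Delta_inversion[OF z] using z0 by (simp add: power_mult_distrib power_mult[symmetric])
    finally show ?thesis .
  qed
  ultimately obtain c where c: "\<And>z. z \<in> uhp \<Longrightarrow> h z = c" by (rule constant_if_power_constant) auto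
  have "\<i> \<in> uhp" by (simp add: uhp_iff)
  from c[OF this] have "c = - 1" by (simp add: h_def slash_def)
  with c[OF z] have "eta4 (- 1 / z) / z ^ 2 / eta4 z = - 1" by (simp add: h_def slash_def)
  moreover have "z \<noteq> 0" using z by (auto simp: uhp_iff)
  hence "eta4 (- 1 / z) = (eta4 (- 1 / z) / z ^ 2 / eta4 z) * (z ^ 2 * eta4 z)" by simp
  ultimately show ?thesis by simp
qed

text \<open>
  The multiplier of \<open>\<eta> ^ 4\<close>, a character of \<open>SL\<^sub>2(\<int>)\<close> of order 6.
\<close>

definition chi6 :: "mat2 \<Rightarrow> complex" where
  "chi6 g = ex (of_int (psi2 (ma g) (mb g) (mc g) (md g)) / of_int 2) * ex (of_int (- psi3 (ma g) (mb g) (mc g) (md g)) / of_int 3)"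

lemma psi2_S: "agree_on_SL2_mod 2 (\<lambda>a b c d. psi2 b (- a) d (- c)) (\<lambda>a b c d. psi2 a b c d + 1)"
  and psi3_S: "agree_on_SL2_mod 3 (\<lambda>a b c d. psi3 b (- a) d (- c)) (\<lambda>a b c d. psi3 a b c d)"
  unfolding agree_on_SL2_mod_def psi3_def psi2_def by code_simp+

lemma chi6_steps:
  assumes g: "mdet g = 1"
  shows "chi6 (g * Tm 1) = ex (1 / 6) * chi6 g" "chi6 (g * Sm) = - chi6 g"
proof -
  define a b c d where abd: "a = ma g" "b = mb g" "c = mc g" "d = md g"
  have "a * d - b * c = 1" using g by (simp add: mdet_def abd)
  hence det': "[a * d - b * c = 1] (mod M)" for M by simp
  have e: "ex (1 / 2) * ex (- 1 / 3) = ex (1 / 6)" by (simp flip: ex_add)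
  have T2: "(psi2 a (a + b) c (c + d) - (psi2 a b c d + 1)) mod 2 = 0"
    by (rule agree_on_SL2_mod_apply[OF psi2_T]) (use det' in \<open>auto intro!: psi2_cong cong_add cong_diff cong_mult simp: Cong.cong_def[of _ "_ mod _"]\<close>)
  have T3: "(psi3 a (a + b) c (c + d) - (psi3 a b c d + 1)) mod 3 = 0"
    by (rule agree_on_SL2_mod_apply[OF psi3_T]) (use det' in \<open>auto intro!: psi3_cong cong_add cong_diff cong_mult simp: Cong.cong_def[of _ "_ mod _"]\<close>)
  have S2: "(psi2 b (- a) d (- c) - (psi2 a b c d + 1)) mod 2 = 0"
    by (rule agree_on_SL2_mod_apply[OF psi2_S]) (use det' in \<open>auto intro!: psi2_cong cong_add cong_diff cong_mult simp: Cong.cong_def[of _ "_ mod _"] cong_minus_minus_iff\<close>)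
  have S3: "(psi3 b (- a) d (- c) - psi3 a b c d) mod 3 = 0"
    by (rule agree_on_SL2_mod_apply[OF psi3_S]) (use det' in \<open>auto intro!: psi3_cong cong_add cong_diff cong_mult simp: Cong.cong_def[of _ "_ mod _"] cong_minus_minus_iff\<close>)
  have neg: "(- x - (- y + - t)) mod 3 = 0" if "(x - (y + t)) mod 3 = 0" for x y t :: int
  proof -
    have "- x - (- y + - t) = - (x - (y + t))" by simp
    thus ?thesis using that by (simp only: mod_eq_0_iff_dvd dvd_minus_iff)
  qed
  have sel: "ma (g * Tm 1) = a" "mb (g * Tm 1) = a + b" "mc (g * Tm 1) = c" "md (g * Tm 1) = c + d"
    "ma (g * Sm) = b" "mb (g * Sm) = - a" "mc (g * Sm) = d" "md (g * Sm) = - c"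
    "ma g = a" "mb g = b" "mc g = c" "md g = d"
    by (simp_all add: Tm_def Sm_def abd)
  have "chi6 (g * Tm 1) = chi6 g * (ex (of_int 1 / of_int 2) * ex (of_int (- 1) / of_int 3))"
    unfolding chi6_def sel by (simp only: ex_shift[OF T2] ex_shift[OF neg[OF T3]] mult_ac)
  also have "ex (of_int 1 / of_int 2) * ex (of_int (- 1) / of_int 3) = ex (1 / 6)" using e by simp
  finally show "chi6 (g * Tm 1) = ex (1 / 6) * chi6 g" by (simp only: mult.commute)
  have S3': "(psi3 b (- a) d (- c) - (psi3 a b c d + 0)) mod 3 = 0" using S3 by simp
  have "chi6 (g * Sm) = chi6 g * (ex (of_int 1 / of_int 2) * ex (of_int (- 0) / of_int 3))"
    unfolding chi6_def sel by (simp only: ex_shift[OF S2] ex_shift[OF neg[OF S3']] mult_ac)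
  thus "chi6 (g * Sm) = - chi6 g" by (simp add: ex_half)
qed

lemma chi6_Tm: assumes g: "mdet g = 1" shows "chi6 (g * Tm n) = ex (of_int n / 6) * chi6 g"
proof (induction n rule: int_induct[where k = 0])
  case base
  have "Tm 0 = 1" by (simp add: Tm_def one_mat2_def)
  thus ?case by simp
next
  case (step1 i)
  have "g * Tm (i + 1) = g * Tm i * Tm 1" by (simp add: mat2_eq_iff Tm_def algebra_simps)
  hence "chi6 (g * Tm (i + 1)) = ex (1 / 6) * chi6 (g * Tm i)" using chi6_steps(1)[of "g * Tm i"] g by simp
  moreover have "ex (of_int (i + 1) / 6) = ex (1 / 6) * ex (of_int i / 6)"
    unfolding ex_add[symmetric] by (rule arg_cong[of _ _ ex]) (simp add: field_simps)
  ultimately show ?case using step1 by (simp only: mult.assoc)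
next
  case (step2 i)
  have "g * Tm i = g * Tm (i - 1) * Tm 1" by (simp add: mat2_eq_iff Tm_def algebra_simps)
  hence "chi6 (g * Tm i) = ex (1 / 6) * chi6 (g * Tm (i - 1))" using chi6_steps(1)[of "g * Tm (i - 1)"] g by simp
  moreover have "ex (of_int i / 6) = ex (1 / 6) * ex (of_int (i - 1) / 6)"
    unfolding ex_add[symmetric] by (rule arg_cong[of _ _ ex]) (simp add: field_simps)
  ultimately have "ex (1 / 6) * chi6 (g * Tm (i - 1)) = ex (1 / 6) * (ex (of_int (i - 1) / 6) * chi6 g)"
    using step2 by (simp only: mult.assoc)
  thus ?case by (simp add: ex_def)
qed

lemma eta4_slash:
  assumes "mdet g = 1" "z \<in> uhp"
  shows "slash 2 g eta4 z = chi6 g * eta4 z"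
proof -
  have "\<forall>z\<in>uhp. slash 2 g eta4 z = chi6 g * eta4 z"
  proof (rule SL2_induct[OF assms(1)])
    show "\<forall>z\<in>uhp. slash 2 1 eta4 z = chi6 1 * eta4 z"
      by (simp add: chi6_def psi2_def psi3_def)
    fix g n assume g: "mdet g = 1" "\<forall>z\<in>uhp. slash 2 g eta4 z = chi6 g * eta4 z"
    show "\<forall>z\<in>uhp. slash 2 (g * Tm n) eta4 z = chi6 (g * Tm n) * eta4 z"
    proof
      fix z assume z: "z \<in> uhp"
      have "slash 2 (g * Tm n) eta4 z = slash 2 (Tm n) (slash 2 g eta4) z" using g z by (intro slash_mult) auto
      also have "\<dots> = slash 2 (Tm n) (\<lambda>z. chi6 g * eta4 z) z" by (rule slash_cong) (use g z in auto)
      finally show "slash 2 (g * Tm n) eta4 z = chi6 (g * Tm n) * eta4 z"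
        by (simp add: slash_def eta4_add_int chi6_Tm[OF g(1)])
    qed
    show "\<forall>z\<in>uhp. slash 2 (g * Sm) eta4 z = chi6 (g * Sm) * eta4 z"
    proof
      fix z assume z: "z \<in> uhp"
      have "slash 2 (g * Sm) eta4 z = slash 2 Sm (slash 2 g eta4) z" using g z by (intro slash_mult) auto
      also have "\<dots> = slash 2 Sm (\<lambda>z. chi6 g * eta4 z) z" by (rule slash_cong) (use g z in auto)
      finally show "slash 2 (g * Sm) eta4 z = chi6 (g * Sm) * eta4 z"
        using z eta4_inversion[OF z] by (auto simp: slash_def chi6_steps(2)[OF g(1)] uhp_iff)
    qed
  qed
  thus ?thesis using assms by blast
qed

lemma eta4_modular_form: "diagonal_character.modular_form 6 (\<lambda>_. 1) 2 0 eta4"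
proof -
  interpret diagonal_character 6 "\<lambda>_. 1" by standard auto
  have "decays 0 (slash 2 g eta4)" if g: "mdet g = 1" for g
  proof -
    have "decays (2 * pi * (real 0 / real 6)) eta4" by (rule q_expansion_decays[OF _ eta4_q_expansion]) simp_all
    hence "decays 0 (\<lambda>z. chi6 g * eta4 z)" by (intro decays_cmult) simp
    thus ?thesis by (subst decays_cong[OF eta4_slash[OF g]])
  qed
  moreover have "slash 2 g eta4 z = of_int 1 * eta4 z" if g: "g \<in> Gam" and z: "z \<in> uhp" for g z
  proof -
    have d: "mdet g = 1" using g by (simp add: Gam_def)
    obtain b c where b: "mb g = 6 * b" and c: "mc g = 6 * c" using g by (auto simp: Gam_def elim!: dvdE)
    have "ex (of_int (psi2 (ma g) (mb g) (mc g) (md g)) / of_int 2) = 1"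
      using ex_cong[of "psi2 (ma g) (mb g) (mc g) (md g)" 0 2] by (simp add: psi2_def b c)
    moreover have "ex (of_int (- psi3 (ma g) (mb g) (mc g) (md g)) / of_int 3) = 1"
      using ex_cong[of "- psi3 (ma g) (mb g) (mc g) (md g)" 0 3] by (simp add: psi3_def b c mod_eq_0_iff_dvd)
    ultimately show ?thesis using eta4_slash[OF d z] by (simp add: chi6_def)
  qed
  ultimately show ?thesis using holomorphic_eta4 unfolding modular_form_def by blast
qed

text \<open>
  The generating function of the 5-regular partitions as a quotient of Euler products; both sides have the same expansion in \<open>q\<close>.
\<close>

lemma regular_fps_eq: "parts_fps (\<lambda>i. \<not> 5 dvd i) = part_fps * stretch 5 euler_fps"
proof -
  let ?R = "parts_fps (\<lambda>i. \<not> 5 dvd i)" and ?S = "part_fps * stretch 5 euler_fps"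
  have 1: "q_expansion 1 (fps_nth (stretch 1 ?R)) (\<lambda>z. exp (eval_fps (logser (\<lambda>i. \<not> 5 dvd i)) (qq z)))"
    by (rule q_expansion_stretch[of 1 _ "\<lambda>x. exp (eval_fps (logser (\<lambda>i. \<not> 5 dvd i)) x)"]) (auto intro: parts_expansion)
  have 2: "q_expansion 1 (fps_nth (stretch 1 ?S)) (\<lambda>z. exp (euler_log (qq z)) * inverse (exp (euler_log (qq z ^ 5))))"
  proof (rule q_expansion_stretch[of 1 _ "\<lambda>x. exp (euler_log x) * inverse (exp (euler_log (x ^ 5)))"])
    have "int_expansion (stretch 5 euler_fps) (\<lambda>x. inverse (exp (euler_log (x ^ 5))))"
      by (rule int_expansion_stretch[OF euler_expansion]) simp
    thus "int_expansion ?S (\<lambda>x. exp (euler_log x) * inverse (exp (euler_log (x ^ 5))))"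
      by (rule int_expansion_mult[OF part_expansion])
  qed simp
  have "fps_nth (stretch 1 ?R) n - fps_nth (stretch 1 ?S) n = 0" for n
  proof (rule q_expansion_0_imp[OF _ q_expansion_diff[OF 1 2]])
    fix z assume "z \<in> uhp"
    from eval_logser_regular[OF _ norm_qq_less[OF this], of 5]
    show "exp (eval_fps (logser (\<lambda>i. \<not> 5 dvd i)) (qq z)) - exp (euler_log (qq z)) * inverse (exp (euler_log (qq z ^ 5))) = 0"
      by (simp add: euler_log_def exp_diff divide_inverse)
  qed simp
  thus ?thesis by (intro fps_ext) (simp add: stretch_nth)
qed

text \<open>
  The prime 5 divides the level of the general construction. But modulo 5 Euler's product satisfies
  \<open>\<Prod>(1 - q ^ (5 n)) = \<Prod>(1 - q ^ n) ^ 5\<close>, so that \<open>\<eta>(5 z) / \<eta>(z)\<close> can be replaced by \<open>\<eta>(z) ^ 4\<close>, which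
  is itself a holomorphic modular form, of level 6 and with trivial character.
\<close>

theorem zeros_mod_5_of_5_regular: "\<exists>n0 D. D > 0 \<and> (\<forall>u. 5 dvd b_reg 5 (n0 + D * u))"
proof -
  interpret diagonal_character 6 "\<lambda>_. 1" by standard auto
  have p5: "prime (5::nat)" and p7: "prime (7::nat)" by simp_all
  have cop: "coprime (7::nat) 6"
    by (rule prime_imp_coprime[OF p7]) simp
  have copi: "coprime (int 7) (int 6)" using cop by (simp only: coprime_int_iff)
  have "\<exists>K. \<forall>n. \<not> 7 dvd n \<longrightarrow> int 5 dvd fps_nth (fps_X ^ 1 * eta_fps 6 4) (7 ^ K * n)"
    by (rule coefficients_vanish_mod_prime[OF _ p5 p7 copi _ eta4_modular_form eta4_q_expansion]) simp_all
  then obtain K where K: "\<And>n. \<not> 7 dvd n \<Longrightarrow> int 5 dvd fps_nth (fps_X ^ 1 * eta_fps 6 4) (7 ^ K * n)"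
    by blast
  have "of_nat 5 dvd part_fps * (euler_fps ^ 5 - stretch 5 euler_fps)"
    by (rule dvd_mult[OF fps_power_prime_cong_stretch[OF p5]])
  also have "part_fps * (euler_fps ^ 5 - stretch 5 euler_fps) = euler_fps ^ 4 - parts_fps (\<lambda>i. \<not> 5 dvd i)"
  proof -
    have "part_fps * euler_fps ^ 5 = (part_fps * euler_fps) * euler_fps ^ 4"
      by (simp add: power_numeral_reduce mult_ac)
    thus ?thesis by (simp add: right_diff_distrib regular_fps_eq part_euler_inverse)
  qed
  finally have c: "int 5 dvd fps_nth (euler_fps ^ 4) n - int (b_reg 5 n)" for n
    unfolding of_nat_dvd_fps_iff by (simp add: parts_fps_def b_reg_eq_parts)
  show ?thesis
  proof (rule progression_of_zeros[where l = 7 and N = 6 and M = "7 ^ K" and s = 1])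
    show "coprime (7 ^ K) (6::nat)" using cop by simp
    fix t n assume t: "\<not> 7 dvd t" "7 ^ K * t = 1 + 6 * (n::nat)"
    have "int 5 dvd fps_nth (fps_X ^ 1 * eta_fps 6 4) (1 + 6 * n)" using K[OF t(1)] t(2) by simp
    also have "fps_nth (fps_X ^ 1 * eta_fps 6 4) (1 + 6 * n) = fps_nth (euler_fps ^ 4) n"
      unfolding fps_X_power_mult_nth by (simp add: eta_fps_def stretch_nth)
    finally have "int 5 dvd fps_nth (euler_fps ^ 4) n - (fps_nth (euler_fps ^ 4) n - int (b_reg 5 n))"
      using c by (rule dvd_diff)
    hence "int 5 dvd int (b_reg 5 n)" by simp
    thus "5 dvd b_reg 5 n" by (simp only: of_nat_dvd_iff)
  qed (use cop in auto)
qed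

section \<open>Regular partitions modulo primes\<close>

theorem corollary1p2:
  fixes m k :: nat
  assumes "prime m" and "m \<ge> 5" and "k \<in> {3, 5}"
  shows "infinite {n::nat. 0 < n \<and> [b_reg k n = 0] (mod m)} \<and>
    (\<exists>c::real. 0 < c \<and>
      (\<forall>\<^sub>F X :: real in at_top.
        real (card {n::nat. real n \<le> X \<and> [b_reg k n = 0] (mod m)}) \<ge> c * X))"
proof -
  have "\<exists>n0 D. D > 0 \<and> (\<forall>u. m dvd b_reg k (n0 + D * u))"
  proof (cases "m = 5 \<and> k = 5")
    case True
    thus ?thesis using zeros_mod_5_of_5_regular by simp
  next
    case False
    have "\<not> m dvd level k"
    proof
      assume "m dvd level k"
      moreover have "level k = 2 * 3 * (if k = 3 then 6 else 5)" using assms(3) by (auto simp: level_def)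
      ultimately have "m dvd 2 \<or> m dvd 3 \<or> m dvd (if k = 3 then 6 else 5)"
        by (simp only: prime_dvd_mult_iff[OF assms(1)] disj_assoc)
      moreover have "(6::nat) = 2 * 3" by simp
      ultimately have "m dvd 2 \<or> m dvd 3 \<or> (m dvd 5 \<and> k = 5)"
        using prime_dvd_mult_iff[OF assms(1), of 2 3] assms(3) by (auto split: if_splits)
      hence "m \<le> 5 \<and> (m = 5 \<longrightarrow> k = 5)" using assms(2) by (auto dest!: dvd_imp_le)
      thus False using assms(2) False by simp
    qed
    hence "coprime m (level k)" using assms(1) prime_imp_coprime by blast
    thus ?thesis using zeros_coprime_to_level assms by blast
  qed
  then obtain n0 D where "D > 0" "\<And>u. n0 + D * u \<in> {n. [b_reg k n = 0] (mod m)}"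
    by (auto simp: cong_0_iff)
  from positive_density_of_progression[OF this] show ?thesis
    by (simp add: conj_commute)
qed

end
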